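(* Let $\Lambda\colon V\times V\to\mathbb{K}$ be an even continuous bilinear form, let $\frac12\le R<1$ and let $\varphi\in V'$ be even. If $\varphi$ is in the image of $\sharp$, then $\tau_\varphi^*$ is an inner automorphism of $\widehat{\mathcal{W}}_R(V,\star_{z\Lambda})$ for all $z\in\mathbb{K}$, $z\ne0$. In fact, $$\tau_\varphi^*(a)=\operatorname{Exp}_{\star_{z\Lambda}}(w)\star_{z\Lambda}a\star_{z\Lambda}\operatorname{Exp}_{\star_{z\Lambda}}(-w)$$ for all $a\in\widehat{\mathcal{W}}_R(V,\star_{z\Lambda})$, where $w\in V_{\mathbf 0}$ is such that $2zw^\sharp=\varphi$.
   Context: $\mathbb{K}=\mathbb{R}$ or $\mathbb{C}$, and $V=V_{\mathbf 0}\oplus V_{\mathbf 1}$ is a $\mathbb{Z}_2$-graded Hausdorff locally convex $\mathbb{K}$-vector space with continuous projections onto $V_{\mathbf 0}$, $V_{\mathbf 1}$; $V'$ is its topological dual and $V^*$ its algebraic dual; $\varphi\in V'$ is even if $\varphi|_{V_{\mathbf 1}}=0$. In exponents of $-1$ a homogeneous vector denotes its parity. Symmetric algebra: $S_n$ acts from the right on $V^{\otimes n}$ by $(v_1\otimes\cdots\otimes v_n)\triangleleft\sigma=\pm\, v_{\sigma(1)}\otimes\cdots\otimes v_{\sigma(n)}$ for homogeneous $v_i$, where $\pm$ is the Koszul sign ($-1$ to the number of pairs $i<j$ with $\sigma(i)>\sigma(j)$ and $v_{\sigma(i)},v_{\sigma(j)}$ both odd). $\mathcal{S}_n(v)=\frac1{n!}\sum_{\sigma}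 v\triangleleft\sigma$, $\mathrm{S}^n(V)=\operatorname{im}\mathcal{S}_n\subseteq V^{\otimes n}$, $\mathrm{S}^0(V)=\mathbb{K}$, $\mathrm{S}^\bullet(V)=\bigoplus_n \mathrm{S}^n(V)$, with product $\mu(v\otimes w)=vw=\mathcal{S}(v\otimes w)$, $\mathcal{S}=\bigoplus_n\mathcal{S}_n$. $\Lambda$ is even if $\Lambda(v,w)=0$ for homogeneous $v,w$ of different parity. $\Lambda_-(v,w)=\frac12(\Lambda(v,w)-(-1)^{vw}\Lambda(w,v))$ for homogeneous $v,w$, and $\sharp\colon V\to V^*$, $v\mapsto v^\sharp=\Lambda_-(v,\cdot)$. $P_\Lambda$ is the linear extension of $$P_\Lambda(v_1\cdots v_n\otimes w_1\cdots w_m)=\sum_{k=1}^n\sum_{\ell=1}^m(-1)^{v_k(v_{k+1}+\cdots+v_n)+w_\ell(w_1+\cdots+w_{\ell-1})}\Lambda(v_k,w_\ell)\,v_1\cdots\widehat{v_k}\cdots v_n\otimes w_1\cdots\widehat{w_\ell}\cdots w_m$$ on $\mathrm{S}^\bullet(V)\otimes \mathrm{S}^\bullet(V)$ (homogeneous vectors; hats denote omission; $P_\Lambda$ vanishes if one factor is in $\mathrm{S}^0(V)$), and $a\star_{z\Lambda}b=\sum_{k\ge0}\frac{z^k}{k!}\mu(P_\Lambda^k(a\otimes b))$. Topology: for a continuous seminorm $p$ on $V$ let $p^n$ be the projective tensor seminorm on $V^{\otimes n}$ ($p^0=|\cdot|$) and $p_R(v)=\sum_np^n(v_n)\,n!^R$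 for $v=\sum_nv_n$. $\mathcal{W}_R(V,\star_{z\Lambda})$ is $\mathrm{S}^\bullet(V)$ with product $\star_{z\Lambda}$ and the topology of all $p_R$ ($p$ a continuous seminorm on $V$). For $R\ge\frac12$ the product is continuous and extends to the completion $\widehat{\mathcal{W}}_R(V,\star_{z\Lambda})$. $\tau_\varphi^*$ is the unital algebra automorphism of $\mathrm{S}^\bullet(V)$ (for the symmetric product and for $\star_{z\Lambda}$) with $v\mapsto v+\varphi(v)1$ for $v\in V$, and its continuous extension to the completion. For $w\in V_{\mathbf 0}$, $\operatorname{Exp}_{\star_{z\Lambda}}(w)=\sum_{n\ge0}\frac1{n!}w\star_{z\Lambda}\cdots\star_{z\Lambda}w$ ($n$ factors), which converges absolutely in $\widehat{\mathcal{W}}_R(V,\star_{z\Lambda})$ for $\frac12\le R<1$. *)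

theory Defs
  imports "HOL-Analysis.Analysis" "HOL-Library.Function_Algebras" "HOL-Combinatorics.Permutations"
begin

(* The ground field is a type 'k :: real_normed_field.  Its norm is multiplicative, so by the
   Gelfand-Mazur theorem the only instances are the reals and the complex numbers with their
   absolute values. *)

section \<open>Linear extension, continuous extension, automorphisms\<close>

definition fscale :: "'k \<Rightarrow> ('x \<Rightarrow> 'k) \<Rightarrow> ('x \<Rightarrow> 'k::real_normed_field)" where
  "fscale c F = (\<lambda>x. c * F x)"

(* The value at t of the linear map that is defined on the span of the first components of G by
   "x is mapped to y" for (x, y) in G: the graph of that map is the span of G. *)
definition lin_ext ::
  "(('x \<Rightarrow> 'k::real_normed_field) \<times> ('y \<Rightarrow> 'k)) set \<Rightarrow> ('x \<Rightarrow> 'k) \<Rightarrow> ('y \<Rightarrow> 'k)" where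
  "lin_ext G t = (THE u. (t, u) \<in> module.span (\<lambda>c (x, y). (fscale c x, fscale c y)) G)"

(* The projection onto A along B, for a space that is the direct sum of A and B. *)
definition proj_along :: "'v::ab_group_add set \<Rightarrow> 'v set \<Rightarrow> 'v \<Rightarrow> 'v" where
  "proj_along A B v = (THE x. x \<in> A \<and> v - x \<in> B)"

(* Both are meant for j mapping S onto a dense subset, where a continuous extension is unique. *)
definition cont_ext1 ::
  "('t \<Rightarrow> 'w::t2_space) \<Rightarrow> 't set \<Rightarrow> ('t \<Rightarrow> 't) \<Rightarrow> ('w \<Rightarrow> 'w)" where
  "cont_ext1 j S f = (THE g. continuous_on UNIV g \<and> (\<forall>a\<in>S. g (j a) = j (f a)))"

definition cont_ext2 ::
  "('t \<Rightarrow> 'w::t2_space) \<Rightarrow> 't set \<Rightarrow> ('t \<Rightarrow> 't \<Rightarrow> 't) \<Rightarrow> ('w \<Rightarrow> 'w \<Rightarrow> 'w)" where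
  "cont_ext2 j S m = (THE g. continuous_on UNIV (\<lambda>(x, y). g x y) \<and>
     (\<forall>a\<in>S. \<forall>b\<in>S. g (j a) (j b) = j (m a b)))"

definition unital_algebra_automorphism ::
  "('k \<Rightarrow> 'a \<Rightarrow> 'a) \<Rightarrow> 'a::ab_group_add set \<Rightarrow> ('a \<Rightarrow> 'a \<Rightarrow> 'a) \<Rightarrow> 'a \<Rightarrow> ('a \<Rightarrow> 'a) \<Rightarrow> bool" where
  "unital_algebra_automorphism sc A mul one f \<longleftrightarrow>
     bij_betw f A A \<and>
     (\<forall>a\<in>A. \<forall>b\<in>A. f (a + b) = f a + f b) \<and>
     (\<forall>c. \<forall>a\<in>A. f (sc c a) = sc c (f a)) \<and>
     (\<forall>a\<in>A. \<forall>b\<in>A. f (mul a b) = mul (f a) (f b)) \<and>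
     f one = one"

definition inner_automorphism ::
  "('k \<Rightarrow> 'a \<Rightarrow> 'a) \<Rightarrow> 'a::ab_group_add set \<Rightarrow> ('a \<Rightarrow> 'a \<Rightarrow> 'a) \<Rightarrow> 'a \<Rightarrow> ('a \<Rightarrow> 'a) \<Rightarrow> bool" where
  "inner_automorphism sc A mul one f \<longleftrightarrow>
     unital_algebra_automorphism sc A mul one f \<and>
     (\<exists>u\<in>A. \<exists>u'\<in>A. mul u u' = one \<and> mul u' u = one \<and> (\<forall>a\<in>A. f a = mul (mul u a) u'))"

section \<open>Graded locally convex spaces\<close>

definition seminorm :: "('k::real_normed_field \<Rightarrow> 'v::ab_group_add \<Rightarrow> 'v) \<Rightarrow> ('v \<Rightarrow> real) \<Rightarrow> bool" where
  "seminorm sc p \<longleftrightarrow>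
     (\<forall>c v. p (sc c v) = norm c * p v) \<and> (\<forall>v w. p (v + w) \<le> p v + p w)"

definition cont_seminorm ::
  "('k::real_normed_field \<Rightarrow> 'v::{ab_group_add,topological_space} \<Rightarrow> 'v) \<Rightarrow> ('v \<Rightarrow> real) \<Rightarrow> bool" where
  "cont_seminorm sc p \<longleftrightarrow> seminorm sc p \<and> continuous_on UNIV p"

locale graded_lcs = vector_space scale
  for scale :: "'k::real_normed_field \<Rightarrow> 'v::{t2_space,topological_ab_group_add} \<Rightarrow> 'v" +
  fixes V0 V1 :: "'v set"
  assumes continuous_scale: "continuous_on UNIV (\<lambda>(c, v). scale c v)"
    and locally_convex:
      "\<And>U. open U \<Longrightarrow> 0 \<in> U \<Longrightarrow> \<exists>p. cont_seminorm scale p \<and> {v. p v < 1} \<subseteq> U"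
    and subspace_V0: "subspace V0"
    and subspace_V1: "subspace V1"
    and V0_Int_V1: "V0 \<inter> V1 = {0}"
    and V0_plus_V1: "\<And>v. \<exists>x\<in>V0. \<exists>y\<in>V1. v = x + y"
    and continuous_proj0: "continuous_on UNIV (proj_along V0 V1)"
    and continuous_proj1: "continuous_on UNIV (proj_along V1 V0)"
begin

definition homogeneous :: "'v \<Rightarrow> bool" where
  "homogeneous v \<longleftrightarrow> v \<in> V0 \<union> V1"

(* The parity of a homogeneous vector; 0 is homogeneous of both parities, and wherever it
   occurs below the sign that its parity contributes to stands in front of a vanishing term. *)
definition par :: "'v \<Rightarrow> nat" where
  "par v = (if v \<in> V0 then 0 else 1)"

definition continuous_linear_form :: "('v \<Rightarrow> 'k) \<Rightarrow> bool" where
  "continuous_linear_form f \<longleftrightarrow> Vector_Spaces.linear scale (*) f \<and> continuous_on UNIV f"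

definition even_linear_form :: "('v \<Rightarrow> 'k) \<Rightarrow> bool" where
  "even_linear_form f \<longleftrightarrow> (\<forall>v\<in>V1. f v = 0)"

definition continuous_bilinear_form :: "('v \<Rightarrow> 'v \<Rightarrow> 'k) \<Rightarrow> bool" where
  "continuous_bilinear_form \<Lambda> \<longleftrightarrow>
     (\<forall>v. Vector_Spaces.linear scale (*) (\<Lambda> v)) \<and>
     (\<forall>w. Vector_Spaces.linear scale (*) (\<lambda>v. \<Lambda> v w)) \<and>
     continuous_on UNIV (\<lambda>(v, w). \<Lambda> v w)"

definition even_bilinear_form :: "('v \<Rightarrow> 'v \<Rightarrow> 'k) \<Rightarrow> bool" where
  "even_bilinear_form \<Lambda> \<longleftrightarrow> (\<forall>v\<in>V0. \<forall>w\<in>V1. \<Lambda> v w = 0 \<and> \<Lambda> w v = 0)"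

(* The formula for homogeneous v, w, extended bilinearly: only the components v1, w1 that are
   both odd receive the sign. *)
definition Lambda_minus :: "('v \<Rightarrow> 'v \<Rightarrow> 'k) \<Rightarrow> 'v \<Rightarrow> 'v \<Rightarrow> 'k" where
  "Lambda_minus \<Lambda> v w =
     (let v0 = proj_along V0 V1 v; v1 = proj_along V1 V0 v;
          w0 = proj_along V0 V1 w; w1 = proj_along V1 V0 w
      in 1/2 * ((\<Lambda> v0 w0 - \<Lambda> w0 v0) + (\<Lambda> v0 w1 - \<Lambda> w1 v0)
              + (\<Lambda> v1 w0 - \<Lambda> w0 v1) + (\<Lambda> v1 w1 + \<Lambda> w1 v1)))"

definition sharp :: "('v \<Rightarrow> 'v \<Rightarrow> 'k) \<Rightarrow> 'v \<Rightarrow> ('v \<Rightarrow> 'k)" where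
  "sharp \<Lambda> v = Lambda_minus \<Lambda> v"

section \<open>Tensors\<close>

(* Functions on lists whose restriction to the lists of each length n is n-linear. *)
definition multilinear :: "('v list \<Rightarrow> 'k) \<Rightarrow> bool" where
  "multilinear f \<longleftrightarrow>
     (\<forall>us u v ws. f (us @ (u + v) # ws) = f (us @ u # ws) + f (us @ v # ws)) \<and>
     (\<forall>us c u ws. f (us @ (scale c u) # ws) = c * f (us @ u # ws))"

(* v1 \<otimes> ... \<otimes> vn is realised as evaluation of multilinear forms at (v1, ..., vn).  Multilinear
   forms on a vector space separate the points of its algebraic tensor powers, so the span of
   these evaluations is the algebraic tensor algebra. *)
definition tensor :: "'v list \<Rightarrow> (('v list \<Rightarrow> 'k) \<Rightarrow> 'k)" where
  "tensor vs = (\<lambda>f. if multilinear f then f vs else 0)"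

definition tensor_power :: "nat \<Rightarrow> (('v list \<Rightarrow> 'k) \<Rightarrow> 'k) set" where
  "tensor_power n = module.span fscale {tensor vs |vs. length vs = n}"

definition tensor_algebra :: "(('v list \<Rightarrow> 'k) \<Rightarrow> 'k) set" where
  "tensor_algebra = module.span fscale (range tensor)"

definition component :: "nat \<Rightarrow> (('v list \<Rightarrow> 'k) \<Rightarrow> 'k) \<Rightarrow> (('v list \<Rightarrow> 'k) \<Rightarrow> 'k)" where
  "component n = lin_ext {(tensor vs, if length vs = n then tensor vs else 0) |vs. True}"

(* The element s \<otimes> t of the tensor square of the tensor algebra, realised likewise as evaluation
   of bilinear forms on the tensor algebra. *)
definition tensor_pair ::
  "(('v list \<Rightarrow> 'k) \<Rightarrow> 'k) \<Rightarrow> (('v list \<Rightarrow> 'k) \<Rightarrow> 'k) \<Rightarrow>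
   (((('v list \<Rightarrow> 'k) \<Rightarrow> 'k) \<Rightarrow> (('v list \<Rightarrow> 'k) \<Rightarrow> 'k) \<Rightarrow> 'k) \<Rightarrow> 'k)" where
  "tensor_pair s t = (\<lambda>B.
     if (\<forall>a\<in>tensor_algebra. \<forall>b\<in>tensor_algebra. \<forall>c\<in>tensor_algebra.
           B (a + b) c = B a c + B b c \<and> B c (a + b) = B c a + B c b) \<and>
        (\<forall>r. \<forall>a\<in>tensor_algebra. \<forall>b\<in>tensor_algebra.
           B (fscale r a) b = r * B a b \<and> B a (fscale r b) = r * B a b)
     then B s t else 0)"

(* The identification of v1...vn \<otimes> w1...wm with an element of the tensor algebra. *)
definition concatenation ::
  "(((('v list \<Rightarrow> 'k) \<Rightarrow> 'k) \<Rightarrow> (('v list \<Rightarrow> 'k) \<Rightarrow> 'k) \<Rightarrow> 'k) \<Rightarrow> 'k) \<Rightarrow> (('v list \<Rightarrow> 'k) \<Rightarrow> 'k)" where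
  "concatenation =
     lin_ext {(tensor_pair (tensor vs) (tensor ws), tensor (vs @ ws)) |vs ws. True}"

section \<open>The symmetric algebra\<close>

definition koszul_sign :: "'v list \<Rightarrow> (nat \<Rightarrow> nat) \<Rightarrow> 'k" where
  "koszul_sign vs \<sigma> = (- 1) ^ card {(i, j). i < j \<and> j < length vs \<and> \<sigma> i > \<sigma> j \<and>
     par (vs ! \<sigma> i) = 1 \<and> par (vs ! \<sigma> j) = 1}"

(* The right action of a permutation of {..<n} on the n-th tensor power. *)
definition perm_action ::
  "nat \<Rightarrow> (nat \<Rightarrow> nat) \<Rightarrow> (('v list \<Rightarrow> 'k) \<Rightarrow> 'k) \<Rightarrow> (('v list \<Rightarrow> 'k) \<Rightarrow> 'k)" where
  "perm_action n \<sigma> = lin_ext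
     {(tensor vs, fscale (koszul_sign vs \<sigma>) (tensor (map (\<lambda>i. vs ! \<sigma> i) [0..<n]))) |vs.
        length vs = n \<and> (\<forall>v\<in>set vs. homogeneous v)}"

definition symmetrizer_deg :: "nat \<Rightarrow> (('v list \<Rightarrow> 'k) \<Rightarrow> 'k) \<Rightarrow> (('v list \<Rightarrow> 'k) \<Rightarrow> 'k)" where
  "symmetrizer_deg n t = fscale (1 / fact n) (\<Sum>\<sigma> | \<sigma> permutes {..<n}. perm_action n \<sigma> t)"

definition symmetrizer :: "(('v list \<Rightarrow> 'k) \<Rightarrow> 'k) \<Rightarrow> (('v list \<Rightarrow> 'k) \<Rightarrow> 'k)" where
  "symmetrizer t = (\<Sum>n | component n t \<noteq> 0. symmetrizer_deg n (component n t))"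

definition sym_power :: "nat \<Rightarrow> (('v list \<Rightarrow> 'k) \<Rightarrow> 'k) set" where
  "sym_power n = symmetrizer_deg n ` tensor_power n"

definition sym_algebra :: "(('v list \<Rightarrow> 'k) \<Rightarrow> 'k) set" where
  "sym_algebra = module.span fscale (\<Union>n. sym_power n)"

definition unit :: "('v list \<Rightarrow> 'k) \<Rightarrow> 'k" where
  "unit = tensor []"

definition incl :: "'v \<Rightarrow> (('v list \<Rightarrow> 'k) \<Rightarrow> 'k)" where
  "incl v = tensor [v]"

definition mu ::
  "(((('v list \<Rightarrow> 'k) \<Rightarrow> 'k) \<Rightarrow> (('v list \<Rightarrow> 'k) \<Rightarrow> 'k) \<Rightarrow> 'k) \<Rightarrow> 'k) \<Rightarrow> (('v list \<Rightarrow> 'k) \<Rightarrow> 'k)" where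
  "mu u = symmetrizer (concatenation u)"

definition sym_mult ::
  "(('v list \<Rightarrow> 'k) \<Rightarrow> 'k) \<Rightarrow> (('v list \<Rightarrow> 'k) \<Rightarrow> 'k) \<Rightarrow> (('v list \<Rightarrow> 'k) \<Rightarrow> 'k)" where
  "sym_mult a b = mu (tensor_pair a b)"

definition sym_prod :: "'v list \<Rightarrow> (('v list \<Rightarrow> 'k) \<Rightarrow> 'k)" where
  "sym_prod vs = foldr (\<lambda>v a. sym_mult (incl v) a) vs unit"

section \<open>The star product\<close>

definition omit :: "nat \<Rightarrow> 'v list \<Rightarrow> 'v list" where
  "omit k vs = take k vs @ drop (Suc k) vs"

definition P_Lambda ::
  "('v \<Rightarrow> 'v \<Rightarrow> 'k) \<Rightarrow>
   (((('v list \<Rightarrow> 'k) \<Rightarrow> 'k) \<Rightarrow> (('v list \<Rightarrow> 'k) \<Rightarrow> 'k) \<Rightarrow> 'k) \<Rightarrow> 'k) \<Rightarrow>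
   (((('v list \<Rightarrow> 'k) \<Rightarrow> 'k) \<Rightarrow> (('v list \<Rightarrow> 'k) \<Rightarrow> 'k) \<Rightarrow> 'k) \<Rightarrow> 'k)" where
  "P_Lambda \<Lambda> = lin_ext
     {(tensor_pair (sym_prod vs) (sym_prod ws),
       \<Sum>k<length vs. \<Sum>l<length ws.
         fscale ((- 1) ^ (par (vs ! k) * (\<Sum>i\<in>{k<..<length vs}. par (vs ! i))
                          + par (ws ! l) * (\<Sum>i<l. par (ws ! i)))
                 * \<Lambda> (vs ! k) (ws ! l))
           (tensor_pair (sym_prod (omit k vs)) (sym_prod (omit l ws)))) |vs ws.
        (\<forall>v\<in>set vs. homogeneous v) \<and> (\<forall>w\<in>set ws. homogeneous w)}"

(* P_Lambda lowers degrees, so only finitely many summands are nonzero. *)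
definition star ::
  "('v \<Rightarrow> 'v \<Rightarrow> 'k) \<Rightarrow> 'k \<Rightarrow>
   (('v list \<Rightarrow> 'k) \<Rightarrow> 'k) \<Rightarrow> (('v list \<Rightarrow> 'k) \<Rightarrow> 'k) \<Rightarrow> (('v list \<Rightarrow> 'k) \<Rightarrow> 'k)" where
  "star \<Lambda> z a b =
     (\<Sum>k | (P_Lambda \<Lambda> ^^ k) (tensor_pair a b) \<noteq> 0.
        fscale (z ^ k / fact k) (mu ((P_Lambda \<Lambda> ^^ k) (tensor_pair a b))))"

definition star_power ::
  "('v \<Rightarrow> 'v \<Rightarrow> 'k) \<Rightarrow> 'k \<Rightarrow> (('v list \<Rightarrow> 'k) \<Rightarrow> 'k) \<Rightarrow> nat \<Rightarrow> (('v list \<Rightarrow> 'k) \<Rightarrow> 'k)" where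
  "star_power \<Lambda> z a n = (star \<Lambda> z a ^^ n) unit"

(* Since the vectors generate the symmetric algebra, f is unique; extensionality only fixes the
   values outside of it. *)
definition tau :: "('v \<Rightarrow> 'k) \<Rightarrow> (('v list \<Rightarrow> 'k) \<Rightarrow> 'k) \<Rightarrow> (('v list \<Rightarrow> 'k) \<Rightarrow> 'k)" where
  "tau \<phi> = (THE f. f \<in> extensional sym_algebra \<and>
     unital_algebra_automorphism fscale sym_algebra sym_mult unit f \<and>
     (\<forall>v. f (incl v) = incl v + fscale (\<phi> v) unit))"

section \<open>Topology and completion\<close>

(* The scalar coefficients matter only for n = 0, where the result is
   the absolute value. *)
definition proj_seminorm :: "('v \<Rightarrow> real) \<Rightarrow> nat \<Rightarrow> (('v list \<Rightarrow> 'k) \<Rightarrow> 'k) \<Rightarrow> real" where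
  "proj_seminorm p n t = Inf {\<Sum>(c, vs)\<leftarrow>xs. norm c * prod_list (map p vs) |xs.
     (\<forall>(c, vs)\<in>set xs. length vs = n) \<and> t = (\<Sum>(c, vs)\<leftarrow>xs. fscale c (tensor vs))}"

definition weyl_seminorm :: "real \<Rightarrow> ('v \<Rightarrow> real) \<Rightarrow> (('v list \<Rightarrow> 'k) \<Rightarrow> 'k) \<Rightarrow> real" where
  "weyl_seminorm R p t =
     (\<Sum>n | component n t \<noteq> 0. proj_seminorm p n (component n t) * fact n powr R)"

(* The seminorms are directed, so balls of single seminorms form neighbourhood bases. *)
definition weyl_topology :: "real \<Rightarrow> (('v list \<Rightarrow> 'k) \<Rightarrow> 'k) topology" where
  "weyl_topology R = topology (\<lambda>U. U \<subseteq> sym_algebra \<and>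
     (\<forall>a\<in>U. \<exists>p e. cont_seminorm scale p \<and> e > 0 \<and>
        {b \<in> sym_algebra. weyl_seminorm R p (b - a) < e} \<subseteq> U))"

(* The completion is unique up to isomorphism; it is given by any complete Hausdorff topological
   vector space 'w (with scalar multiplication scaleW) and a linear topological embedding j of the
   symmetric algebra onto a dense subspace.  In the class uniform_topological_group_add the
   uniformity is the canonical one of the additive topological group. *)
definition is_completion ::
  "real \<Rightarrow> ('k \<Rightarrow> 'w \<Rightarrow> 'w::{t2_space,ab_group_add,uniform_topological_group_add}) \<Rightarrow>
   ((('v list \<Rightarrow> 'k) \<Rightarrow> 'k) \<Rightarrow> 'w) \<Rightarrow> bool" where
  "is_completion R scaleW j \<longleftrightarrow>
     vector_space scaleW \<and>
     continuous_on UNIV (\<lambda>(c, x). scaleW c x) \<and>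
     (\<forall>a\<in>sym_algebra. \<forall>b\<in>sym_algebra. j (a + b) = j a + j b) \<and>
     (\<forall>c. \<forall>a\<in>sym_algebra. j (fscale c a) = scaleW c (j a)) \<and>
     embedding_map (weyl_topology R) euclidean j \<and>
     closure (j ` sym_algebra) = UNIV \<and>
     complete (UNIV :: 'w set)"

definition star_hat ::
  "((('v list \<Rightarrow> 'k) \<Rightarrow> 'k) \<Rightarrow> 'w::t2_space) \<Rightarrow> ('v \<Rightarrow> 'v \<Rightarrow> 'k) \<Rightarrow> 'k \<Rightarrow> 'w \<Rightarrow> 'w \<Rightarrow> 'w" where
  "star_hat j \<Lambda> z = cont_ext2 j sym_algebra (star \<Lambda> z)"

definition tau_hat ::
  "((('v list \<Rightarrow> 'k) \<Rightarrow> 'k) \<Rightarrow> 'w::t2_space) \<Rightarrow> ('v \<Rightarrow> 'k) \<Rightarrow> 'w \<Rightarrow> 'w" where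
  "tau_hat j \<phi> = cont_ext1 j sym_algebra (tau \<phi>)"

definition Exp_star ::
  "('k \<Rightarrow> 'w \<Rightarrow> 'w) \<Rightarrow> ((('v list \<Rightarrow> 'k) \<Rightarrow> 'k) \<Rightarrow> 'w::{t2_space,comm_monoid_add}) \<Rightarrow>
   ('v \<Rightarrow> 'v \<Rightarrow> 'k) \<Rightarrow> 'k \<Rightarrow> 'v \<Rightarrow> 'w" where
  "Exp_star scaleW j \<Lambda> z w = (\<Sum>n. scaleW (1 / fact n) (j (star_power \<Lambda> z (incl w) n)))"

end

end

theory Submission
  imports Defs
begin

text \<open>
  Tensors are functionals on multilinear forms, so every operator on tensors is the transpose of
  an operator on forms: symmetrization of a tensor means evaluation at the symmetrized form, and
  \<open>P_Lambda\<close> becomes a contraction that acts as a graded derivation in each argument.  That the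
  contractions are derivations gives associativity of the star product by induction on the degree
  of the left factor, and it shows that for even \<open>w\<close> the star commutator with \<open>w\<close> is the derivation
  \<open>D\<close> of the symmetric algebra with \<open>D v = 2 z w\<^sup>\<sharp>(v) = \<phi>(v)\<close>.  It is locally nilpotent, and its
  exponential is the translation automorphism, so on the symmetric algebra the Cauchy product of
  \<open>Exp(w)\<close>, \<open>a\<close> and \<open>Exp(- w)\<close> is the finite sum of the \<open>D\<^sup>k a / k!\<close>, that is \<open>\<tau> a\<close>.

  For \<open>R \<ge> 1/2\<close> the inequality \<open>k! \<le> (k!)\<^sup>R (k!)\<^sup>R\<close> compensates the number of \<open>k\<close>-fold contractions, so
  the star product is continuous.  The series of \<open>Exp(w)\<close> converges for \<open>R < 1\<close> since
  \<open>(n!)\<^sup>R / n!\<close> decays faster than every geometric sequence.  Density of the symmetric algebra then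
  carries the formula over to the completion, where \<open>Exp(w)\<close> and \<open>Exp(- w)\<close> are inverse to each other.
\<close>

text \<open>Two obstacles shape the proof. The operators in the definitions are definite
  descriptions of linear extensions, prescribed on homogeneous words with signs read off from
  \<open>par\<close>; before anything can be computed, an explicit map must be found that is linear
  everywhere. Therefore vectors are split by the projections, signs become a linear grading
  operator, and \<Lambda> is cut into an even and an odd part, each of which gives contractions of a
  definite parity. The second obstacle is analytic. The continuity estimate of the product enlarges
  the seminorm, so it cannot be iterated along star powers; the terms of the exponential are bounded
  through a closed formula in symmetric powers of \<open>w\<close> instead. Moreover the product is
  in general not uniformly continuous, so its extension to the completion rests on Cauchy filters at
  single points. The factor 2 in \<open>2 * z * sharp \<Lambda> w v\<close> undoes the 1/2 in
  \<open>Lambda_minus\<close>, and an even \<open>w\<close> exists because an even \<phi> sees only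
  the even component of a preimage under \<open>sharp\<close>.\<close>

lemma vector_space_fscale: "vector_space (fscale :: 'k::real_normed_field \<Rightarrow> ('x \<Rightarrow> 'k) \<Rightarrow> ('x \<Rightarrow> 'k))"
  by unfold_locales (auto simp: fscale_def fun_eq_iff algebra_simps)

interpretation fs: vector_space "fscale :: 'k::real_normed_field \<Rightarrow> ('x \<Rightarrow> 'k) \<Rightarrow> ('x \<Rightarrow> 'k)"
  by (rule vector_space_fscale)

lemma fscale_apply [simp]: "fscale c F x = c * F x"
  by (simp add: fscale_def)

lemma sum_fun_apply: "(\<Sum>i\<in>A. F i) x = (\<Sum>i\<in>A. F i x)"
  by (induction A rule: infinite_finite_induct) auto

text \<open>Parities are booleans with \<open>True\<close> for odd, which lets sums over both
  parities run over \<open>UNIV\<close>.\<close>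

definition ksign :: "bool \<Rightarrow> bool \<Rightarrow> 'k::real_normed_field" where
  "ksign e e' = (if e \<and> e' then - 1 else 1)"

lemma ksign_simps [simp]:
  "ksign False e = 1" "ksign e False = 1" "ksign True True = - 1"
  by (auto simp: ksign_def)

lemma ksign_commute: "ksign e e' = ksign e' e"
  by (auto simp: ksign_def)

section \<open>Graded multilinear algebra: projections, graded symmetric forms, contractions\<close>

context graded_lcs
begin

definition Vpar :: "bool \<Rightarrow> 'v set" where
  "Vpar e = (if e then V1 else V0)"

definition pr :: "bool \<Rightarrow> 'v \<Rightarrow> 'v" where
  "pr e = (if e then proj_along V1 V0 else proj_along V0 V1)"

text \<open>The power of the parity involution that an element of parity \<open>e\<close> leaves
  behind when it moves past \<open>v\<close>. Unlike a sign taken from \<open>par\<close>, it is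
  linear in \<open>v\<close>.\<close>

definition gr :: "bool \<Rightarrow> 'v \<Rightarrow> 'v" where
  "gr e v = (if e then pr False v - pr True v else v)"

lemma subspace_Vpar: "subspace (Vpar e)"
  by (simp add: Vpar_def subspace_V0 subspace_V1)

lemma Vpar_Int: "x \<in> Vpar e \<Longrightarrow> x \<in> Vpar (\<not> e) \<Longrightarrow> x = 0"
  using V0_Int_V1 by (auto simp: Vpar_def split: if_splits)

lemma Vpar_0 [simp]: "0 \<in> Vpar e"
  by (rule subspace_0 [OF subspace_Vpar])

lemma pr_eqI:
  assumes "x \<in> Vpar e" "v - x \<in> Vpar (\<not> e)"
  shows "pr e v = x"
proof -
  have "y = x" if "y \<in> Vpar e" "v - y \<in> Vpar (\<not> e)" for y
  proof -
    have "x - y \<in> Vpar e"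
      using assms that by (auto intro: subspace_diff [OF subspace_Vpar])
    moreover have "(v - y) - (v - x) \<in> Vpar (\<not> e)"
      using assms that by (blast intro: subspace_diff [OF subspace_Vpar])
    ultimately have "x - y = 0"
      by (intro Vpar_Int[of "x - y" e]) (auto simp: algebra_simps)
    then show ?thesis by simp
  qed
  then have "(THE y. y \<in> Vpar e \<and> v - y \<in> Vpar (\<not> e)) = x"
    using assms by blast
  then show ?thesis
    by (cases e) (auto simp: pr_def proj_along_def Vpar_def)
qed

lemma pr_decomp: "pr e v \<in> Vpar e \<and> v - pr e v \<in> Vpar (\<not> e)"
proof -
  obtain x y where xy: "x \<in> V0" "y \<in> V1" "v = x + y"
    using V0_plus_V1 by blast
  show ?thesis
  proof (cases e)
    case True
    have "pr e v = y"
      by (rule pr_eqI) (use xy True in \<open>auto simp: Vpar_def\<close>)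
    then show ?thesis using xy True by (auto simp: Vpar_def)
  next
    case False
    have "pr e v = x"
      by (rule pr_eqI) (use xy False in \<open>auto simp: Vpar_def\<close>)
    then show ?thesis using xy False by (auto simp: Vpar_def)
  qed
qed

lemma pr_in [simp]: "pr e v \<in> Vpar e"
  using pr_decomp by blast

lemma pr_add: "pr e (u + v) = pr e u + pr e v"
proof (rule pr_eqI)
  have "u + v - (pr e u + pr e v) = (u - pr e u) + (v - pr e v)" by simp
  then show "u + v - (pr e u + pr e v) \<in> Vpar (\<not> e)"
    using pr_decomp by (metis subspace_add [OF subspace_Vpar])
qed (simp add: subspace_add [OF subspace_Vpar])

lemma pr_scale: "pr e (scale c u) = scale c (pr e u)"
proof (rule pr_eqI)
  have "scale c u - scale c (pr e u) = scale c (u - pr e u)"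
    by (simp add: scale_right_diff_distrib)
  then show "scale c u - scale c (pr e u) \<in> Vpar (\<not> e)"
    using pr_decomp by (metis subspace_scale [OF subspace_Vpar])
qed (simp add: subspace_scale [OF subspace_Vpar])

lemma pr_same: "v \<in> Vpar e \<Longrightarrow> pr e v = v"
  by (rule pr_eqI) auto

lemma pr_other: "v \<in> Vpar (\<not> e) \<Longrightarrow> pr e v = 0"
  by (rule pr_eqI) auto

lemma pr_pr [simp]: "pr e (pr e' v) = (if e = e' then pr e v else 0)"
proof (cases "e = e'")
  case False
  then have "e' = (\<not> e)" by auto
  then show ?thesis using pr_other[of "pr e' v" e] by simp
qed (simp add: pr_same)

lemma pr_sum: "pr False v + pr True v = v"
proof -
  have "v - pr False v \<in> Vpar True" using pr_decomp[of False v] by simp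
  then have "pr True v = v - pr False v"
    by (intro pr_eqI) (auto simp: pr_decomp)
  then show ?thesis by simp
qed

lemma pr_0 [simp]: "pr e 0 = 0"
  using pr_scale[of e 0 0] by simp

lemma pr_minus: "pr e (- v) = - pr e v"
  using pr_scale[of e "-1" v] by simp

lemma pr_diff: "pr e (u - v) = pr e u - pr e v"
  using pr_add[of e u "- v"] by (simp add: pr_minus)

lemma gr_add: "gr e (u + v) = gr e u + gr e v"
  by (simp add: gr_def pr_add)

lemma gr_scale: "gr e (scale c u) = scale c (gr e u)"
  by (simp add: gr_def pr_scale scale_right_diff_distrib)

lemma gr_False [simp]: "gr False v = v"
  by (simp add: gr_def)

lemma map_gr_False [simp]: "map (gr False) vs = vs"
  by (simp add: map_idI)

lemma gr_gr [simp]: "gr e (gr e v) = v"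
  by (cases e) (auto simp: gr_def pr_diff pr_sum)

lemma gr_commute: "gr e (gr e' v) = gr e' (gr e v)"
  by (cases e; cases e') auto

lemma pr_gr: "pr e (gr e' v) = scale (ksign e e') (pr e v)"
  by (cases e; cases e') (auto simp: gr_def pr_diff)

lemma gr_homogeneous: "v \<in> Vpar e \<Longrightarrow> gr e' v = scale (ksign e e') v"
  by (cases e; cases e') (auto simp: gr_def pr_same pr_other[of v True] pr_other[of v False])

lemma gr_pr: "gr e' (pr e v) = pr e (gr e' v)"
  by (simp add: pr_gr gr_homogeneous[OF pr_in])

text \<open>The factor 2 is the one in \<open>graded_symmetric\<close>: there too an odd
  contribution changes its sign, which means subtracting it twice.\<close>

lemma pr_True_gr: "gr True v = v - scale 2 (pr True v)"
proof -
  have "gr True v = (pr False v + pr True v) - (pr True v + pr True v)"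
    by (simp add: gr_def)
  then show ?thesis
    using scale_left_distrib[of 1 1 "pr True v"] by (simp add: pr_sum)
qed

definition lin_form :: "('v \<Rightarrow> 'k) \<Rightarrow> bool" where
  "lin_form l \<longleftrightarrow> (\<forall>u v. l (u + v) = l u + l v) \<and> (\<forall>c u. l (scale c u) = c * l u)"

lemma lin_form_add: "lin_form l \<Longrightarrow> l (u + v) = l u + l v"
  and lin_form_scale: "lin_form l \<Longrightarrow> l (scale c u) = c * l u"
  by (auto simp: lin_form_def)

lemma lin_form_0: "lin_form l \<Longrightarrow> l 0 = 0"
  using lin_form_scale[of l 0 0] by simp

lemma lin_form_minus: "lin_form l \<Longrightarrow> l (- u) = - l u"
  using lin_form_scale[of l "-1" u] by simp

lemma lin_form_diff: "lin_form l \<Longrightarrow> l (u - v) = l u - l v"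
  using lin_form_add[of l u "- v"] by (simp add: lin_form_minus)

lemma linear_iff_lin_form: "Vector_Spaces.linear scale (*) l \<longleftrightarrow> lin_form l"
proof
  assume "Vector_Spaces.linear scale (*) l"
  then interpret Vector_Spaces.linear scale "(*)" l .
  show "lin_form l" by (simp add: lin_form_def add scale)
next
  assume "lin_form l"
  then show "Vector_Spaces.linear scale (*) l"
    by unfold_locales (auto simp: lin_form_def algebra_simps)
qed

definition par_form :: "bool \<Rightarrow> ('v \<Rightarrow> 'k) \<Rightarrow> bool" where
  "par_form e l \<longleftrightarrow> lin_form l \<and> (\<forall>v. l (pr (\<not> e) v) = 0)"

lemma par_form_lin: "par_form e l \<Longrightarrow> lin_form l"
  by (simp add: par_form_def)

lemma par_form_pr: "par_form e l \<Longrightarrow> l (pr e' v) = (if e = e' then l v else 0)"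
proof -
  assume l: "par_form e l"
  then have "l v = l (pr False v) + l (pr True v)"
    by (metis lin_form_add par_form_def pr_sum)
  then show ?thesis using l by (cases e; cases e') (auto simp: par_form_def)
qed

lemma par_form_gr: "par_form e l \<Longrightarrow> l (gr e' v) = ksign e e' * l v"
  by (cases e') (auto simp: gr_def ksign_def par_form_pr lin_form_diff par_form_lin)

lemma par_formI: "lin_form l \<Longrightarrow> par_form e (\<lambda>v. l (pr e v))"
  using lin_form_0[of l] by (auto simp: par_form_def lin_form_def pr_add pr_scale)

lemma ml_add: "multilinear f \<Longrightarrow> f (us @ (u + v) # ws) = f (us @ u # ws) + f (us @ v # ws)"
  and ml_scale: "multilinear f \<Longrightarrow> f (us @ scale c u # ws) = c * f (us @ u # ws)"
  by (auto simp: multilinear_def)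

lemma multilinearI:
  assumes "\<And>us u v ws. f (us @ (u + v) # ws) = f (us @ u # ws) + f (us @ v # ws)"
    and "\<And>us c u ws. f (us @ scale c u # ws) = c * f (us @ u # ws)"
  shows "multilinear f"
  unfolding multilinear_def using assms by blast

lemma ml_append_left: "multilinear f \<Longrightarrow> multilinear (\<lambda>us. f (vs @ us))"
  by (rule multilinearI) (metis append.assoc ml_add, metis append.assoc ml_scale)

lemma ml_append_right: "multilinear f \<Longrightarrow> multilinear (\<lambda>us. f (us @ vs))"
  by (rule multilinearI) (metis append.assoc append_Cons ml_add, metis append.assoc append_Cons ml_scale)

lemma ml_Cons: "multilinear f \<Longrightarrow> multilinear (\<lambda>us. f (v # us))"
  using ml_append_left[of f "[v]"] by simp

lemma ml_head_lin: "multilinear f \<Longrightarrow> lin_form (\<lambda>u. f (us @ u # ws))"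
  by (simp add: lin_form_def ml_add ml_scale)

lemmas ml_slot_0 = lin_form_0 [OF ml_head_lin]

lemma ml_Cons_lin: "multilinear f \<Longrightarrow> lin_form (\<lambda>u. f (u # ws))"
  using ml_head_lin[of f "[]" ws] by simp

lemma ml_plus: "multilinear f \<Longrightarrow> multilinear g \<Longrightarrow> multilinear (\<lambda>us. f us + g us)"
  by (simp add: multilinear_def algebra_simps)

lemma ml_times: "multilinear f \<Longrightarrow> multilinear (\<lambda>us. c * f us)"
  by (simp add: multilinear_def algebra_simps)

lemma ml_zero: "multilinear (\<lambda>us. 0)"
  by (simp add: multilinear_def)

lemma ml_sum: "(\<And>i. i \<in> A \<Longrightarrow> multilinear (F i)) \<Longrightarrow> multilinear (\<lambda>us. \<Sum>i\<in>A. F i us)"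
  by (induction A rule: infinite_finite_induct) (auto simp: ml_zero ml_plus)

text \<open>
  Bilinearity turns the Koszul rule for homogeneous \<open>x\<close>, \<open>y\<close> into one identity for all vectors: the
  plain transposition is corrected only on the pair of the odd components, whose sign is flipped.
\<close>

definition graded_symmetric :: "('v list \<Rightarrow> 'k) \<Rightarrow> bool" where
  "graded_symmetric f \<longleftrightarrow> multilinear f \<and>
     (\<forall>us x y ws. f (us @ x # y # ws) = f (us @ y # x # ws) - 2 * f (us @ pr True y # pr True x # ws))"

lemma gs_ml: "graded_symmetric f \<Longrightarrow> multilinear f"
  by (simp add: graded_symmetric_def)

lemma gs_swap: "graded_symmetric f \<Longrightarrow>
    f (us @ x # y # ws) = f (us @ y # x # ws) - 2 * f (us @ pr True y # pr True x # ws)"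
  unfolding graded_symmetric_def by blast

lemma gs_swap_Cons: "graded_symmetric f \<Longrightarrow>
    f (x # y # ws) = f (y # x # ws) - 2 * f (pr True y # pr True x # ws)"
  using gs_swap[of f "[]" x y ws] by (simp only: append_Nil)

lemma graded_symmetricI:
  assumes "multilinear f"
    and "\<And>us x y ws. f (us @ x # y # ws) = f (us @ y # x # ws) - 2 * f (us @ pr True y # pr True x # ws)"
  shows "graded_symmetric f"
  unfolding graded_symmetric_def using assms by blast

lemma gs_append_left:
  assumes "graded_symmetric f" shows "graded_symmetric (\<lambda>us. f (vs @ us))"
proof (rule graded_symmetricI [OF ml_append_left [OF gs_ml [OF assms]]])
  fix us x y ws
  show "f (vs @ us @ x # y # ws) = f (vs @ us @ y # x # ws) - 2 * f (vs @ us @ pr True y # pr True x # ws)"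
    using gs_swap[OF assms, of "vs @ us" x y ws] unfolding append_assoc .
qed

lemma gs_append_right: 
  assumes "graded_symmetric f" shows "graded_symmetric (\<lambda>us. f (us @ vs))"
proof (rule graded_symmetricI [OF ml_append_right [OF gs_ml [OF assms]]])
  fix us x y ws
  show "f ((us @ x # y # ws) @ vs) = f ((us @ y # x # ws) @ vs) - 2 * f ((us @ pr True y # pr True x # ws) @ vs)"
    unfolding append_assoc append_Cons by (rule gs_swap[OF assms])
qed

lemma gs_Cons: "graded_symmetric f \<Longrightarrow> graded_symmetric (\<lambda>us. f (v # us))"
  using gs_append_left[of f "[v]"] by simp

lemma gs_plus: 
  assumes "graded_symmetric f" "graded_symmetric g" shows "graded_symmetric (\<lambda>us. f us + g us)"
proof (rule graded_symmetricI [OF ml_plus [OF gs_ml [OF assms(1)] gs_ml [OF assms(2)]]])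
  fix us x y ws
  show "f (us @ x # y # ws) + g (us @ x # y # ws) = f (us @ y # x # ws) + g (us @ y # x # ws) -
     2 * (f (us @ pr True y # pr True x # ws) + g (us @ pr True y # pr True x # ws))"
    by (subst gs_swap[OF assms(1)], subst gs_swap[OF assms(2)]) (simp add: algebra_simps)
qed

lemma gs_times: 
  assumes "graded_symmetric f" shows "graded_symmetric (\<lambda>us. c * f us)"
proof (rule graded_symmetricI [OF ml_times [OF gs_ml [OF assms]]])
  fix us x y ws
  show "c * f (us @ x # y # ws) = c * f (us @ y # x # ws) -
     2 * (c * f (us @ pr True y # pr True x # ws))"
    by (subst gs_swap[OF assms(1)]) (simp add: algebra_simps)
qed

lemma gs_zero: "graded_symmetric (\<lambda>us. 0)"
  by (simp add: graded_symmetric_def ml_zero)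

lemma gs_sum: "(\<And>i. i \<in> A \<Longrightarrow> graded_symmetric (F i)) \<Longrightarrow> graded_symmetric (\<lambda>us. \<Sum>i\<in>A. F i us)"
  by (induction A rule: infinite_finite_induct) (auto simp: gs_zero gs_plus)

text \<open>
  The left derivation of parity \<open>e\<close> determined by \<open>l\<close>, transposed to forms: moving past \<open>w\<close> applies the
  grading operator \<open>gr e\<close> to it.
\<close>

fun contr :: "bool \<Rightarrow> ('v \<Rightarrow> 'k) \<Rightarrow> ('v list \<Rightarrow> 'k) \<Rightarrow> 'v list \<Rightarrow> 'k" where
  "contr e l f [] = 0"
| "contr e l f (w # ws) = l w * f ws + contr e l (\<lambda>us. f (gr e w # us)) ws"

lemma contr_plus: "contr e l (\<lambda>us. f us + g us) ws = contr e l f ws + contr e l g ws"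
  by (induction ws arbitrary: f g) (auto simp: algebra_simps)

lemma contr_times: "contr e l (\<lambda>us. c * f us) ws = c * contr e l f ws"
  by (induction ws arbitrary: f) (auto simp: algebra_simps)

lemma contr_zero [simp]: "contr e l (\<lambda>us. 0) ws = 0"
  using contr_times[of e l 0 "\<lambda>us. 0" ws] by simp

lemma contr_diff: "contr e l (\<lambda>us. f us - g us) ws = contr e l f ws - contr e l g ws"
  by (induction ws arbitrary: f g) (auto simp: algebra_simps)

lemma contr_sum: "contr e l (\<lambda>us. \<Sum>i\<in>A. F i us) ws = (\<Sum>i\<in>A. contr e l (F i) ws)"
  by (induction A rule: infinite_finite_induct) (auto simp: contr_plus)

lemma contr_form_plus: "contr e (\<lambda>v. l v + l' v) f ws = contr e l f ws + contr e l' f ws"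
  by (induction ws arbitrary: f) (auto simp: algebra_simps)

lemma contr_form_times: "contr e (\<lambda>v. c * l v) f ws = c * contr e l f ws"
  by (induction ws arbitrary: f) (auto simp: algebra_simps)

lemma contr_form_zero [simp]: "contr e (\<lambda>v. 0) f ws = 0"
  by (induction ws arbitrary: f) auto

lemma contr_Cons_lin:
  assumes "multilinear f"
  shows "lin_form (\<lambda>u. contr e l (\<lambda>us. f (u # us)) ws)"
  unfolding lin_form_def
  using lin_form_add[OF ml_Cons_lin[OF assms]] lin_form_scale[OF ml_Cons_lin[OF assms]]
  by (simp add: contr_plus contr_times)

lemma contr_ml:
  assumes "multilinear f" "lin_form l"
  shows "multilinear (contr e l f)"
proof -
  have "contr e l f (us @ (u + v) # ws) = contr e l f (us @ u # ws) + contr e l f (us @ v # ws) \<and>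
     contr e l f (us @ scale c u # ws) = c * contr e l f (us @ u # ws)" for us u v c ws
    using assms(1)
  proof (induction us arbitrary: f)
    case Nil
    note lin = contr_Cons_lin[OF Nil]
    show ?case
      using lin_form_add[OF lin] lin_form_scale[OF lin] assms(2)
      by (simp add: lin_form_add lin_form_scale gr_add gr_scale algebra_simps)
  next
    case (Cons a us)
    show ?case
      using Cons.IH[OF ml_Cons[OF Cons.prems]]
      by (simp add: ml_add ml_scale Cons.prems algebra_simps)
  qed
  then show ?thesis by (auto simp: multilinear_def)
qed

text \<open>The point to check is the contraction of the two exchanged vectors themselves. For even
  \<open>l\<close> the terms in which \<open>l\<close> meets an odd component vanish; for odd
  \<open>l\<close> the \<open>gr True\<close> picked up by passing the neighbour produces exactly
  the correction term.\<close>

lemma contr_gs: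
  assumes "graded_symmetric f" "par_form e l"
  shows "graded_symmetric (contr e l f)"
proof -
  have "contr e l f (us @ x # y # ws) =
      contr e l f (us @ y # x # ws) - 2 * contr e l f (us @ pr True y # pr True x # ws)" for us x y ws
    using assms(1)
  proof (induction us arbitrary: f)
    case Nil
    note lin = ml_Cons_lin[OF gs_ml[OF Nil]]
    \<comment> \<open>Both vectors survive here and both carry \<open>gr e\<close>, which commutes
      with \<open>pr\<close>, so the swap rule of \<open>f\<close> applies under the
      contraction.\<close>
    have "contr e l (\<lambda>us. f (gr e x # gr e y # us)) ws =
        contr e l (\<lambda>us. f (gr e y # gr e x # us) - 2 * f (gr e (pr True y) # gr e (pr True x) # us)) ws"
      unfolding gr_pr by (subst gs_swap_Cons[OF Nil]) (rule refl)
    then have sw: "contr e l (\<lambda>us. f (gr e x # gr e y # us)) ws =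
        contr e l (\<lambda>us. f (gr e y # gr e x # us)) ws -
          2 * contr e l (\<lambda>us. f (gr e (pr True y) # gr e (pr True x) # us)) ws"
      by (simp only: contr_times contr_diff)
    show ?case
    proof (cases e)
      case False
      then show ?thesis
        using sw assms(2) by (simp add: par_form_pr algebra_simps)
    next
      case True
      have 1: "f (gr True u # ws) = f (u # ws) - 2 * f (pr True u # ws)" for u
        by (simp add: pr_True_gr lin_form_diff[OF lin] lin_form_scale[OF lin])
      have 2: "l (pr True u) = l u" for u using assms(2) True by (simp add: par_form_pr)
      from sw show ?thesis
        by (simp add: True 1 2 algebra_simps)
    qed
  next
    case (Cons a us)
    have 1: "l a * f (us @ x # y # ws) = l a * (f (us @ y # x # ws) - 2 * f (us @ pr True y # pr True x # ws))"
      by (subst gs_swap[OF Cons.prems]) (rule refl)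
    show ?case
      unfolding append_Cons contr.simps 1 Cons.IH[OF gs_Cons[OF Cons.prems]]
      by (simp add: algebra_simps)
  qed
  then show ?thesis
    using assms contr_ml[OF gs_ml par_form_lin] by (intro graded_symmetricI) blast+
qed

text \<open>The graded Leibniz rule: concatenation is the product of words, and in the second term
  the derivation has passed the whole left word.\<close>

lemma contr_append:
  "contr e l f (us @ ws) =
     contr e l (\<lambda>vs. f (vs @ ws)) us + contr e l (\<lambda>vs. f (map (gr e) us @ vs)) ws"
  by (induction us arbitrary: f) (auto simp: algebra_simps)

text \<open>Both sides apply \<open>gr e'\<close> to every vector that survives. The contracted one
  meets \<open>gr e'\<close> on the right only, where \<open>l\<close> turns it into a sign.\<close>

lemma contr_map_gr:
  assumes "par_form e l"
  shows "contr e l (\<lambda>us. f (map (gr e') us)) ws = ksign e e' * contr e l f (map (gr e') ws)"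
proof (induction ws arbitrary: f)
  case (Cons w ws)
  show ?case
    using Cons[of "\<lambda>us. f (gr e' (gr e w) # us)"]
    by (simp add: par_form_gr[OF assms] algebra_simps gr_commute[of e' e]) (auto simp: ksign_def)
qed auto

text \<open>The graded commutator of two such derivations is a derivation again, and it kills
  vectors, because each of the two sends vectors to scalars and scalars to 0. In the induction the
  terms at the head match since \<open>l'\<close> turns \<open>gr e\<close> into the sign.\<close>

lemma contr_anticommute:
  assumes "par_form e l" "par_form e' l'"
  shows "contr e l (contr e' l' f) ws = ksign e e' * contr e' l' (contr e l f) ws"
proof (induction ws arbitrary: f)
  case (Cons w ws)
  have "contr e l (contr e' l' f) (w # ws) =
     l w * contr e' l' f ws + (l' (gr e w) * contr e l f ws +
       contr e l (contr e' l' (\<lambda>us. f (gr e' (gr e w) # us))) ws)"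
    by (simp add: contr_plus contr_times)
  moreover have "contr e' l' (contr e l f) (w # ws) =
     l' w * contr e l f ws + (l (gr e' w) * contr e' l' f ws +
       contr e' l' (contr e l (\<lambda>us. f (gr e (gr e' w) # us))) ws)"
    by (simp add: contr_plus contr_times)
  ultimately show ?case
    by (simp add: Cons par_form_gr[OF assms(1)] par_form_gr[OF assms(2)] gr_commute[of e' e]
        ksign_commute[of e' e] algebra_simps) (auto simp: ksign_def)
qed auto

text \<open>The two contractions act in different words and neither passes a vector of the other
  one; the sign of such a passage is put into \<open>contr_right\<close>.\<close>

lemma contr_interchange:
  "contr e l (\<lambda>us. contr e' l' (g us) ws) us = contr e' l' (\<lambda>ws. contr e l (\<lambda>us. g us ws) us) ws"
  by (induction us arbitrary: g) (auto simp: contr_plus contr_times)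

end

lemma UNIV_bool_sum: "(\<Sum>e\<in>UNIV. F e) = F False + F True"
  by (simp add: UNIV_bool add.commute)

section \<open>The bilinear form as a contraction operator on pairs of words\<close>

locale graded_lcs_form = graded_lcs scale V0 V1
  for scale :: "'k::real_normed_field \<Rightarrow> 'v::{t2_space,topological_ab_group_add} \<Rightarrow> 'v" and V0 V1 +
  fixes \<Lambda> :: "'v \<Rightarrow> 'v \<Rightarrow> 'k" and z :: 'k
  assumes Lambda_bilinear: "continuous_bilinear_form \<Lambda>"
    and Lambda_even: "even_bilinear_form \<Lambda>"
begin

lemma Lambda_lin: "lin_form (\<Lambda> v)" "lin_form (\<lambda>v. \<Lambda> v w)"
  using Lambda_bilinear by (auto simp: continuous_bilinear_form_def linear_iff_lin_form)

text \<open>An even bilinear form is the sum of its parts on even and on odd vectors. The splitting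
  makes \<open>Lam e v\<close> a form of parity \<open>e\<close> for every \<open>v\<close>, so that
  the contraction lemmas apply to inhomogeneous vectors.\<close>

definition Lam :: "bool \<Rightarrow> 'v \<Rightarrow> 'v \<Rightarrow> 'k" where
  "Lam e v w = \<Lambda> (pr e v) (pr e w)"

lemma Lam_par_form: "par_form e (Lam e v)"
  unfolding Lam_def by (rule par_formI [OF Lambda_lin(1)])

lemma Lam_add: "Lam e (u + v) = (\<lambda>w. Lam e u w + Lam e v w)"
  by (simp add: fun_eq_iff Lam_def pr_add lin_form_add[OF Lambda_lin(2)])

lemma Lam_scale: "Lam e (scale c u) = (\<lambda>w. c * Lam e u w)"
  by (simp add: fun_eq_iff Lam_def pr_scale lin_form_scale[OF Lambda_lin(2)])

lemma Lam_pr: "Lam e (pr e' v) = (if e = e' then Lam e v else (\<lambda>w. 0))"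
  by (simp add: fun_eq_iff Lam_def lin_form_0[OF Lambda_lin(2)])

lemma Lam_gr: "Lam e (gr e' v) = (\<lambda>w. ksign e e' * Lam e v w)"
  by (simp add: fun_eq_iff Lam_def pr_gr lin_form_scale[OF Lambda_lin(2)])

lemma Lam_sum: "Lam False v w + Lam True v w = \<Lambda> v w"
proof -
  have "\<Lambda> v w = \<Lambda> (pr False v + pr True v) (pr False w + pr True w)"
    by (simp add: pr_sum)
  also have "\<dots> = Lam False v w + Lam True v w"
    using Lambda_even pr_in[of False] pr_in[of True]
    by (simp add: even_bilinear_form_def Lam_def Vpar_def lin_form_add[OF Lambda_lin(1)] lin_form_add[OF Lambda_lin(2)])
  finally show ?thesis by simp
qed

definition contr_left :: "bool \<Rightarrow> ('v \<Rightarrow> 'k) \<Rightarrow> ('v list \<Rightarrow> 'v list \<Rightarrow> 'k) \<Rightarrow> 'v list \<Rightarrow> 'v list \<Rightarrow> 'k" where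
  "contr_left e l g vs ws = contr e l (\<lambda>us. g us ws) vs"

text \<open>A derivation that acts on the right tensor factor only; \<open>map (gr e)\<close> is the
  sign for passing the left factor.\<close>

definition contr_right :: "bool \<Rightarrow> ('v \<Rightarrow> 'k) \<Rightarrow> ('v list \<Rightarrow> 'v list \<Rightarrow> 'k) \<Rightarrow> 'v list \<Rightarrow> 'v list \<Rightarrow> 'k" where
  "contr_right e l g vs ws = contr e l (g (map (gr e) vs)) ws"

text \<open>All contractions of one vector \<open>v\<close> of the left word with the right word.
  Here \<open>vs\<close> is what follows \<open>v\<close> in the left word, so
  \<open>map (gr e) vs\<close> inside \<open>contr_right\<close> is the sign with exponent v_k
  (v_{k+1} + ... + v_n) of \<open>P_Lambda\<close>.\<close>

definition Lam_right :: "'v \<Rightarrow> ('v list \<Rightarrow> 'v list \<Rightarrow> 'k) \<Rightarrow> 'v list \<Rightarrow> 'v list \<Rightarrow> 'k" where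
  "Lam_right v g vs ws = (\<Sum>e\<in>UNIV. contr_right e (Lam e v) g vs ws)"

text \<open>\<open>P_Lambda\<close> transposed, with its double sum unrolled along the left word.
  The term that keeps \<open>v\<close> has no sign, because a contracted vector moves to the right
  end of the left word and passes later vectors only.\<close>

fun Pc :: "('v list \<Rightarrow> 'v list \<Rightarrow> 'k) \<Rightarrow> 'v list \<Rightarrow> 'v list \<Rightarrow> 'k" where
  "Pc g [] ws = 0"
| "Pc g (v # vs) ws = Pc (\<lambda>us. g (v # us)) vs ws + Lam_right v g vs ws"

lemma contr_right_eq: "contr_right e l g vs = contr e l (g (map (gr e) vs))"
  by (simp add: fun_eq_iff contr_right_def)

lemma Lam_right_eq: "Lam_right v g vs = (\<lambda>ws. \<Sum>e\<in>UNIV. contr e (Lam e v) (g (map (gr e) vs)) ws)"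
  by (simp add: fun_eq_iff Lam_right_def contr_right_def)

lemma Pc_Nil_eq: "Pc g [] = (\<lambda>ws. 0)"
  by (simp add: fun_eq_iff)

lemma Pc_Cons_eq: "Pc g (v # vs) = (\<lambda>ws. Pc (\<lambda>us. g (v # us)) vs ws + Lam_right v g vs ws)"
  by (simp add: fun_eq_iff)

lemma contr_right_plus: "contr_right e l (\<lambda>vs ws. f vs ws + g vs ws) vs ws = contr_right e l f vs ws + contr_right e l g vs ws"
  by (simp add: contr_right_def contr_plus)

lemma contr_right_times: "contr_right e l (\<lambda>vs ws. c * f vs ws) vs ws = c * contr_right e l f vs ws"
  by (simp add: contr_right_def contr_times)

lemma Lam_right_plus: "Lam_right v (\<lambda>vs ws. f vs ws + g vs ws) vs ws = Lam_right v f vs ws + Lam_right v g vs ws"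
  by (simp add: Lam_right_def contr_right_plus sum.distrib)

lemma Lam_right_times: "Lam_right v (\<lambda>vs ws. c * f vs ws) vs ws = c * Lam_right v f vs ws"
  by (simp add: Lam_right_def contr_right_times sum_distrib_left)

lemma Pc_plus: "Pc (\<lambda>vs ws. f vs ws + g vs ws) vs ws = Pc f vs ws + Pc g vs ws"
  by (induction vs arbitrary: f g) (auto simp: Lam_right_plus)

lemma Pc_times: "Pc (\<lambda>vs ws. c * f vs ws) vs ws = c * Pc f vs ws"
  by (induction vs arbitrary: f) (auto simp: Lam_right_times algebra_simps)

lemma Pc_zero [simp]: "Pc (\<lambda>vs ws. 0) vs ws = 0"
  using Pc_times[of 0 "\<lambda>_ _. 0"] by simp

lemma Pc_sum: "Pc (\<lambda>vs ws. \<Sum>i\<in>A. F i vs ws) vs ws = (\<Sum>i\<in>A. Pc (F i) vs ws)"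
  by (induction A rule: infinite_finite_induct) (auto simp: Pc_plus)

lemma Lam_right_sum: "Lam_right v (\<lambda>vs ws. \<Sum>i\<in>A. F i vs ws) vs ws = (\<Sum>i\<in>A. Lam_right v (F i) vs ws)"
proof (induction A rule: infinite_finite_induct)
  case (insert x F)
  then show ?case by (simp add: Lam_right_plus)
qed (use Lam_right_times[of v 0 "\<lambda>_ _. 0"] in simp_all)

definition bi_gs :: "('v list \<Rightarrow> 'v list \<Rightarrow> 'k) \<Rightarrow> bool" where
  "bi_gs g \<longleftrightarrow> (\<forall>ws. graded_symmetric (\<lambda>vs. g vs ws)) \<and> (\<forall>vs. graded_symmetric (g vs))"

lemma bi_gs_Cons: "bi_gs g \<Longrightarrow> bi_gs (\<lambda>us. g (v # us))"
  unfolding bi_gs_def using gs_Cons by blast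

lemma Lam_right_slot_lin:
  assumes "bi_gs g"
  shows "lin_form (\<lambda>v. Lam_right v g vs ws)" "lin_form (\<lambda>u. Lam_right v g (us @ u # vs) ws)"
proof -
  show "lin_form (\<lambda>v. Lam_right v g vs ws)"
    by (simp add: lin_form_def Lam_right_def contr_right_def Lam_add Lam_scale contr_form_plus
        contr_form_times sum.distrib sum_distrib_left)
  have ml: "multilinear (\<lambda>vs. g vs ws)" for ws
    using assms by (auto simp: bi_gs_def gs_ml)
  have 1: "g (map (gr e) (us @ (u + u') # vs)) = (\<lambda>ws. g (map (gr e) (us @ u # vs)) ws + g (map (gr e) (us @ u' # vs)) ws)"
    and 2: "g (map (gr e) (us @ scale c u # vs)) = (\<lambda>ws. c * g (map (gr e) (us @ u # vs)) ws)"
    for e u u' c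
    by (simp_all add: fun_eq_iff gr_add gr_scale ml_add[OF ml] ml_scale[OF ml])
  show "lin_form (\<lambda>u. Lam_right v g (us @ u # vs) ws)"
    unfolding lin_form_def Lam_right_def contr_right_def 1 2 contr_plus contr_times
    by (simp add: sum.distrib sum_distrib_left)
qed

lemma Pc_gs_right: "bi_gs g \<Longrightarrow> graded_symmetric (Pc g vs)"
proof (induction vs arbitrary: g)
  case Nil
  have "Pc g [] = (\<lambda>ws. 0)" by (simp add: fun_eq_iff)
  then show ?case by (simp add: gs_zero)
next
  case (Cons v vs)
  have eq: "Pc g (v # vs) = (\<lambda>ws. Pc (\<lambda>us. g (v # us)) vs ws + (\<Sum>e\<in>UNIV. contr e (Lam e v) (g (map (gr e) vs)) ws))"
    by (simp add: fun_eq_iff Lam_right_def contr_right_def)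
  show ?case
    unfolding eq
    by (rule gs_plus [OF Cons.IH[OF bi_gs_Cons[OF Cons.prems]] gs_sum[OF contr_gs[OF _ Lam_par_form]]])
      (use Cons.prems in \<open>auto simp: bi_gs_def\<close>)
qed

lemma Pc_ml_left: 
  assumes "bi_gs g"
  shows "multilinear (\<lambda>vs. Pc g vs ws)"
proof -
  have "Pc g (us @ (u + v) # vs) ws = Pc g (us @ u # vs) ws + Pc g (us @ v # vs) ws \<and>
     Pc g (us @ scale c u # vs) ws = c * Pc g (us @ u # vs) ws" for us u v c vs
    using assms
  proof (induction us arbitrary: g)
    case Nil
    have ml: "multilinear (\<lambda>vs. g vs ws)" for ws
      using Nil by (auto simp: bi_gs_def gs_ml)
    have 1: "(\<lambda>us. g ((u + v) # us)) = (\<lambda>us ws. g (u # us) ws + g (v # us) ws)"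
      and 2: "(\<lambda>us. g (scale c u # us)) = (\<lambda>us ws. c * g (u # us) ws)"
      using lin_form_add[OF ml_Cons_lin[OF ml]] lin_form_scale[OF ml_Cons_lin[OF ml]] by (simp_all add: fun_eq_iff)
    show ?case
      using lin_form_add[OF Lam_right_slot_lin(1)[OF Nil]] lin_form_scale[OF Lam_right_slot_lin(1)[OF Nil]]
      by (simp add: 1 2 Pc_plus Pc_times algebra_simps)
  next
    case (Cons a us)
    show ?case
      using Cons.IH[OF bi_gs_Cons[OF Cons.prems]]
        lin_form_add[OF Lam_right_slot_lin(2)[OF Cons.prems]] lin_form_scale[OF Lam_right_slot_lin(2)[OF Cons.prems]]
      by (simp add: algebra_simps)
  qed
  then show ?thesis by (intro multilinearI) auto
qed

lemma Pc_gs_left: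
  assumes "bi_gs g"
  shows "graded_symmetric (\<lambda>vs. Pc g vs ws)"
proof -
  have "Pc g (us @ x # y # vs) ws = Pc g (us @ y # x # vs) ws - 2 * Pc g (us @ pr True y # pr True x # vs) ws"
    for us x y vs
    using assms
  proof (induction us arbitrary: g)
    case Nil
    \<comment> \<open>The contribution in which \<open>u\<close> is contracted with the right word
      while \<open>v\<close> stays at the head of the left word. Which of \<open>x\<close> and
      \<open>y\<close> has to pass the other depends on their order; this costs
      \<open>gr True\<close> in the odd part and nothing in the even part.\<close>
    define K where "K e u v = contr e (Lam e u) (g (v # map (gr e) vs)) ws" for e u v
    have gs: "graded_symmetric (\<lambda>vs. g vs ws)" for ws
      using Nil by (auto simp: bi_gs_def)
    note lin = ml_Cons_lin[OF gs_ml[OF gs]]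
    have 1: "g ((u + v) # vs) = (\<lambda>ws. g (u # vs) ws + g (v # vs) ws)"
      and 2: "g (scale c u # vs) = (\<lambda>ws. c * g (u # vs) ws)" for u v c vs
      using lin_form_add[OF lin] lin_form_scale[OF lin] by (simp_all add: fun_eq_iff)
    have K2: "lin_form (K e u)" for e u
      by (simp add: lin_form_def K_def 1 2 contr_plus contr_times)
    have Kgr: "K True u (gr True v) = K True u v - 2 * K True u (pr True v)" for u v
      by (simp add: pr_True_gr lin_form_diff[OF K2] lin_form_scale[OF K2])
    have Kpr: "K True (pr True u) v = K True u v" "K False (pr True u) v = 0" for u v
      by (auto simp: K_def Lam_pr)
    have step: "Pc g (u # v # vs) ws = Pc (\<lambda>us. g (u # v # us)) vs ws +
        (K False v u + K True v u + K False u v + K True u (gr True v))" for u v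
      by (simp add: Lam_right_def contr_right_def K_def UNIV_bool_sum)
    have eq: "(\<lambda>us. g (x # y # us)) = (\<lambda>us ws. g (y # x # us) ws + (-2) * g (pr True y # pr True x # us) ws)"
      by (intro ext, subst gs_swap_Cons[OF gs]) simp
    have Pcs: "Pc (\<lambda>us. g (x # y # us)) vs ws =
       Pc (\<lambda>us. g (y # x # us)) vs ws - 2 * Pc (\<lambda>us. g (pr True y # pr True x # us)) vs ws"
      unfolding eq by (subst Pc_plus, subst Pc_times) simp
    show ?case
      unfolding append_Nil step Pcs
      by (simp add: Kgr Kpr algebra_simps)
  next
    case (Cons a us)
    have gs: "graded_symmetric (\<lambda>vs. g vs ws)" for ws
      using Cons.prems by (auto simp: bi_gs_def)
    have eq: "g (map (gr e) (us @ x # y # vs)) = (\<lambda>ws. g (map (gr e) (us @ y # x # vs)) ws -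
        2 * g (map (gr e) (us @ pr True y # pr True x # vs)) ws)" for e
      unfolding map_append list.map gr_pr by (intro ext) (rule gs_swap[OF gs])
    have L: "Lam_right a g (us @ x # y # vs) ws = Lam_right a g (us @ y # x # vs) ws -
       2 * Lam_right a g (us @ pr True y # pr True x # vs) ws"
      unfolding Lam_right_def contr_right_def eq contr_diff contr_times
      by (simp add: sum_subtractf sum_distrib_left)
    show ?case
      unfolding append_Cons Pc.simps Cons.IH[OF bi_gs_Cons[OF Cons.prems]] L
      by (simp add: algebra_simps)
  qed
  then show ?thesis
    using Pc_ml_left[OF assms] by (intro graded_symmetricI) blast+
qed

lemma Pc_bi_gs: "bi_gs g \<Longrightarrow> bi_gs (Pc g)"
  using Pc_gs_left Pc_gs_right by (simp add: bi_gs_def)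

lemma Pc_pow_bi_gs: "bi_gs g \<Longrightarrow> bi_gs ((Pc ^^ k) g)"
  by (induction k) (auto simp: Pc_bi_gs)

text \<open>Removing one vector of the right word by \<open>l\<close> and another one by \<Lambda>
  can be done in either order. The sign from \<open>contr_anticommute\<close> is compensated by the
  \<open>gr e\<close> that \<open>contr_right\<close> applies to \<open>v\<close>.\<close>

lemma Pc_contr_right:
  assumes l: "par_form e l"
  shows "Pc (contr_right e l g) vs ws = contr_right e l (Pc g) vs ws"
proof (induction vs arbitrary: g)
  case (Cons v vs)
  have 1: "(\<lambda>us. contr_right e l g (v # us)) = contr_right e l (\<lambda>us. g (gr e v # us))"
    by (simp add: fun_eq_iff contr_right_def)
  have "contr_right e l (Lam_right (gr e v) g) vs ws =
    (\<Sum>e'\<in>UNIV. ksign e e' * contr e l (contr e' (Lam e' v) (g (map (gr e') (map (gr e) vs)))) ws)"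
    by (simp add: contr_right_def Lam_right_eq contr_sum Lam_gr contr_form_times contr_times ksign_commute[of _ e])
  also have "\<dots> = Lam_right v (contr_right e l g) vs ws"
    unfolding Lam_right_def
    by (rule sum.cong)
      (auto simp: contr_right_eq contr_anticommute[OF l Lam_par_form] gr_commute[of _ e] comp_def ksign_def)
  finally have 2: "contr_right e l (Lam_right (gr e v) g) vs ws = Lam_right v (contr_right e l g) vs ws" .
  have "contr_right e l (Pc g) (v # vs) ws =
     contr_right e l (\<lambda>vs ws. Pc (\<lambda>us. g (gr e v # us)) vs ws + Lam_right (gr e v) g vs ws) vs ws"
    by (simp add: contr_right_eq Pc_Cons_eq)
  then show ?case
    by (simp add: 1 2 Cons contr_right_plus)
qed (simp add: contr_right_eq Pc_Nil_eq)

text \<open>In the left word \<open>l\<close> removes a vector that \<Lambda> does not touch. Two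
  equal signs cancel: one because \<open>l\<close> passes \<open>v\<close>, the other because
  \<open>gr e'\<close> runs over a word that \<open>l\<close> has shortened.\<close>

lemma Pc_contr_left:
  assumes l: "par_form e l"
  shows "Pc (contr_left e l g) vs ws = contr_left e l (Pc g) vs ws"
proof (induction vs arbitrary: g)
  case (Cons v vs)
  have 1: "(\<lambda>us. contr_left e l g (v # us)) =
     (\<lambda>us ws. l v * g us ws + contr_left e l (\<lambda>us. g (gr e v # us)) us ws)"
    by (simp add: fun_eq_iff contr_left_def)
  have "contr_left e l (Lam_right (gr e v) g) vs ws =
    (\<Sum>e'\<in>UNIV. ksign e e' * contr e l (\<lambda>us. contr e' (Lam e' v) (g (map (gr e') us)) ws) vs)"
    by (simp add: contr_left_def Lam_right_eq contr_sum Lam_gr contr_form_times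
        contr_times ksign_commute[of _ e])
  also have "\<dots> = Lam_right v (contr_left e l g) vs ws"
    unfolding Lam_right_def
  proof (rule sum.cong)
    fix e'
    have "contr e l (\<lambda>us. contr e' (Lam e' v) (g (map (gr e') us)) ws) vs =
       ksign e e' * contr_right e' (Lam e' v) (contr_left e l g) vs ws"
      by (subst contr_interchange)
        (simp only: contr_map_gr[OF l, where f = "\<lambda>us. g us _"] contr_times contr_right_eq contr_left_def[abs_def])
    then show "ksign e e' * contr e l (\<lambda>us. contr e' (Lam e' v) (g (map (gr e') us)) ws) vs =
        contr_right e' (Lam e' v) (contr_left e l g) vs ws"
      by (auto simp: ksign_def)
  qed simp
  finally have 2: "contr_left e l (Lam_right (gr e v) g) vs ws = Lam_right v (contr_left e l g) vs ws" .
  have "contr_left e l (Pc g) (v # vs) ws = l v * Pc g vs ws +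
     (contr_left e l (Pc (\<lambda>us. g (gr e v # us))) vs ws + contr_left e l (Lam_right (gr e v) g) vs ws)"
    by (simp add: contr_left_def contr_plus)
  then show ?case
    by (simp add: 1 2 Cons Pc_plus Pc_times)
qed (simp add: contr_left_def)

lemma Pc_Lam_right: "Pc (Lam_right v g) vs ws = Lam_right v (Pc g) vs ws"
  unfolding Lam_right_def[abs_def] by (simp add: Pc_sum Pc_contr_right[OF Lam_par_form])

lemma Pc_pow_contr_right:
  assumes l: "par_form e l"
  shows "(Pc ^^ k) (contr_right e l g) = contr_right e l ((Pc ^^ k) g)"
  by (induction k) (simp_all add: Pc_contr_right[OF l] ext)

lemma Pc_pow_contr_left:
  assumes l: "par_form e l"
  shows "(Pc ^^ k) (contr_left e l g) = contr_left e l ((Pc ^^ k) g)"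
  by (induction k) (simp_all add: Pc_contr_left[OF l] ext)

lemma Pc_pow_plus: "(Pc ^^ k) (\<lambda>vs ws. f vs ws + g vs ws) = (\<lambda>vs ws. (Pc ^^ k) f vs ws + (Pc ^^ k) g vs ws)"
  by (induction k) (simp_all add: Pc_plus ext)

lemma Pc_pow_times: "(Pc ^^ k) (\<lambda>vs ws. c * f vs ws) = (\<lambda>vs ws. c * (Pc ^^ k) f vs ws)"
  by (induction k) (simp_all add: Pc_times ext)

text \<open>Each application removes a vector from the left and one from the right word, which makes
  every series over \<open>k\<close> finite.\<close>

lemma Pc_pow_zero: "length vs < k \<or> length ws < k \<Longrightarrow> (Pc ^^ k) g vs ws = 0"
proof (induction k arbitrary: vs ws)
  case (Suc k)
  show ?case
  proof (cases "length ws < Suc k")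
    case True
    then have 0: "(Pc ^^ k) g us us' = 0" if "length us' < length ws" for us us'
      using Suc.IH[of us us'] that by auto
    have c0: "contr e l f ws = 0" if "\<And>us'. length us' < length ws \<Longrightarrow> f us' = 0" for e l ws f
      using that by (induction ws arbitrary: f) auto
    have "Pc h us ws = 0" if "\<And>us us'. length us' < length ws \<Longrightarrow> h us us' = 0" for h us
      using that
      by (induction us arbitrary: h) (auto simp: Lam_right_def contr_right_def intro!: sum.neutral c0)
    then show ?thesis using 0 by simp
  next
    case False
    then have *: "length vs < Suc k" using Suc.prems by simp
    then have 0: "(Pc ^^ k) g us us' = 0" if "length us < length vs" for us us'
      using Suc.IH[of us us'] that by auto
    have z: "contr e l f ws = 0" if "\<And>us. f us = 0" for e l f ws
    proof -
      have "f = (\<lambda>us. 0)" using that by auto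
      then show ?thesis by simp
    qed
    have "Pc h vs us' = 0" if "\<And>us us'. length us < length vs \<Longrightarrow> h us us' = 0" for h us'
      using that
      by (induction vs arbitrary: h) (auto simp: Lam_right_def contr_right_def intro!: sum.neutral z)
    then show ?thesis using 0 by simp
  qed
qed simp

text \<open>The binomial expansion for two commuting operators, one that leaves \<open>v\<close> in
  place and one that contracts it; it stops after the linear term, since \<open>v\<close> can be
  contracted only once.\<close>

lemma Pc_pow_Cons:
  "(Pc ^^ Suc k) g (v # vs) ws = (Pc ^^ Suc k) (\<lambda>us. g (v # us)) vs ws + of_nat (Suc k) * Lam_right v ((Pc ^^ k) g) vs ws"
proof (induction k arbitrary: vs ws)
  case 0
  then show ?case by simp
next
  case (Suc k)
  have eq: "(\<lambda>us. (Pc ^^ Suc k) g (v # us)) = (\<lambda>vs ws. (Pc ^^ Suc k) (\<lambda>us. g (v # us)) vs ws + of_nat (Suc k) * Lam_right v ((Pc ^^ k) g) vs ws)"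
    using Suc.IH by (simp add: fun_eq_iff)
  have "(Pc ^^ Suc (Suc k)) g (v # vs) ws = Pc (\<lambda>us. (Pc ^^ Suc k) g (v # us)) vs ws + Lam_right v ((Pc ^^ Suc k) g) vs ws"
    by simp
  also have "\<dots> = (Pc ^^ Suc (Suc k)) (\<lambda>us. g (v # us)) vs ws + of_nat (Suc k) * Lam_right v ((Pc ^^ Suc k) g) vs ws
      + Lam_right v ((Pc ^^ Suc k) g) vs ws"
    unfolding eq Pc_plus Pc_times Pc_Lam_right by simp
  finally show ?case by (simp add: algebra_simps)
qed

text \<open>
  The transpose of \<open>star\<close>.  Every contraction consumes a left slot, so the truncation at the number of
  left vectors loses nothing.
\<close>

definition SF :: "('v list \<Rightarrow> 'k) \<Rightarrow> 'v list \<Rightarrow> 'v list \<Rightarrow> 'k" where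
  "SF f vs ws = (\<Sum>k\<le>length vs. z ^ k / fact k * (Pc ^^ k) (\<lambda>vs ws. f (vs @ ws)) vs ws)"

lemma SF_eq:
  assumes "length vs \<le> n"
  shows "SF f vs ws = (\<Sum>k\<le>n. z ^ k / fact k * (Pc ^^ k) (\<lambda>vs ws. f (vs @ ws)) vs ws)"
  unfolding SF_def by (rule sum.mono_neutral_left) (use assms in \<open>auto simp: Pc_pow_zero\<close>)

lemma SF_Nil [simp]: "SF f [] ws = f ws"
  by (simp add: SF_def)

text \<open>The factor \<open>Suc k\<close> of \<open>Pc_pow_Cons\<close> turns 1/(k+1)! into 1/k!,
  so the linear terms of all powers sum up to the series again.\<close>

lemma SF_Cons: "SF f (v # vs) ws = SF (\<lambda>us. f (v # us)) vs ws + z * Lam_right v (SF f) vs ws"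
proof -
  let ?D = "\<lambda>f vs ws. f (vs @ ws)"
  let ?n = "length vs"
  have "SF f (v # vs) ws = f (v # vs @ ws) + (\<Sum>k\<le>?n. z ^ Suc k / fact (Suc k) * (Pc ^^ Suc k) (?D f) (v # vs) ws)"
    unfolding SF_def by (simp add: sum.atMost_Suc_shift del: sum.atMost_Suc funpow.simps)
  also have "(\<Sum>k\<le>?n. z ^ Suc k / fact (Suc k) * (Pc ^^ Suc k) (?D f) (v # vs) ws) =
     (\<Sum>k\<le>?n. z ^ Suc k / fact (Suc k) * (Pc ^^ Suc k) (\<lambda>us. ?D f (v # us)) vs ws) +
     (\<Sum>k\<le>?n. z * (z ^ k / fact k * Lam_right v ((Pc ^^ k) (?D f)) vs ws))"
    unfolding Pc_pow_Cons sum.distrib[symmetric]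
    by (rule sum.cong) (auto simp: field_simps simp del: funpow.simps of_nat_Suc)
  also have "f (v # vs @ ws) + \<dots> = (\<Sum>k\<le>Suc ?n. z ^ k / fact k * (Pc ^^ k) (\<lambda>us. ?D f (v # us)) vs ws) +
     z * (\<Sum>k\<le>?n. z ^ k / fact k * Lam_right v ((Pc ^^ k) (?D f)) vs ws)"
    by (subst sum.atMost_Suc_shift) (simp add: sum_distrib_left del: sum.atMost_Suc funpow.simps)
  also have "(\<Sum>k\<le>Suc ?n. z ^ k / fact k * (Pc ^^ k) (\<lambda>us. ?D f (v # us)) vs ws) = SF (\<lambda>us. f (v # us)) vs ws"
    by (subst SF_eq[of _ "Suc ?n"]) auto
  also have "(\<Sum>k\<le>?n. z ^ k / fact k * Lam_right v ((Pc ^^ k) (?D f)) vs ws) = Lam_right v (SF f) vs ws"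
    unfolding Lam_right_times[symmetric] Lam_right_sum[symmetric]
    by (simp add: Lam_right_def contr_right_def SF_def[abs_def])
  finally show ?thesis .
qed

lemma SF_plus: "SF (\<lambda>us. f us + g us) vs ws = SF f vs ws + SF g vs ws"
  by (simp add: SF_def Pc_pow_plus sum.distrib algebra_simps)

lemma SF_times: "SF (\<lambda>us. c * f us) vs ws = c * SF f vs ws"
  by (simp add: SF_def Pc_pow_times sum_distrib_left algebra_simps)

lemma SF_zero [simp]: "SF (\<lambda>us. 0) vs ws = 0"
  using SF_times[of 0 "\<lambda>us. 0"] by simp

lemma SF_sum: "SF (\<lambda>us. \<Sum>i\<in>A. F i us) vs ws = (\<Sum>i\<in>A. SF (F i) vs ws)"
  by (induction A rule: infinite_finite_induct) (auto simp: SF_plus)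

text \<open>A graded derivation with scalar values on vectors is also a derivation of the star
  product: it satisfies the Leibniz rule for concatenation and commutes with the powers of
  \<open>Pc\<close> on either side.\<close>

lemma SF_contr:
  assumes l: "par_form e l"
  shows "SF (contr e l f) vs ws = contr_left e l (SF f) vs ws + contr_right e l (SF f) vs ws"
proof -
  let ?D = "\<lambda>vs ws. f (vs @ ws)"
  let ?n = "length vs"
  have 1: "(\<lambda>vs ws. contr e l f (vs @ ws)) = (\<lambda>vs ws. contr_left e l ?D vs ws + contr_right e l ?D vs ws)"
    by (simp add: fun_eq_iff contr_append contr_left_def contr_right_def)
  \<comment> \<open>\<open>SF\<close> truncates at the length of its own left word, which a
    contraction shortens. Comparing forms on words up to the given length suffices to use the bound
    \<open>?n\<close> everywhere.\<close>
  have cc: "contr e l f ws = contr e l g ws"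
    if "\<And>us. length us \<le> length ws \<Longrightarrow> f us = g us" for f g ws
    using that
  proof (induction ws arbitrary: f g)
    case (Cons w ws)
    have "contr e l (\<lambda>us. f (gr e w # us)) ws = contr e l (\<lambda>us. g (gr e w # us)) ws"
      by (rule Cons.IH) (simp add: Cons.prems)
    moreover have "f ws = g ws" by (simp add: Cons.prems)
    ultimately show ?case by simp
  qed simp
  have 2: "contr_left e l (SF f) vs ws =
      (\<Sum>k\<le>?n. z ^ k / fact k * contr_left e l ((Pc ^^ k) ?D) vs ws)"
    unfolding contr_left_def contr_times[symmetric] contr_sum[symmetric]
    by (rule cc) (auto simp: SF_eq[of _ ?n])
  have 3: "contr_right e l (SF f) vs ws =
      (\<Sum>k\<le>?n. z ^ k / fact k * contr_right e l ((Pc ^^ k) ?D) vs ws)"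
    unfolding contr_right_def contr_times[symmetric] contr_sum[symmetric]
    by (rule cc) (auto simp: SF_eq[of _ ?n])
  show ?thesis
    unfolding 2 3 unfolding SF_def 1 Pc_pow_plus Pc_pow_contr_left[OF l] Pc_pow_contr_right[OF l]
    by (simp add: sum.distrib algebra_simps)
qed

text \<open>Transposed associativity with a single vector in front. On the left \<open>v\<close> is
  multiplied with \<open>vs\<close> and the result with \<open>ws\<close>; on the right
  \<open>v\<close> is multiplied with the product of the two. By the Leibniz rule
  \<open>SF_contr\<close> the contraction of \<open>v\<close> with that product hits
  \<open>vs\<close> or \<open>ws\<close>.\<close>

lemma SF_assoc:
  "SF f (v # vs) ws + z * (\<Sum>e\<in>UNIV. contr_left e (Lam e v) (SF f) vs ws) =
   SF (\<lambda>us. f (v # us) + z * (\<Sum>e\<in>UNIV. contr e (Lam e v) f us)) vs ws"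
  by (simp add: SF_Cons SF_plus SF_times SF_sum SF_contr[OF Lam_par_form] Lam_right_def sum.distrib algebra_simps)

text \<open>The defining identities compare words of equal length only. This serves
  \<open>SF\<close> and \<open>tf\<close>, where the number of summands depends on the
  length.\<close>

lemma gs_by_length:
  assumes "\<And>n. graded_symmetric (F n)"
  shows "graded_symmetric (\<lambda>vs. F (length vs) vs)"
proof (rule graded_symmetricI)
  show "multilinear (\<lambda>vs. F (length vs) vs)"
    by (rule multilinearI) (simp_all add: ml_add[OF gs_ml[OF assms]] ml_scale[OF gs_ml[OF assms]])
  fix us x y ws
  show "F (length (us @ x # y # ws)) (us @ x # y # ws) = F (length (us @ y # x # ws)) (us @ y # x # ws) -
      2 * F (length (us @ pr True y # pr True x # ws)) (us @ pr True y # pr True x # ws)"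
    by (subst gs_swap[OF assms]) simp
qed

lemma SF_bi_gs:
  assumes "graded_symmetric f"
  shows "bi_gs (SF f)"
proof -
  have D: "bi_gs (\<lambda>vs ws. f (vs @ ws))"
    using gs_append_left[OF assms] gs_append_right[OF assms] by (simp add: bi_gs_def)
  have P: "graded_symmetric (\<lambda>vs. (Pc ^^ k) (\<lambda>vs ws. f (vs @ ws)) vs ws)"
    "graded_symmetric ((Pc ^^ k) (\<lambda>vs ws. f (vs @ ws)) vs)" for k vs ws
    using Pc_pow_bi_gs[OF D] by (auto simp: bi_gs_def)
  have "graded_symmetric (\<lambda>vs. SF f vs ws)" for ws
    unfolding SF_def
    by (rule gs_by_length[where F = "\<lambda>n vs. \<Sum>k\<le>n. z ^ k / fact k * (Pc ^^ k) (\<lambda>vs ws. f (vs @ ws)) vs ws"])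
      (intro gs_sum gs_times P)
  moreover have "graded_symmetric (SF f vs)" for vs
    unfolding SF_def[abs_def] by (intro gs_sum gs_times P)
  ultimately show ?thesis by (simp add: bi_gs_def)
qed

end

section \<open>Linear extensions and Koszul signs of permutations\<close>

text \<open>The span of the prescribed pairs lies in the graph of \<Phi>, which makes the value at
  \<open>t\<close> unique. Thus a prescription on generators is well defined as soon as one linear
  map realizes it; \<open>comp\<close>, \<open>permT\<close>, \<open>concT\<close> and
  \<open>PT\<close> below are these maps.\<close>

lemma lin_ext_eq:
  fixes \<Phi> :: "('x \<Rightarrow> 'k::real_normed_field) \<Rightarrow> ('y \<Rightarrow> 'k)"
  assumes add: "\<And>s t. \<Phi> (s + t) = \<Phi> s + \<Phi> t" and scale: "\<And>c s. \<Phi> (fscale c s) = fscale c (\<Phi> s)"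
    and G: "\<And>x y. (x, y) \<in> G \<Longrightarrow> y = \<Phi> x" and t: "t \<in> fs.span (fst ` G)"
  shows "lin_ext G t = \<Phi> t"
proof -
  let ?sc = "\<lambda>c (x :: 'x \<Rightarrow> 'k, y :: 'y \<Rightarrow> 'k). (fscale c x, fscale c y)"
  interpret ps: vector_space ?sc
    by unfold_locales (auto simp: fscale_def fun_eq_iff algebra_simps)
  have zero: "\<Phi> 0 = 0" using scale[of 0 0] by simp
  have sub: "u = \<Phi> s" if "(s, u) \<in> ps.span G" for s u
  proof -
    have "ps.subspace {(s, u). u = \<Phi> s}"
      by (rule ps.subspaceI) (auto simp: zero add scale zero_prod_def)
    then have "ps.span G \<subseteq> {(s, u). u = \<Phi> s}"
      using G by (intro ps.span_minimal) auto
    then show ?thesis using that by auto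
  qed
  have "(t, \<Phi> t) \<in> ps.span G"
    using t
  proof (induction rule: fs.span_induct_alt)
    case base
    show ?case unfolding zero using ps.span_zero[of G] unfolding zero_prod_def .
  next
    case (step c x y)
    then obtain w where "(x, w) \<in> G" by auto
    with G have "(x, \<Phi> x) \<in> ps.span G" using ps.span_base by fastforce
    from ps.span_add[OF ps.span_scale[OF this, of c] step.IH] show ?case
      by (simp only: add scale prod.case add_Pair)
  qed
  then show ?thesis
    unfolding lin_ext_def by (rule the_equality[where P = "\<lambda>u. (t, u) \<in> ps.span G"]) (rule sub)
qed

text \<open>Insertion sort exchanges neighbours only. The prefix \<open>as\<close> is what the
  recursion has already passed.\<close>

lemma swap_invariant_sort:
  fixes h :: "nat list \<Rightarrow> 'b"
  assumes swap: "\<And>as x y bs. distinct (as @ x # y # bs) \<Longrightarrow> h (as @ x # y # bs) = h (as @ y # x # bs)"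
    and "distinct (as @ xs)"
  shows "h (as @ xs) = h (as @ sort xs)"
proof -
  have ins: "h (as @ x # xs) = h (as @ insort x xs)" if "distinct (as @ x # xs)" for as x xs
    using that
  proof (induction xs arbitrary: as)
    case (Cons y ys)
    then show ?case
      using swap[of as x y ys] Cons.IH[of "as @ [y]"] by auto
  qed simp
  show ?thesis using assms(2)
  proof (induction xs arbitrary: as)
    case (Cons x xs)
    then show ?case
      using Cons.IH[of "as @ [x]"] ins[of as x "sort xs"] by auto
  qed simp
qed

text \<open>The Koszul sign of the permutation with value list \<open>xs\<close>, where
  \<open>o' i\<close> says whether the vector at index \<open>i\<close> is odd. As a product over
  inversions it can be followed through exchanges of neighbours, unlike the cardinality in
  \<open>koszul_sign\<close>.\<close>

fun list_sign :: "(nat \<Rightarrow> bool) \<Rightarrow> nat list \<Rightarrow> 'k::real_normed_field" where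
  "list_sign o' [] = 1"
| "list_sign o' (x # xs) = (\<Prod>y\<leftarrow>xs. if x > y \<and> o' x \<and> o' y then - 1 else 1) * list_sign o' xs"

lemma list_sign_swap:
  "x \<noteq> y \<Longrightarrow> list_sign o' (as @ x # y # bs) = ksign (o' x) (o' y) * list_sign o' (as @ y # x # bs)"
  by (induction as) (auto simp: ksign_def algebra_simps)

lemma list_sign_sorted: "sorted xs \<Longrightarrow> list_sign o' xs = 1"
proof (induction xs)
  case (Cons x xs)
  have "(\<Prod>y\<leftarrow>xs. if x > y \<and> o' x \<and> o' y then - 1 else 1) = (\<Prod>y\<leftarrow>xs. 1::'a)"
    using Cons.prems by (intro arg_cong[where f = prod_list] map_cong) auto
  then show ?case using Cons by (simp add: map_replicate_const)
qed simp

text \<open>Exchanging the values \<open>k\<close> and \<open>Suc k\<close> reverses the order of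
  this pair only. All other factors occur twice and square to 1.\<close>

lemma list_sign_transpose:
  assumes "distinct xs"
  shows "list_sign (o' \<circ> Transposition.transpose k (Suc k)) xs * list_sign o' (map (Transposition.transpose k (Suc k)) xs) =
    (if k \<in> set xs \<and> Suc k \<in> set xs then ksign (o' k) (o' (Suc k)) else 1)"
  using assms
proof (induction xs)
  case (Cons x xs)
  let ?t = "Transposition.transpose k (Suc k)"
  let ?p = "\<lambda>y. (if x > y \<and> o' (?t x) \<and> o' (?t y) then - 1 else 1) *
       (if ?t x > ?t y \<and> o' (?t x) \<and> o' (?t y) then - 1 else 1::'a)"
  have p: "?p y = (if {x, y} = {k, Suc k} then ksign (o' k) (o' (Suc k)) else 1)" if "y \<noteq> x" for y
  proof (cases "{x, y} = {k, Suc k}")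
    case True
    then have "(x = k \<and> y = Suc k) \<or> (x = Suc k \<and> y = k)"
      by (auto simp: doubleton_eq_iff)
    then show ?thesis using True by (elim disjE) (simp_all add: ksign_def conj_commute)
  next
    case False
    have "?t x > ?t y \<longleftrightarrow> x > y"
      using that False by (simp add: Transposition.transpose_def doubleton_eq_iff) linarith
    then show ?thesis using False by simp
  qed
  have "(\<Prod>y\<leftarrow>xs. if x > y \<and> (o' \<circ> ?t) x \<and> (o' \<circ> ?t) y then - 1 else 1) *
      (\<Prod>y\<leftarrow>map ?t xs. if ?t x > y \<and> o' (?t x) \<and> o' y then - 1 else 1) = (\<Prod>y\<leftarrow>xs. ?p y)"
    by (induction xs) (auto simp: algebra_simps)
  also have "\<dots> = (\<Prod>y\<leftarrow>xs. if {x, y} = {k, Suc k} then ksign (o' k) (o' (Suc k)) else 1)"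
  proof (intro arg_cong[where f = prod_list] map_cong refl)
    fix y assume "y \<in> set xs"
    then have "y \<noteq> x" using Cons.prems by auto
    then show "?p y = (if {x, y} = {k, Suc k} then ksign (o' k) (o' (Suc k)) else 1)" by (rule p)
  qed
  also have "\<dots> = (if (x = k \<and> Suc k \<in> set xs) \<or> (x = Suc k \<and> k \<in> set xs) then ksign (o' k) (o' (Suc k)) else 1)"
    using Cons.prems by (induction xs) (auto simp: doubleton_eq_iff)
  finally have *: "(\<Prod>y\<leftarrow>xs. if x > y \<and> (o' \<circ> ?t) x \<and> (o' \<circ> ?t) y then - 1 else 1) *
      (\<Prod>y\<leftarrow>map ?t xs. if ?t x > y \<and> o' (?t x) \<and> o' y then - 1 else 1) =
     (if (x = k \<and> Suc k \<in> set xs) \<or> (x = Suc k \<and> k \<in> set xs) then ksign (o' k) (o' (Suc k)) else 1 :: 'a)" .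
  have "list_sign (o' \<circ> ?t) (x # xs) * list_sign o' (map ?t (x # xs)) =
    ((\<Prod>y\<leftarrow>xs. if x > y \<and> (o' \<circ> ?t) x \<and> (o' \<circ> ?t) y then - 1 else 1) *
      (\<Prod>y\<leftarrow>map ?t xs. if ?t x > y \<and> o' (?t x) \<and> o' y then - 1 else 1)) *
     (list_sign (o' \<circ> ?t) xs * list_sign o' (map ?t xs) :: 'a)"
    by (simp add: algebra_simps)
  also have "\<dots> = (if (x = k \<and> Suc k \<in> set xs) \<or> (x = Suc k \<and> k \<in> set xs) then ksign (o' k) (o' (Suc k)) else 1) *
     (if k \<in> set xs \<and> Suc k \<in> set xs then ksign (o' k) (o' (Suc k)) else 1)"
    unfolding * using Cons.IH Cons.prems by (simp only: distinct.simps simp_thms)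
  finally have fin: "list_sign (o' \<circ> ?t) (x # xs) * list_sign o' (map ?t (x # xs)) = \<dots>" .
  show ?case unfolding fin using Cons.prems by auto
qed simp

lemma list_sign_card:
  "(- 1) ^ card {(i, j). i < j \<and> j < length xs \<and> xs ! i > xs ! j \<and> o' (xs ! i) \<and> o' (xs ! j)} = list_sign o' xs"
proof (induction xs)
  case (Cons x xs)
  let ?Q = "\<lambda>xs i j. i < j \<and> j < length xs \<and> xs ! i > xs ! j \<and> o' (xs ! i) \<and> o' (xs ! j)"
  have fin: "finite {(i, j). ?Q xs i j}" for xs
    by (rule finite_subset[of _ "{..<length xs} \<times> {..<length xs}"]) auto
  \<comment> \<open>Inversions that involve the head, and inversions of the tail with both indices
    shifted by one.\<close>
  have eq: "{(i, j). ?Q (x # xs) i j} =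
      (\<lambda>j. (0, Suc j)) ` {j. j < length xs \<and> x > xs ! j \<and> o' x \<and> o' (xs ! j)} \<union>
      (\<lambda>(i, j). (Suc i, Suc j)) ` {(i, j). ?Q xs i j}" (is "?L = ?A \<union> ?B")
  proof (rule set_eqI)
    fix ij :: "nat \<times> nat"
    obtain i j where ij: "ij = (i, j)" by fastforce
    have A: "(i, j) \<in> (\<lambda>j. (0, Suc j)) ` P \<longleftrightarrow> i = 0 \<and> j > 0 \<and> j - 1 \<in> P" for P
      by (cases j) (auto simp: image_iff)
    have B: "(i, j) \<in> (\<lambda>(i, j). (Suc i, Suc j)) ` P \<longleftrightarrow> i > 0 \<and> j > 0 \<and> (i - 1, j - 1) \<in> P" for P
      by (cases i; cases j) (force simp: image_iff)+
    show "ij \<in> ?L \<longleftrightarrow> ij \<in> ?A \<union> ?B"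
      unfolding ij Un_iff A B by (cases i; cases j) simp_all
  qed
  have "card ?L = card ?A + card ?B"
    unfolding eq using fin[of xs] by (intro card_Un_disjoint) auto
  also have "card ?B = card {(i, j). ?Q xs i j}"
    by (rule card_image) (auto simp: inj_on_def)
  also have "card ?A = card {j. j < length xs \<and> x > xs ! j \<and> o' x \<and> o' (xs ! j)}"
    by (rule card_image) (auto simp: inj_on_def)
  also have "\<dots> = length (filter (\<lambda>y. x > y \<and> o' x \<and> o' y) xs)"
    by (simp add: length_filter_conv_card)
  finally have c: "card ?L = length (filter (\<lambda>y. x > y \<and> o' x \<and> o' y) xs) + card {(i, j). ?Q xs i j}" .
  have "(- 1) ^ length (filter (\<lambda>y. x > y \<and> o' x \<and> o' y) xs) =
     (\<Prod>y\<leftarrow>xs. if x > y \<and> o' x \<and> o' y then - 1 else 1 :: 'a)"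
    by (induction xs) auto
  with Cons.IH show ?case unfolding c power_add list_sign.simps by (simp only:)
qed simp

context graded_lcs
begin

subsection \<open>Labelled words\<close>

text \<open>
  Splitting every vector into its components and recording the chosen parity as a label makes Koszul
  signs depend on the labels alone; \<open>par\<close> could not serve here, because it assigns a parity to zero.
\<close>

fun hx :: "((bool \<times> 'v) list \<Rightarrow> 'k) \<Rightarrow> 'v list \<Rightarrow> 'k" where
  "hx F [] = F []"
| "hx F (v # vs) = (\<Sum>e\<in>UNIV. hx (\<lambda>l. F ((e, pr e v) # l)) vs)"

definition lab_ml :: "((bool \<times> 'v) list \<Rightarrow> 'k) \<Rightarrow> bool" where
  "lab_ml F \<longleftrightarrow> (\<forall>us e u v ws. F (us @ (e, u + v) # ws) = F (us @ (e, u) # ws) + F (us @ (e, v) # ws)) \<and>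
     (\<forall>us e c u ws. F (us @ (e, scale c u) # ws) = c * F (us @ (e, u) # ws))"

lemma lab_ml_Cons: 
  assumes "lab_ml F" shows "lab_ml (\<lambda>l. F (a # l))"
proof -
  have "F (us @ (e, u + v) # ws) = F (us @ (e, u) # ws) + F (us @ (e, v) # ws)"
    "F (us @ (e, scale c u) # ws) = c * F (us @ (e, u) # ws)" for us e u v ws c
    using assms unfolding lab_ml_def by blast+
  from this[of "a # _"] show ?thesis unfolding lab_ml_def by simp
qed

lemma hx_plus: "hx (\<lambda>l. F l + G l) vs = hx F vs + hx G vs"
  by (induction vs arbitrary: F G) (auto simp: sum.distrib)

lemma hx_times: "hx (\<lambda>l. c * F l) vs = c * hx F vs"
  by (induction vs arbitrary: F) (auto simp: sum_distrib_left)

lemma hx_sum: "hx (\<lambda>l. \<Sum>i\<in>A. F i l) vs = (\<Sum>i\<in>A. hx (F i) vs)"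
proof (induction A rule: infinite_finite_induct)
  case (insert x A)
  then show ?case by (simp add: hx_plus)
qed (use hx_times[of 0 "\<lambda>_. 0" vs] in simp_all)

lemma hx_zero [simp]: "hx (\<lambda>l. 0) vs = 0"
  using hx_times[of 0 "\<lambda>_. 0" vs] by simp

lemma hx_cong:
  assumes "\<And>l. length l = length vs \<Longrightarrow> (\<And>e v. (e, v) \<in> set l \<Longrightarrow> v \<in> Vpar e) \<Longrightarrow> F l = G l"
  shows "hx F vs = hx G vs"
  using assms
proof (induction vs arbitrary: F G)
  case (Cons v vs)
  have "hx (\<lambda>l. F ((e, pr e v) # l)) vs = hx (\<lambda>l. G ((e, pr e v) # l)) vs" for e
  proof (rule Cons.IH)
    fix l :: "(bool \<times> 'v) list"
    assume "length l = length vs" "\<And>e v. (e, v) \<in> set l \<Longrightarrow> v \<in> Vpar e"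
    then show "F ((e, pr e v) # l) = G ((e, pr e v) # l)"
      by (intro Cons.prems) auto
  qed
  then show ?case by simp
qed simp

lemma hx_ml:
  assumes "lab_ml F"
  shows "multilinear (hx F)"
proof -
  have "hx F (us @ (u + v) # ws) = hx F (us @ u # ws) + hx F (us @ v # ws) \<and>
     hx F (us @ scale c u # ws) = c * hx F (us @ u # ws)" for us u v ws c
    using assms
  proof (induction us arbitrary: F)
    case Nil
    have 1: "F ((e, u + v) # l) = F ((e, u) # l) + F ((e, v) # l)"
      "F ((e, scale c u) # l) = c * F ((e, u) # l)" for e u v c l
      using Nil unfolding lab_ml_def by (metis append_Nil)+
    show ?case
      by (simp add: pr_add pr_scale 1 hx_plus hx_times sum.distrib sum_distrib_left)
  next
    case (Cons a us)
    show ?case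
      using Cons.IH[OF lab_ml_Cons[OF Cons.prems]] by (simp add: sum.distrib sum_distrib_left)
  qed
  then show ?thesis by (intro multilinearI) auto
qed

text \<open>Every labelled word with a wrong label contains a zero vector, so a single summand
  survives. This is the passage from labels back to \<open>par\<close>, which labels the vector 0 as
  even.\<close>

lemma hx_homogeneous:
  assumes "lab_ml F" "\<forall>v\<in>set vs. homogeneous v"
  shows "hx F vs = F (map (\<lambda>v. (par v = 1, v)) vs)"
  using assms
proof (induction vs arbitrary: F)
  case (Cons v vs)
  have zero: "hx (\<lambda>l. F ((e, 0) # l)) vs = 0" for e
  proof -
    have "F ([] @ (e, scale 0 0) # l) = 0 * F ([] @ (e, 0) # l)" for l
      using Cons.prems(1) unfolding lab_ml_def by blast
    then show ?thesis by simp
  qed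
  obtain e where v: "v \<in> Vpar e" "par v = 1 \<longleftrightarrow> e"
    using that[of "v \<notin> V0"] Cons.prems(2) by (cases "v \<in> V0") (auto simp: homogeneous_def par_def Vpar_def)
  have "hx F (v # vs) = hx (\<lambda>l. F ((e, v) # l)) vs"
    using v(1) by (cases e) (auto simp: UNIV_bool_sum pr_same pr_other zero)
  also have "\<dots> = F ((e, v) # map (\<lambda>v. (par v = 1, v)) vs)"
    using Cons.prems by (intro Cons.IH lab_ml_Cons) auto
  finally show ?case using v(2) by simp
qed simp

lemma hx_snd: "multilinear f \<Longrightarrow> hx (\<lambda>l. f (map snd l)) vs = f vs"
proof (induction vs arbitrary: f)
  case (Cons v vs)
  have "f (pr False v # vs) + f (pr True v # vs) = f (v # vs)"
    using lin_form_add[OF ml_Cons_lin[OF Cons.prems], of "pr False v" "pr True v"] by (simp add: pr_sum)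
  then show ?case
    by (simp add: UNIV_bool_sum Cons.IH[OF ml_Cons[OF Cons.prems]])
qed simp

text \<open>Of the four pairs of labels for \<open>x\<close> and \<open>y\<close> only the odd-odd
  one is not a plain exchange; flipping its sign means subtracting it twice.\<close>

lemma hx_gs:
  assumes "lab_ml F"
    and "\<And>us e x e' y ws. F (us @ (e, x) # (e', y) # ws) = ksign e e' * F (us @ (e', y) # (e, x) # ws)"
  shows "graded_symmetric (hx F)"
proof (rule graded_symmetricI[OF hx_ml[OF assms(1)]])
  fix us x y ws
  show "hx F (us @ x # y # ws) = hx F (us @ y # x # ws) - 2 * hx F (us @ pr True y # pr True x # ws)"
    using assms
  proof (induction us arbitrary: F)
    case Nil
    have sw: "F ((e, x) # (e', y) # ws) = ksign e e' * F ((e', y) # (e, x) # ws)" for e x e' y ws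
      using Nil(2)[of "[]" e x e' y ws] by (simp only: append_Nil)
    have 0: "F ((False, 0) # l) = 0" "F ((a) # (False, 0) # l) = 0" for l a
    proof -
      have *: "F (us @ (False, scale 0 0) # l) = 0 * F (us @ (False, 0) # l)" for us
        using Nil(1) unfolding lab_ml_def by blast
      from *[of "[]"] *[of "[a]"] show "F ((False, 0) # l) = 0" "F ((a) # (False, 0) # l) = 0" by auto
    qed
    have xy: "hx F (x # y # ws) = (\<Sum>e\<in>UNIV. \<Sum>e'\<in>UNIV. ksign e e' * hx (\<lambda>l. F ((e', pr e' y) # (e, pr e x) # l)) ws)"
      unfolding hx.simps hx_times[symmetric] by (subst sw) (rule refl)
    show ?case
      unfolding append_Nil xy by (simp add: UNIV_bool_sum 0)
  next
    case (Cons a us)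
    have "hx (\<lambda>l. F ((e, pr e a) # l)) (us @ x # y # ws) = hx (\<lambda>l. F ((e, pr e a) # l)) (us @ y # x # ws) -
        2 * hx (\<lambda>l. F ((e, pr e a) # l)) (us @ pr True y # pr True x # ws)" for e
    proof (rule Cons.IH[OF lab_ml_Cons[OF Cons.prems(1)]])
      fix us e1 x e' y ws
      show "F ((e, pr e a) # us @ (e1, x) # (e', y) # ws) = ksign e1 e' * F ((e, pr e a) # us @ (e', y) # (e1, x) # ws)"
        using Cons.prems(2)[of "(e, pr e a) # us" e1 x e' y ws] by (simp only: append_Cons)
    qed
    then show ?case
      unfolding append_Cons hx.simps by (simp add: sum_subtractf sum_distrib_left)
  qed
qed

subsection \<open>The symmetrizer on forms\<close>

text \<open>The permutation enters by its list of values, so that it can be changed by one exchange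
  of neighbours at a time.\<close>

definition index_act :: "('v list \<Rightarrow> 'k) \<Rightarrow> nat list \<Rightarrow> (bool \<times> 'v) list \<Rightarrow> 'k" where
  "index_act f xs l = list_sign ((!) (map fst l)) xs * f (map ((!) (map snd l)) xs)"

lemma gs_swap_homogeneous:
  assumes "graded_symmetric f" "x \<in> Vpar e" "y \<in> Vpar e'"
  shows "f (us @ x # y # ws) = ksign e e' * f (us @ y # x # ws)"
proof -
  have 0: "f (us @ y # 0 # ws) = 0" "f (us @ 0 # x # ws) = 0" for x y
    using ml_slot_0[OF gs_ml[OF assms(1)], of "us @ [y]"] ml_slot_0[OF gs_ml[OF assms(1)], of "us"] by auto
  have "f (us @ x # y # ws) = f (us @ y # x # ws) - 2 * f (us @ pr True y # pr True x # ws)"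
    by (rule gs_swap[OF assms(1)])
  then show ?thesis
    using assms(2,3) 0 by (cases e; cases e') (auto simp: pr_same pr_other[of _ True])
qed

text \<open>Each exchange of neighbours in the value list multiplies the sign and the value of
  \<open>f\<close> by the same factor 1 or -1, which cancels; hence the list may be sorted.\<close>

lemma index_act_gs:
  assumes f: "graded_symmetric f" and l: "\<And>e v. (e, v) \<in> set l \<Longrightarrow> v \<in> Vpar e"
    and p: "\<sigma> permutes {..<length l}"
  shows "index_act f (map \<sigma> [0..<length l]) l = f (map snd l)"
proof -
  let ?n = "length l"
  \<comment> \<open>\<open>swap_invariant_sort\<close> asks for invariance on all distinct lists;
    the value 0 covers those with indices outside the word.\<close>
  define h where "h xs = (if set xs \<subseteq> {..<?n} then index_act f xs l else 0)" for xs
  have hom: "map snd l ! i \<in> Vpar (map fst l ! i)" if "i < ?n" for i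
    using that l[of "fst (l ! i)" "snd (l ! i)"] by simp
  have swap: "h (as @ x # y # bs) = h (as @ y # x # bs)" if "distinct (as @ x # y # bs)" for as x y bs
  proof (cases "set (as @ x # y # bs) \<subseteq> {..<?n}")
    case True
    then have x: "x < ?n" "y < ?n" by auto
    have 1: "f (map ((!) (map snd l)) (as @ x # y # bs)) = ksign (map fst l ! x) (map fst l ! y) *
       f (map ((!) (map snd l)) (as @ y # x # bs))"
      unfolding map_append list.map by (rule gs_swap_homogeneous[OF f hom[OF x(1)] hom[OF x(2)]])
    have "x \<noteq> y" using that by auto
    then have 2: "list_sign ((!) (map fst l)) (as @ x # y # bs) = ksign (map fst l ! x) (map fst l ! y) *
        list_sign ((!) (map fst l)) (as @ y # x # bs)"
      by (rule list_sign_swap)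
    have "index_act f (as @ x # y # bs) l = index_act f (as @ y # x # bs) l"
      unfolding index_act_def 1 2 by (auto simp: ksign_def)
    then show ?thesis using True by (auto simp: h_def)
  qed (auto simp: h_def)
  have d: "distinct (map \<sigma> [0..<?n])"
    using p by (simp add: distinct_map permutes_inj_on[OF p] del: upt_Suc)
  have s: "set (map \<sigma> [0..<?n]) = {..<?n}"
    using permutes_image[OF p] by (simp add: lessThan_atLeast0)
  have "sort (map \<sigma> [0..<?n]) = [0..<?n]"
    using d s by (intro sorted_distinct_set_unique) (auto simp: distinct_map)
  then have "h (map \<sigma> [0..<?n]) = h [0..<?n]"
    using swap_invariant_sort[of h "[]" "map \<sigma> [0..<?n]", OF swap] d by simp
  also have "\<dots> = index_act f [0..<?n] l" by (simp add: h_def atLeast0LessThan)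
  also have "\<dots> = f (map snd l)"
    by (simp add: index_act_def list_sign_sorted) (metis length_map map_nth)
  also have "h (map \<sigma> [0..<?n]) = index_act f (map \<sigma> [0..<?n]) l"
    using s by (simp add: h_def)
  finally show ?thesis .
qed

lemma index_act_lab_ml:
  assumes f: "multilinear f" and p: "\<sigma> permutes {..<n}"
  shows "lab_ml (\<lambda>l. if length l = n then index_act f (map \<sigma> [0..<n]) l else 0)"
proof -
  \<comment> \<open>The entry at position \<open>length us\<close> appears exactly once in the
    permuted word, at position \<open>inv \<sigma> (length us)\<close>, and the sign depends on
    labels only; hence a single slot of \<open>f\<close> varies.\<close>
  have key: "\<exists>c A B. \<forall>x. index_act f (map \<sigma> [0..<n]) (us @ (e, x) # ws) = c * f (A @ x # B)"
    if n: "length us + length ws + 1 = n" for us e ws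
  proof -
    let ?i = "length us"
    define k where "k = inv \<sigma> ?i"
    have i: "?i < n" using n by simp
    have k: "\<sigma> k = ?i" by (simp add: k_def permutes_inverses[OF p])
    have kn: "k < n" using k i p by (metis lessThan_iff permutes_in_image)
    have "map ((!) (map snd (us @ (e, x) # ws))) (map \<sigma> [0..<n]) =
        (map (\<lambda>i. map snd (us @ (e, 0) # ws) ! \<sigma> i) [0..<n])[k := x]" for x
    proof (rule nth_equalityI)
      fix i assume "i < length (map ((!) (map snd (us @ (e, x) # ws))) (map \<sigma> [0..<n]))"
      then have i: "i < n" by simp
      have "\<sigma> i = ?i \<longleftrightarrow> i = k" by (metis k permutes_inj[OF p] inj_eq)
      then show "map ((!) (map snd (us @ (e, x) # ws))) (map \<sigma> [0..<n]) ! i =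
         (map (\<lambda>i. map snd (us @ (e, 0) # ws) ! \<sigma> i) [0..<n])[k := x] ! i"
        using i kn by (auto simp: nth_list_update nth_append nth_Cons' simp flip: map_map)
    qed simp
    then have eq: "map ((!) (map snd (us @ (e, x) # ws))) (map \<sigma> [0..<n]) =
       take k (map (\<lambda>i. map snd (us @ (e, 0) # ws) ! \<sigma> i) [0..<n]) @ x #
       drop (Suc k) (map (\<lambda>i. map snd (us @ (e, 0) # ws) ! \<sigma> i) [0..<n])" for x
      using kn by (simp add: upd_conv_take_nth_drop)
    show ?thesis
      unfolding index_act_def eq by auto
  qed
  show ?thesis
    unfolding lab_ml_def
  proof (intro conjI allI)
    fix us e u v ws c
    show "(if length (us @ (e, u + v) # ws) = n then index_act f (map \<sigma> [0..<n]) (us @ (e, u + v) # ws) else 0) =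
      (if length (us @ (e, u) # ws) = n then index_act f (map \<sigma> [0..<n]) (us @ (e, u) # ws) else 0) +
      (if length (us @ (e, v) # ws) = n then index_act f (map \<sigma> [0..<n]) (us @ (e, v) # ws) else 0)"
      using key[of us ws e] ml_add[OF f] by (auto simp: algebra_simps)
    show "(if length (us @ (e, scale c u) # ws) = n then index_act f (map \<sigma> [0..<n]) (us @ (e, scale c u) # ws) else 0) =
      c * (if length (us @ (e, u) # ws) = n then index_act f (map \<sigma> [0..<n]) (us @ (e, u) # ws) else 0)"
      using key[of us ws e] ml_scale[OF f] by (auto simp: algebra_simps)
  qed
qed

definition sym_label :: "('v list \<Rightarrow> 'k) \<Rightarrow> (bool \<times> 'v) list \<Rightarrow> 'k" where
  "sym_label f l = 1 / fact (length l) * (\<Sum>\<sigma> | \<sigma> permutes {..<length l}. index_act f (map \<sigma> [0..<length l]) l)"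

definition Symf :: "('v list \<Rightarrow> 'k) \<Rightarrow> 'v list \<Rightarrow> 'k" where
  "Symf f = hx (sym_label f)"

lemma sym_label_lab_ml:
  assumes "multilinear f"
  shows "lab_ml (sym_label f)"
proof -
  define G where "G n \<sigma> l = (if length l = n then index_act f (map \<sigma> [0..<n]) l else 0)" for n \<sigma> l
  have G: "G n \<sigma> (us @ (e, u + v) # ws) = G n \<sigma> (us @ (e, u) # ws) + G n \<sigma> (us @ (e, v) # ws)"
    "G n \<sigma> (us @ (e, scale c u) # ws) = c * G n \<sigma> (us @ (e, u) # ws)" 
    if "\<sigma> permutes {..<n}" for n \<sigma> us e u v ws c
    using index_act_lab_ml[OF assms that] unfolding lab_ml_def G_def by blast+
  have L: "sym_label f l = 1 / fact n * (\<Sum>\<sigma> | \<sigma> permutes {..<n}. G n \<sigma> l)" if "length l = n" for l n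
    using that by (simp add: sym_label_def G_def)
  show ?thesis
    unfolding lab_ml_def
  proof (intro conjI allI)
    fix us ws :: "(bool \<times> 'v) list" and e u v c
    let ?n = "Suc (length us + length ws)"
    have n: "length (us @ (e, u) # ws) = ?n" for u by simp
    have "(\<Sum>\<sigma> | \<sigma> permutes {..<?n}. G ?n \<sigma> (us @ (e, u + v) # ws)) =
        (\<Sum>\<sigma> | \<sigma> permutes {..<?n}. G ?n \<sigma> (us @ (e, u) # ws) + G ?n \<sigma> (us @ (e, v) # ws))"
      by (rule sum.cong) (simp_all only: G mem_Collect_eq)
    then show "sym_label f (us @ (e, u + v) # ws) = sym_label f (us @ (e, u) # ws) + sym_label f (us @ (e, v) # ws)"
      unfolding L[OF n] by (simp only: sum.distrib distrib_left)
    have "(\<Sum>\<sigma> | \<sigma> permutes {..<?n}. G ?n \<sigma> (us @ (e, scale c u) # ws)) =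
        (\<Sum>\<sigma> | \<sigma> permutes {..<?n}. c * G ?n \<sigma> (us @ (e, u) # ws))"
      by (rule sum.cong) (simp_all only: G mem_Collect_eq)
    then show "sym_label f (us @ (e, scale c u) # ws) = c * sym_label f (us @ (e, u) # ws)"
      unfolding L[OF n] by (simp only: sum_distrib_left[symmetric] mult.left_commute)
  qed
qed

text \<open>Reindexing the average by left composition with the transposition of the two positions
  permutes the summands; \<open>list_sign_transpose\<close> gives the sign that each of them
  acquires.\<close>

lemma sym_label_swap:
  "sym_label f (us @ (e, x) # (e', y) # ws) = ksign e e' * sym_label f (us @ (e', y) # (e, x) # ws)"
proof -
  let ?k = "length us"
  let ?l = "us @ (e, x) # (e', y) # ws" and ?l' = "us @ (e', y) # (e, x) # ws"
  let ?n = "Suc (Suc (length us + length ws))"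
  let ?t = "Transposition.transpose ?k (Suc ?k)"
  have t: "?t permutes {..<?n}" by (rule permutes_swap_id) auto
  have nt: "map g ?l ! ?t i = map g ?l' ! i" if "i < ?n" for i and g :: "bool \<times> 'v \<Rightarrow> 'c"
    using that by (auto simp: Transposition.transpose_def nth_append nth_Cons')
  have "index_act f (map \<sigma> [0..<?n]) ?l' = ksign e e' * index_act f (map (?t \<circ> \<sigma>) [0..<?n]) ?l"
    if p: "\<sigma> permutes {..<?n}" for \<sigma>
  proof -
    let ?xs = "map \<sigma> [0..<?n]"
    have d: "distinct ?xs"
      using p by (simp add: distinct_map permutes_inj_on[OF p] del: upt_Suc)
    have s: "set ?xs = {..<?n}"
      using permutes_image[OF p] by (simp add: lessThan_atLeast0 del: upt_Suc)
    have 1: "map ((!) (map snd ?l')) ?xs = map ((!) (map snd ?l)) (map ?t ?xs)"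
    proof (unfold map_map, rule map_cong[OF refl])
      fix i assume "i \<in> set [0..<?n]"
      then have "\<sigma> i < ?n" using permutes_in_image[OF p, of i] by auto
      then show "((!) (map snd ?l') \<circ> \<sigma>) i = ((!) (map snd ?l) \<circ> (?t \<circ> \<sigma>)) i"
        using nt[of "\<sigma> i" snd] by (simp only: comp_def)
    qed
    have cong: "list_sign o1 xs = (list_sign o2 xs :: 'k)" if "\<And>x. x \<in> set xs \<Longrightarrow> o1 x = o2 x" for o1 o2 xs
      using that
    proof (induction xs)
      case (Cons a xs)
      then have "(\<Prod>y\<leftarrow>xs. if a > y \<and> o1 a \<and> o1 y then - 1 else 1) =
         (\<Prod>y\<leftarrow>xs. if a > y \<and> o2 a \<and> o2 y then - 1 else 1 :: 'k)"
        by (intro arg_cong[where f = prod_list] map_cong) auto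
      with Cons show ?case by simp
    qed simp
    have "list_sign ((!) (map fst ?l')) ?xs = (list_sign ((!) (map fst ?l) \<circ> ?t) ?xs :: 'k)"
    proof (rule cong)
      fix i assume "i \<in> set ?xs"
      then have "i < ?n" unfolding s by simp
      then show "map fst ?l' ! i = ((!) (map fst ?l) \<circ> ?t) i"
        using nt[of i fst] by (simp only: comp_def)
    qed
    moreover have "list_sign ((!) (map fst ?l) \<circ> ?t) ?xs * list_sign ((!) (map fst ?l)) (map ?t ?xs) =
        (ksign (map fst ?l ! ?k) (map fst ?l ! Suc ?k) :: 'k)"
      using list_sign_transpose[OF d, of "(!) (map fst ?l)" ?k] unfolding s by simp
    ultimately have 2: "list_sign ((!) (map fst ?l')) ?xs * list_sign ((!) (map fst ?l)) (map ?t ?xs) = (ksign e e' :: 'k)"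
      by (simp add: nth_append)
    have sq: "list_sign o1 xs * list_sign o1 xs = (1::'k)" for o1 xs
    proof (induction xs)
      case (Cons a xs)
      have "(\<Prod>y\<leftarrow>xs. if a > y \<and> o1 a \<and> o1 y then - 1 else 1) *
         (\<Prod>y\<leftarrow>xs. if a > y \<and> o1 a \<and> o1 y then - 1 else 1 :: 'k) = 1"
        by (induction xs) auto
      then show ?case using Cons by (simp add: algebra_simps)
    qed simp
    have "list_sign ((!) (map fst ?l')) ?xs = (ksign e e' * list_sign ((!) (map fst ?l)) (map ?t ?xs) :: 'k)"
    proof -
      have *: "a = c * b" if "a * b = c" "b * b = 1" for a b c :: 'k
        using that by (metis mult.assoc mult.right_neutral)
      show ?thesis by (rule *[OF 2 sq])
    qed
    then show ?thesis
      unfolding index_act_def 1 map_map[symmetric] by (simp only: mult.assoc)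
  qed
  then have "(\<Sum>\<sigma> | \<sigma> permutes {..<?n}. index_act f (map \<sigma> [0..<?n]) ?l') =
    (\<Sum>\<sigma> | \<sigma> permutes {..<?n}. ksign e e' * index_act f (map (?t \<circ> \<sigma>) [0..<?n]) ?l)"
    by (intro sum.cong) auto
  also have "\<dots> = ksign e e' * (\<Sum>\<sigma> | \<sigma> permutes {..<?n}. index_act f (map \<sigma> [0..<?n]) ?l)"
    by (subst setum_permutations_compose_left[OF t, of "\<lambda>\<sigma>. index_act f (map \<sigma> [0..<?n]) ?l"])
      (simp add: sum_distrib_left)
  finally have "(\<Sum>\<sigma> | \<sigma> permutes {..<?n}. index_act f (map \<sigma> [0..<?n]) ?l') =
     ksign e e' * (\<Sum>\<sigma> | \<sigma> permutes {..<?n}. index_act f (map \<sigma> [0..<?n]) ?l)" .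
  then show ?thesis
    unfolding sym_label_def by (auto simp: ksign_def)
qed

lemma Symf_gs: "multilinear f \<Longrightarrow> graded_symmetric (Symf f)"
  unfolding Symf_def by (intro hx_gs sym_label_lab_ml sym_label_swap)

lemma Symf_ml: "multilinear f \<Longrightarrow> multilinear (Symf f)"
  by (rule gs_ml[OF Symf_gs])

lemma Symf_id:
  assumes "graded_symmetric f"
  shows "Symf f = f"
proof
  fix vs
  have "Symf f vs = hx (\<lambda>l. f (map snd l)) vs"
    unfolding Symf_def
  proof (rule hx_cong)
    fix l :: "(bool \<times> 'v) list"
    assume l: "\<And>e v. (e, v) \<in> set l \<Longrightarrow> v \<in> Vpar e"
    have "(\<Sum>\<sigma> | \<sigma> permutes {..<length l}. index_act f (map \<sigma> [0..<length l]) l) =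
       (\<Sum>\<sigma> | \<sigma> permutes {..<length l}. f (map snd l))"
      by (rule sum.cong) (auto simp: index_act_gs[OF assms l])
    also have "\<dots> = fact (length l) * f (map snd l)"
      by (simp add: card_permutations)
    finally show "sym_label f l = f (map snd l)"
      unfolding sym_label_def by simp
  qed
  also have "\<dots> = f vs" by (rule hx_snd[OF gs_ml[OF assms]])
  finally show "Symf f vs = f vs" .
qed

end

text \<open>
  Their left-hand sides eta-contract, so as rewrite rules they would also turn unapplied sums of
  tensors into abstractions, to which the additivity lemmas no longer apply.
\<close>

lemmas fun_arith_apply = fscale_apply plus_fun_apply zero_fun_apply sum_fun_apply
declare fscale_apply [simp del] plus_fun_apply [simp del] zero_fun_apply [simp del]

lemma fs_span_map:
  fixes \<Phi> :: "('x \<Rightarrow> 'k::real_normed_field) \<Rightarrow> ('y \<Rightarrow> 'k)"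
  assumes add: "\<And>s t. \<Phi> (s + t) = \<Phi> s + \<Phi> t" and scale: "\<And>c s. \<Phi> (fscale c s) = fscale c (\<Phi> s)"
    and A: "\<And>a. a \<in> A \<Longrightarrow> \<Phi> a \<in> fs.span B" and t: "t \<in> fs.span A"
  shows "\<Phi> t \<in> fs.span B"
  using t
proof (induction rule: fs.span_induct_alt)
  case base
  have "\<Phi> 0 = 0" using scale[of 0 0] by simp
  then show ?case by (simp only: fs.span_zero)
next
  case (step c x y)
  show ?case unfolding add scale
    by (rule fs.span_add[OF fs.span_scale[OF A[OF step.hyps]] step.IH])
qed

section \<open>Tensors as functionals on multilinear forms\<close>

context graded_lcs
begin

definition bilin where
  "bilin B \<longleftrightarrow> (\<forall>a\<in>tensor_algebra. \<forall>b\<in>tensor_algebra. \<forall>c\<in>tensor_algebra.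
           B (a + b) c = B a c + B b c \<and> B c (a + b) = B c a + B c b) \<and>
        (\<forall>r. \<forall>a\<in>tensor_algebra. \<forall>b\<in>tensor_algebra.
           B (fscale r a) b = r * B a b \<and> B a (fscale r b) = r * (B a b :: 'k))"

lemma tensor_pair_eq: "tensor_pair s t B = (if bilin B then B s t else 0)"
  by (simp add: tensor_pair_def bilin_def)

lemma T_induct [consumes 1, case_names zero step]:
  assumes "t \<in> tensor_algebra" "P 0"
    and "\<And>c vs s. s \<in> tensor_algebra \<Longrightarrow> P s \<Longrightarrow> P (fscale c (tensor vs) + s)"
  shows "P t"
proof -
  have "t \<in> tensor_algebra \<and> P t"
    using assms(1)[unfolded tensor_algebra_def]
  proof (induction rule: fs.span_induct_alt)
    case base
    show ?case unfolding tensor_algebra_def using assms(2) fs.span_zero by blast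
  next
    case (step c x y)
    then obtain vs where "x = tensor vs" by auto
    then show ?case
      using step.IH assms(3) fs.span_add[OF fs.span_scale[OF fs.span_base[of "tensor vs"]], of "range tensor" y c]
      unfolding tensor_algebra_def by blast
  qed
  then show ?thesis by simp
qed

lemma T_tensor [simp]: "tensor vs \<in> tensor_algebra"
  by (simp add: tensor_algebra_def fs.span_base)

lemma T_add [simp]: "a \<in> tensor_algebra \<Longrightarrow> b \<in> tensor_algebra \<Longrightarrow> a + b \<in> tensor_algebra"
  unfolding tensor_algebra_def by (rule fs.span_add)

lemma T_scale [simp]: "a \<in> tensor_algebra \<Longrightarrow> fscale c a \<in> tensor_algebra"
  unfolding tensor_algebra_def by (rule fs.span_scale)

lemma T_0 [simp]: "0 \<in> tensor_algebra"
  unfolding tensor_algebra_def by (rule fs.span_zero)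

text \<open>A tensor takes the value 0 at functions that are not multilinear, so additivity is
  available on multilinear forms only. The side conditions on multilinearity in later proofs come
  from here.\<close>

lemma T_form_plus:
  "t \<in> tensor_algebra \<Longrightarrow> multilinear f \<Longrightarrow> multilinear g \<Longrightarrow> t (\<lambda>vs. f vs + g vs) = t f + t g"
  by (induction rule: T_induct) (auto simp: tensor_def ml_plus algebra_simps fun_arith_apply)

lemma T_form_times: "t \<in> tensor_algebra \<Longrightarrow> multilinear f \<Longrightarrow> t (\<lambda>vs. c * f vs) = c * t f"
  by (induction rule: T_induct) (auto simp: tensor_def ml_times algebra_simps fun_arith_apply)

lemma T_form_zero: "t \<in> tensor_algebra \<Longrightarrow> t (\<lambda>vs. 0) = 0"
  using T_form_times[of t "\<lambda>_. 0" 0] by (simp add: ml_zero)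

lemma T_form_sum:
  assumes "t \<in> tensor_algebra" "\<And>i. i \<in> A \<Longrightarrow> multilinear (F i)"
  shows "t (\<lambda>vs. \<Sum>i\<in>A. F i vs) = (\<Sum>i\<in>A. t (F i))"
  using assms(2)
proof (induction A rule: infinite_finite_induct)
  case (insert x A)
  have "t (\<lambda>vs. F x vs + (\<Sum>i\<in>A. F i vs)) = t (F x) + t (\<lambda>vs. \<Sum>i\<in>A. F i vs)"
    using insert.prems by (intro T_form_plus[OF assms(1)] ml_sum) auto
  then show ?case using insert by simp
qed (use assms in \<open>auto simp: T_form_zero\<close>)

text \<open>A tensor has only finitely many degrees, and \<open>N\<close> exceeds all of them. Since
  \<open>N\<close> does not depend on \<open>h\<close>, series can be cut off before the form is
  known.\<close>

lemma T_bound: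
  assumes "t \<in> tensor_algebra"
  shows "\<exists>N. \<forall>h. multilinear h \<longrightarrow> (\<forall>vs. length vs < N \<longrightarrow> h vs = 0) \<longrightarrow> t h = 0"
  using assms
proof (induction rule: T_induct)
  case (step c vs s)
  then obtain N where N: "\<And>h. multilinear h \<Longrightarrow> (\<forall>vs. length vs < N \<longrightarrow> h vs = 0) \<Longrightarrow> s h = 0" by blast
  show ?case
    by (rule exI[of _ "max N (Suc (length vs))"]) (auto simp: tensor_def fun_arith_apply intro!: N)
qed (simp add: zero_fun_apply)

text \<open>The bilinear form on the tensor algebra that is induced by a form in two words; elements
  of the tensor square are tested against it.\<close>

definition pairing :: "('v list \<Rightarrow> 'v list \<Rightarrow> 'k) \<Rightarrow> (('v list \<Rightarrow> 'k) \<Rightarrow> 'k) \<Rightarrow> (('v list \<Rightarrow> 'k) \<Rightarrow> 'k) \<Rightarrow> 'k" where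
  "pairing g s t = s (\<lambda>vs. t (g vs))"

definition bi_ml :: "('v list \<Rightarrow> 'v list \<Rightarrow> 'k) \<Rightarrow> bool" where
  "bi_ml g \<longleftrightarrow> (\<forall>ws. multilinear (\<lambda>vs. g vs ws)) \<and> (\<forall>vs. multilinear (g vs))"

lemma pairing_inner_ml:
  assumes "bi_ml g" "t \<in> tensor_algebra"
  shows "multilinear (\<lambda>vs. t (g vs))"
proof (rule multilinearI)
  have m: "multilinear (g vs)" "multilinear (\<lambda>vs. g vs ws)" for vs ws
    using assms(1) by (auto simp: bi_ml_def)
  fix us u v ws c
  have "g (us @ (u + v) # ws) = (\<lambda>xs. g (us @ u # ws) xs + g (us @ v # ws) xs)"
    "g (us @ scale c u # ws) = (\<lambda>xs. c * g (us @ u # ws) xs)"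
    by (simp_all add: fun_eq_iff ml_add[OF m(2)] ml_scale[OF m(2)])
  then show "t (g (us @ (u + v) # ws)) = t (g (us @ u # ws)) + t (g (us @ v # ws))"
    "t (g (us @ scale c u # ws)) = c * t (g (us @ u # ws))"
    using T_form_plus[OF assms(2) m(1) m(1)] T_form_times[OF assms(2) m(1)] by simp_all
qed

lemma pairing_bilin:
  assumes "bi_ml g"
  shows "bilin (pairing g)"
  unfolding bilin_def pairing_def
  using T_form_plus[OF _ pairing_inner_ml[OF assms] pairing_inner_ml[OF assms]]
    T_form_times[OF _ pairing_inner_ml[OF assms]]
  by (simp add: fun_arith_apply)

lemma pairing_tensor: "bi_ml g \<Longrightarrow> pairing g (tensor vs) (tensor ws) = g vs ws"
  using pairing_inner_ml[of g "tensor ws"] by (auto simp: pairing_def tensor_def bi_ml_def)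

definition restr :: "nat \<Rightarrow> ('v list \<Rightarrow> 'k) \<Rightarrow> 'v list \<Rightarrow> 'k" where
  "restr n f vs = (if length vs = n then f vs else 0)"

lemma restr_ml: "multilinear f \<Longrightarrow> multilinear (restr n f)"
  by (rule multilinearI) (simp_all add: restr_def ml_add ml_scale)

text \<open>The component of degree \<open>n\<close> as the transpose of restricting forms to words
  of length \<open>n\<close>. Like the other transposed maps it is set to 0 off the multilinear
  forms, as tensors are.\<close>

definition comp :: "nat \<Rightarrow> (('v list \<Rightarrow> 'k) \<Rightarrow> 'k) \<Rightarrow> ('v list \<Rightarrow> 'k) \<Rightarrow> 'k" where
  "comp n t = (\<lambda>f. if multilinear f then t (restr n f) else 0)"

lemma comp_add: "comp n (s + t) = comp n s + comp n t"
  and comp_scale: "comp n (fscale c t) = fscale c (comp n t)"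
  by (auto simp: comp_def fun_eq_iff fun_arith_apply)

lemma comp_tensor: "comp n (tensor vs) = (if length vs = n then tensor vs else 0)"
  by (auto simp: comp_def tensor_def fun_eq_iff restr_ml restr_def fun_arith_apply)

lemma component_eq:
  assumes "t \<in> tensor_algebra"
  shows "component n t = comp n t"
  unfolding component_def
proof (rule lin_ext_eq[where \<Phi> = "comp n", OF comp_add comp_scale])
  have "fst ` {(tensor vs, if length vs = n then tensor vs else 0) |vs. True} = range tensor"
  proof -
    have "{(tensor vs, if length vs = n then tensor vs else 0) |vs. True} =
        range (\<lambda>vs. (tensor vs, if length vs = n then tensor vs else 0))"
      by blast
    then show ?thesis by (simp only: image_image fst_conv)
  qed
  then show "t \<in> fs.span (fst ` {(tensor vs, if length vs = n then tensor vs else 0) |vs. True})"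
    using assms by (simp only: tensor_algebra_def)
  fix x y assume "(x, y) \<in> {(tensor vs, if length vs = n then tensor vs else 0) |vs. True}"
  then show "y = comp n x" by (clarify, simp only: comp_tensor)
qed

lemma tensor_power_T: "t \<in> tensor_power n \<Longrightarrow> t \<in> tensor_algebra"
  unfolding tensor_power_def tensor_algebra_def by (erule set_mp[OF fs.span_mono, rotated]) auto

lemma comp_tensor_power:
  assumes "t \<in> tensor_algebra"
  shows "comp n t \<in> tensor_power n"
  unfolding tensor_power_def
proof (rule fs_span_map[where \<Phi> = "comp n", OF comp_add comp_scale _ assms[unfolded tensor_algebra_def]])
  fix a :: "('v list \<Rightarrow> 'k) \<Rightarrow> 'k" assume "a \<in> range tensor"
  then obtain vs where a: "a = tensor vs" by auto
  show "comp n a \<in> fs.span {tensor vs |vs. length vs = n}"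
    unfolding a comp_tensor by (auto simp only: fs.span_zero split: if_splits intro!: fs.span_base)
qed

lemma tensor_power_cong:
  assumes "t \<in> tensor_power n" "multilinear f" "multilinear g" "\<And>vs. length vs = n \<Longrightarrow> f vs = g vs"
  shows "t f = t g"
  using assms(1) unfolding tensor_power_def
  by (induction rule: fs.span_induct_alt) (use assms in \<open>auto simp: tensor_def fun_arith_apply\<close>)

lemma T_decomp:
  assumes "t \<in> tensor_algebra"
  shows "\<exists>N. \<forall>M\<ge>N. comp M t = 0 \<and> t = (\<Sum>n<M. comp n t)"
  using assms
proof (induction rule: T_induct)
  case zero
  show ?case by (intro exI[of _ 0]) (auto simp: comp_def fun_eq_iff fun_arith_apply)
next
  case (step c vs s)
  then obtain N where N: "\<And>M. M \<ge> N \<Longrightarrow> comp M s = 0 \<and> s = (\<Sum>n<M. comp n s)" by blast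
  have "comp M (fscale c (tensor vs) + s) = 0 \<and> fscale c (tensor vs) + s = (\<Sum>n<M. comp n (fscale c (tensor vs) + s))"
    if "M \<ge> max N (Suc (length vs))" for M
  proof -
    have "(\<Sum>n<M. comp n (fscale c (tensor vs) + s)) = (\<Sum>n<M. fscale c (comp n (tensor vs))) + (\<Sum>n<M. comp n s)"
      by (simp only: comp_add comp_scale sum.distrib)
    also have "(\<Sum>n<M. comp n s) = s" using N[of M] that by simp
    also have "(\<Sum>n<M. fscale c (comp n (tensor vs))) = (\<Sum>n<M. if n = length vs then fscale c (tensor vs) else 0)"
      by (rule sum.cong) (auto simp: comp_tensor)
    also have "\<dots> = fscale c (tensor vs)" using that by simp
    finally show ?thesis using N[of M] that
      by (simp add: comp_add comp_scale comp_tensor fs.scale_zero_right)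
  qed
  then show ?case by blast
qed

text \<open>\<open>perm_action\<close> and \<open>P_Lambda\<close> are prescribed on homogeneous
  vectors only; expanding every slot into its components shows that this determines them.\<close>

lemma tensor_homogeneous_span:
  "tensor vs \<in> fs.span {tensor us |us. length us = length vs \<and> (\<forall>v\<in>set us. homogeneous v)}"
proof -
  have "tensor (us @ vs) \<in> fs.span {tensor us' |us'. length us' = length us + length vs \<and> (\<forall>v\<in>set us'. homogeneous v)}"
    if "\<forall>v\<in>set us. homogeneous v" for us
    using that
  proof (induction vs arbitrary: us)
    case Nil
    then show ?case by (auto intro!: fs.span_base)
  next
    case (Cons v vs)
    have pr: "homogeneous (pr e v)" for e
      using pr_in[of e v] by (cases e) (auto simp: homogeneous_def Vpar_def)
    have "tensor (us @ v # vs) = tensor ((us @ [pr False v]) @ vs) + tensor ((us @ [pr True v]) @ vs)"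
    proof
      fix f
      show "tensor (us @ v # vs) f = (tensor ((us @ [pr False v]) @ vs) + tensor ((us @ [pr True v]) @ vs)) f"
        using ml_add[of f us "pr False v" "pr True v" vs] by (simp add: tensor_def pr_sum fun_arith_apply)
    qed
    then show ?case
      using Cons.IH[of "us @ [pr False v]"] Cons.IH[of "us @ [pr True v]"] Cons.prems pr
      by (auto intro!: fs.span_add)
  qed
  from this[of "[]"] show ?thesis by simp
qed

lemma tensor_power_homogeneous_span:
  assumes "t \<in> tensor_power n"
  shows "t \<in> fs.span {tensor us |us. length us = n \<and> (\<forall>v\<in>set us. homogeneous v)}"
  using assms unfolding tensor_power_def
  by (rule fs_span_map[where \<Phi> = "\<lambda>t. t", rotated -1]) (use tensor_homogeneous_span in auto)

definition permf :: "nat \<Rightarrow> (nat \<Rightarrow> nat) \<Rightarrow> ('v list \<Rightarrow> 'k) \<Rightarrow> 'v list \<Rightarrow> 'k" where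
  "permf n \<sigma> f = hx (\<lambda>l. if length l = n then index_act f (map \<sigma> [0..<n]) l else 0)"

definition permT :: "nat \<Rightarrow> (nat \<Rightarrow> nat) \<Rightarrow> (('v list \<Rightarrow> 'k) \<Rightarrow> 'k) \<Rightarrow> ('v list \<Rightarrow> 'k) \<Rightarrow> 'k" where
  "permT n \<sigma> t = (\<lambda>f. if multilinear f then t (permf n \<sigma> f) else 0)"

lemma permT_add: "permT n \<sigma> (s + t) = permT n \<sigma> s + permT n \<sigma> t"
  and permT_scale: "permT n \<sigma> (fscale c t) = fscale c (permT n \<sigma> t)"
  by (auto simp: permT_def fun_eq_iff fun_arith_apply)

lemma permf_ml: "multilinear f \<Longrightarrow> \<sigma> permutes {..<n} \<Longrightarrow> multilinear (permf n \<sigma> f)"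
  unfolding permf_def by (intro hx_ml index_act_lab_ml)

text \<open>The labelled sign is identified with \<open>koszul_sign\<close> here; both count the
  inversions between odd vectors.\<close>

lemma permT_homogeneous:
  assumes p: "\<sigma> permutes {..<n}" and n: "length vs = n" and hom: "\<forall>v\<in>set vs. homogeneous v"
  shows "permT n \<sigma> (tensor vs) = fscale (koszul_sign vs \<sigma>) (tensor (map (\<lambda>i. vs ! \<sigma> i) [0..<n]))"
proof
  fix f
  have lt: "\<sigma> i < n" if "i < n" for i using permutes_in_image[OF p, of i] that by simp
  show "permT n \<sigma> (tensor vs) f = fscale (koszul_sign vs \<sigma>) (tensor (map (\<lambda>i. vs ! \<sigma> i) [0..<n])) f"
  proof (cases "multilinear f")
    case True
    let ?xs = "map \<sigma> [0..<n]"
    let ?o = "(!) (map (\<lambda>v. par v = 1) vs)"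
    have "{(i, j). i < j \<and> j < length vs \<and> \<sigma> i > \<sigma> j \<and> par (vs ! \<sigma> i) = 1 \<and> par (vs ! \<sigma> j) = 1} =
      {(i, j). i < j \<and> j < length ?xs \<and> ?xs ! i > ?xs ! j \<and> ?o (?xs ! i) \<and> ?o (?xs ! j)}"
      using lt n by (auto simp: nth_append)
    then have "koszul_sign vs \<sigma> = list_sign ?o ?xs"
      unfolding koszul_sign_def by (simp only: list_sign_card)
    moreover have "permf n \<sigma> f vs = index_act f ?xs (map (\<lambda>v. (par v = 1, v)) vs)"
      unfolding permf_def using n by (subst hx_homogeneous[OF index_act_lab_ml[OF True p] hom]) simp
    ultimately show ?thesis
      using True permf_ml[OF True p] by (simp add: permT_def tensor_def index_act_def Fun.comp_def fscale_apply del: upt_Suc)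
  qed (simp add: permT_def tensor_def fscale_apply)
qed

lemma perm_action_eq:
  assumes p: "\<sigma> permutes {..<n}" and t: "t \<in> tensor_power n"
  shows "perm_action n \<sigma> t = permT n \<sigma> t"
  unfolding perm_action_def
proof (rule lin_ext_eq)
  show "t \<in> fs.span (fst ` {(tensor vs, fscale (koszul_sign vs \<sigma>) (tensor (map (\<lambda>i. vs ! \<sigma> i) [0..<n]))) |vs.
        length vs = n \<and> (\<forall>v\<in>set vs. homogeneous v)})"
    by (rule set_mp[OF fs.span_mono tensor_power_homogeneous_span[OF t]]) (force simp: image_iff)
next
  fix x y assume "(x, y) \<in> {(tensor vs, fscale (koszul_sign vs \<sigma>) (tensor (map (\<lambda>i. vs ! \<sigma> i) [0..<n]))) |vs.
        length vs = n \<and> (\<forall>v\<in>set vs. homogeneous v)}"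
  then show "y = permT n \<sigma> x"
    using permT_homogeneous[OF p] by clarify metis
qed (simp_all only: permT_add permT_scale)

lemma permT_tensor_power:
  assumes p: "\<sigma> permutes {..<n}" and t: "t \<in> tensor_power n"
  shows "permT n \<sigma> t \<in> tensor_power n"
  unfolding tensor_power_def
proof (rule fs_span_map[where \<Phi> = "permT n \<sigma>", OF permT_add permT_scale _ tensor_power_homogeneous_span[OF t]])
  fix a :: "('v list \<Rightarrow> 'k) \<Rightarrow> 'k" assume "a \<in> {tensor us |us. length us = n \<and> (\<forall>v\<in>set us. homogeneous v)}"
  then obtain us where us: "a = tensor us" "length us = n" "\<forall>v\<in>set us. homogeneous v" by blast
  show "permT n \<sigma> a \<in> fs.span {tensor vs |vs. length vs = n}"
    unfolding us(1) permT_homogeneous[OF p us(2,3)] by (intro fs.span_scale fs.span_base) auto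
qed

text \<open>One formula for all degrees, as \<open>Symf\<close> treats the words of each length
  separately.\<close>

definition symT :: "(('v list \<Rightarrow> 'k) \<Rightarrow> 'k) \<Rightarrow> ('v list \<Rightarrow> 'k) \<Rightarrow> 'k" where
  "symT t = (\<lambda>f. if multilinear f then t (Symf f) else 0)"

lemma symT_add: "symT (s + t) = symT s + symT t"
  and symT_scale: "symT (fscale c t) = fscale c (symT t)"
  by (auto simp: symT_def fun_eq_iff fun_arith_apply)

lemma symT_0 [simp]: "symT 0 = 0"
  by (auto simp: symT_def fun_eq_iff fun_arith_apply)

lemma Symf_length:
  assumes "length vs = n"
  shows "Symf f vs = 1 / fact n * (\<Sum>\<sigma> | \<sigma> permutes {..<n}. permf n \<sigma> f vs)"
proof -
  have "Symf f vs = hx (\<lambda>l. 1 / fact n * (\<Sum>\<sigma> | \<sigma> permutes {..<n}. if length l = n then index_act f (map \<sigma> [0..<n]) l else 0)) vs"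
    unfolding Symf_def by (rule hx_cong) (simp add: sym_label_def assms)
  then show ?thesis
    by (simp only: hx_times hx_sum permf_def)
qed

lemma symmetrizer_deg_eq:
  assumes t: "t \<in> tensor_power n"
  shows "symmetrizer_deg n t = symT t"
proof
  fix f
  have "symmetrizer_deg n t f = 1 / fact n * (\<Sum>\<sigma> | \<sigma> permutes {..<n}. permT n \<sigma> t f)"
    unfolding symmetrizer_deg_def by (simp add: fun_arith_apply perm_action_eq[OF _ t])
  also have "\<dots> = symT t f"
  proof (cases "multilinear f")
    case True
    note T = tensor_power_T[OF t]
    have m: "multilinear (permf n \<sigma> f)" if "\<sigma> \<in> {\<sigma>. \<sigma> permutes {..<n}}" for \<sigma>
      using that permf_ml[OF True] by simp
    have "t (Symf f) = t (\<lambda>vs. 1 / fact n * (\<Sum>\<sigma> | \<sigma> permutes {..<n}. permf n \<sigma> f vs))"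
      by (rule tensor_power_cong[OF t Symf_ml[OF True] ml_times[OF ml_sum[OF m]]]) (auto simp: Symf_length)
    also have "\<dots> = 1 / fact n * t (\<lambda>vs. \<Sum>\<sigma> | \<sigma> permutes {..<n}. permf n \<sigma> f vs)"
      by (rule T_form_times[OF T ml_sum[OF m]])
    also have "\<dots> = 1 / fact n * (\<Sum>\<sigma> | \<sigma> permutes {..<n}. t (permf n \<sigma> f))"
      by (subst T_form_sum[OF T m], assumption, rule refl)
    finally show ?thesis using True by (simp add: symT_def permT_def)
  qed (simp add: symT_def permT_def)
  finally show "symmetrizer_deg n t f = symT t f" .
qed

lemma symT_tensor_power:
  assumes t: "t \<in> tensor_power n"
  shows "symT t \<in> tensor_power n"
proof -
  have "(\<Sum>\<sigma> | \<sigma> permutes {..<n}. permT n \<sigma> t) \<in> tensor_power n"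
    unfolding tensor_power_def
    by (rule fs.span_sum) (use permT_tensor_power[OF _ t] in \<open>simp add: tensor_power_def\<close>)
  moreover have "(\<Sum>\<sigma> | \<sigma> permutes {..<n}. permT n \<sigma> t) = (\<Sum>\<sigma> | \<sigma> permutes {..<n}. perm_action n \<sigma> t)"
    by (rule sum.cong) (simp_all add: perm_action_eq[OF _ t])
  ultimately show ?thesis
    unfolding symmetrizer_deg_eq[OF t, symmetric] symmetrizer_deg_def tensor_power_def
    by (auto intro: fs.span_scale)
qed

lemma symmetrizer_eq:
  assumes t: "t \<in> tensor_algebra"
  shows "symmetrizer t = symT t"
proof -
  obtain N where N: "\<And>M. M \<ge> N \<Longrightarrow> comp M t = 0" "t = (\<Sum>n<N. comp n t)"
    using T_decomp[OF t] by blast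
  have "symmetrizer t = (\<Sum>n | comp n t \<noteq> 0. symT (comp n t))"
    unfolding symmetrizer_def component_eq[OF t]
    by (rule sum.cong) (simp_all add: symmetrizer_deg_eq[OF comp_tensor_power[OF t]])
  also have "\<dots> = (\<Sum>n<N. symT (comp n t))"
  proof (rule sum.mono_neutral_left)
    show "{n. comp n t \<noteq> 0} \<subseteq> {..<N}" using N(1) by (metis (mono_tags) lessThan_iff mem_Collect_eq not_le subsetI)
  qed auto
  also have "\<dots> = symT (\<Sum>n<N. comp n t)"
  proof -
    have "symT (\<Sum>n\<in>A. F n) = (\<Sum>n\<in>A. symT (F n))" for A :: "nat set" and F
      by (induction A rule: infinite_finite_induct) (auto simp: symT_add)
    then show ?thesis by simp
  qed
  finally show ?thesis using N(2) by simp
qed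

lemma symT_T: "t \<in> tensor_algebra \<Longrightarrow> symT t \<in> tensor_algebra"
  unfolding tensor_algebra_def
proof (rule fs_span_map[where \<Phi> = symT, OF symT_add symT_scale])
  fix a :: "('v list \<Rightarrow> 'k) \<Rightarrow> 'k" assume "a \<in> range tensor"
  then obtain vs where a: "a = tensor vs" by auto
  have "tensor vs \<in> tensor_power (length vs)"
    unfolding tensor_power_def by (auto intro: fs.span_base)
  from tensor_power_T[OF symT_tensor_power[OF this]]
  show "symT a \<in> fs.span (range tensor)" by (simp add: a tensor_algebra_def)
qed

text \<open>The product of the vectors in the symmetric algebra, see \<open>sym_prod_eq\<close>.
  These elements span the symmetric algebra and depend on \<open>vs\<close> in a graded symmetric
  way.\<close>

definition E :: "'v list \<Rightarrow> ('v list \<Rightarrow> 'k) \<Rightarrow> 'k" where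
  "E vs = symT (tensor vs)"

lemma E_T [simp]: "E vs \<in> tensor_algebra"
  by (simp add: E_def symT_T)

lemma E_apply: "E vs f = (if multilinear f then Symf f vs else 0)"
  by (simp add: E_def symT_def tensor_def Symf_ml)

text \<open>A graded symmetric form does not notice symmetrization, so at such forms
  \<open>E vs\<close> acts like the bare word \<open>vs\<close>.\<close>

lemma E_gs_apply: "graded_symmetric f \<Longrightarrow> E vs f = f vs"
  by (simp add: E_apply gs_ml Symf_id)

lemma E_gs: "graded_symmetric (\<lambda>vs. E vs f)"
  by (cases "multilinear f") (auto simp: E_apply gs_zero Symf_gs)

lemma sym_algebra_eq: "sym_algebra = fs.span (range E)"
proof (rule antisym)
  have "sym_power n \<subseteq> fs.span (range E)" for n
  proof
    fix s assume "s \<in> sym_power n"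
    then obtain t where t: "t \<in> tensor_power n" "s = symT t"
      by (auto simp: sym_power_def symmetrizer_deg_eq)
    show "s \<in> fs.span (range E)"
      unfolding t(2)
      by (rule fs_span_map[where \<Phi> = symT, OF symT_add symT_scale _ t(1)[unfolded tensor_power_def]])
        (auto simp: E_def[symmetric] intro: fs.span_base)
  qed
  then show "sym_algebra \<subseteq> fs.span (range E)"
    unfolding sym_algebra_def by (intro fs.span_minimal fs.subspace_span) blast
  have "E vs \<in> sym_power (length vs)" for vs
  proof -
    have "tensor vs \<in> tensor_power (length vs)"
      unfolding tensor_power_def by (auto intro: fs.span_base)
    then show ?thesis by (auto simp: sym_power_def E_def symmetrizer_deg_eq)
  qed
  then show "fs.span (range E) \<subseteq> sym_algebra"
    unfolding sym_algebra_def by (intro fs.span_mono) blast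
qed

lemma S_E [simp]: "E vs \<in> sym_algebra"
  by (simp add: sym_algebra_eq fs.span_base)

lemma S_add [simp]: "a \<in> sym_algebra \<Longrightarrow> b \<in> sym_algebra \<Longrightarrow> a + b \<in> sym_algebra"
  unfolding sym_algebra_def by (rule fs.span_add)

lemma S_diff [simp]: "a \<in> sym_algebra \<Longrightarrow> b \<in> sym_algebra \<Longrightarrow> a - b \<in> sym_algebra"
  unfolding sym_algebra_def by (rule fs.span_diff)

lemma S_scale [simp]: "a \<in> sym_algebra \<Longrightarrow> fscale c a \<in> sym_algebra"
  unfolding sym_algebra_def by (rule fs.span_scale)

lemma S_0 [simp]: "0 \<in> sym_algebra"
  unfolding sym_algebra_def by (rule fs.span_zero)

lemma S_sum [simp]: "(\<And>i. i \<in> A \<Longrightarrow> F i \<in> sym_algebra) \<Longrightarrow> (\<Sum>i\<in>A. F i) \<in> sym_algebra"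
  unfolding sym_algebra_def by (rule fs.span_sum)

lemma S_induct [consumes 1, case_names zero step]:
  assumes "t \<in> sym_algebra" "P 0"
    and "\<And>c vs s. s \<in> sym_algebra \<Longrightarrow> P s \<Longrightarrow> P (fscale c (E vs) + s)"
  shows "P t"
proof -
  have "t \<in> sym_algebra \<and> P t"
    using assms(1)[unfolded sym_algebra_eq]
  proof (induction rule: fs.span_induct_alt)
    case base
    then show ?case by (simp add: assms(2))
  next
    case (step c x y)
    then show ?case using assms(3) by auto
  qed
  then show ?thesis by simp
qed

lemma S_T: "t \<in> sym_algebra \<Longrightarrow> t \<in> tensor_algebra"
  by (induction rule: S_induct) auto

lemma symT_S: "t \<in> tensor_algebra \<Longrightarrow> symT t \<in> sym_algebra"
  by (induction rule: T_induct) (auto simp: symT_add symT_scale E_def[symmetric])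

lemma symT_id: "t \<in> sym_algebra \<Longrightarrow> symT t = t"
proof (induction rule: S_induct)
  case (step c vs s)
  have "symT (E vs) = E vs"
    by (rule ext) (simp add: symT_def E_apply Symf_ml Symf_id[OF Symf_gs])
  then show ?case using step by (simp add: symT_add symT_scale)
qed simp

text \<open>Elements of the symmetric algebra are fixed by \<open>symT\<close>, hence their value at
  a multilinear \<open>f\<close> is their value at the symmetrized form.\<close>

lemma S_eqI:
  assumes "s \<in> sym_algebra" "t \<in> sym_algebra" "\<And>f. graded_symmetric f \<Longrightarrow> s f = t f"
  shows "s = t"
proof
  fix f
  have "symT s f = symT t f" using assms(3)[OF Symf_gs] by (simp add: symT_def)
  then show "s f = t f" using assms by (simp add: symT_id)
qed

subsection \<open>Symmetric products\<close>

lemma bilin_tensor_pair_add: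
  assumes "a \<in> tensor_algebra" "b \<in> tensor_algebra" "c \<in> tensor_algebra"
  shows "tensor_pair (fscale r a + b) c = fscale r (tensor_pair a c) + tensor_pair b c"
    "tensor_pair c (fscale r a + b) = fscale r (tensor_pair c a) + tensor_pair c b"
  using assms by (auto simp: fun_eq_iff tensor_pair_eq bilin_def fun_arith_apply)

lemma tensor_pair_0:
  assumes "c \<in> tensor_algebra"
  shows "tensor_pair 0 c = 0" "tensor_pair c 0 = 0"
  using bilin_tensor_pair_add[of 0 0 c "-1"] assms by (auto simp: fun_eq_iff fun_arith_apply)

definition TT where "TT = fs.span {tensor_pair (tensor vs) (tensor ws) |vs ws. True}"

lemma tensor_pair_TT:
  assumes "s \<in> tensor_algebra" "t \<in> tensor_algebra"
  shows "tensor_pair s t \<in> TT"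
proof -
  have "tensor_pair (tensor vs) t \<in> TT" for vs
    using assms(2)
  proof (induction rule: T_induct)
    case zero
    show ?case by (simp add: tensor_pair_0 TT_def fs.span_zero)
  next
    case (step c ws s)
    then show ?case by (auto simp: bilin_tensor_pair_add TT_def intro!: fs.span_add fs.span_scale intro: fs.span_base)
  qed
  note tensor_case = this
  show ?thesis using assms(1)
  proof (induction rule: T_induct)
    case zero
    show ?case using assms by (simp add: tensor_pair_0 TT_def fs.span_zero)
  next
    case (step c ws s)
    then show ?case using assms tensor_case by (auto simp: bilin_tensor_pair_add TT_def intro!: fs.span_add fs.span_scale)
  qed
qed

definition concT where
  "concT u = (\<lambda>f. if multilinear f then u (pairing (\<lambda>vs ws. f (vs @ ws))) else (0 :: 'k))"

lemma append_bi_ml: "multilinear f \<Longrightarrow> bi_ml (\<lambda>vs ws. f (vs @ ws))"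
  by (simp add: bi_ml_def ml_append_left ml_append_right)

lemma concT_tensor: "concT (tensor_pair (tensor vs) (tensor ws)) = tensor (vs @ ws)"
proof
  fix f
  show "concT (tensor_pair (tensor vs) (tensor ws)) f = tensor (vs @ ws) f"
    by (cases "multilinear f")
      (simp_all add: concT_def tensor_pair_eq pairing_bilin[OF append_bi_ml] pairing_tensor[OF append_bi_ml], simp_all add: tensor_def)
qed

lemma concT_add: "concT (u + v) = concT u + concT v"
  and concT_scale: "concT (fscale c u) = fscale c (concT u)"
  by (auto simp: concT_def fun_eq_iff fun_arith_apply)

lemma concatenation_eq: "u \<in> TT \<Longrightarrow> concatenation u = concT u"
  unfolding concatenation_def TT_def
  by (rule lin_ext_eq[where \<Phi> = concT, OF concT_add concT_scale])
    (auto simp: concT_tensor elim!: set_mp[OF fs.span_mono, rotated] intro!: rev_image_eqI)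

lemma concT_T: "u \<in> TT \<Longrightarrow> concT u \<in> tensor_algebra"
  unfolding TT_def tensor_algebra_def
  by (rule fs_span_map[where \<Phi> = concT, OF concT_add concT_scale]) (auto simp: concT_tensor intro: fs.span_base)

lemma mu_eq: "u \<in> TT \<Longrightarrow> mu u = symT (concT u)"
  by (simp add: mu_def concatenation_eq symmetrizer_eq concT_T)

lemma mu_S: "u \<in> TT \<Longrightarrow> mu u \<in> sym_algebra"
  by (simp add: mu_eq symT_S concT_T)

lemma sym_mult_apply:
  assumes "s \<in> tensor_algebra" "t \<in> tensor_algebra"
  shows "sym_mult s t f = (if multilinear f then s (\<lambda>vs. t (\<lambda>ws. Symf f (vs @ ws))) else 0)"
  by (simp add: sym_mult_def mu_eq tensor_pair_TT[OF assms] symT_def concT_def Symf_ml tensor_pair_eq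
      pairing_bilin[OF append_bi_ml]) (simp add: pairing_def)

lemma sym_mult_S: "s \<in> tensor_algebra \<Longrightarrow> t \<in> tensor_algebra \<Longrightarrow> sym_mult s t \<in> sym_algebra"
  by (simp add: sym_mult_def mu_S tensor_pair_TT)

lemma tensor_sym_mult_E: "sym_mult (tensor us) (E vs) = E (us @ vs)"
proof
  fix f
  show "sym_mult (tensor us) (E vs) f = E (us @ vs) f"
  proof (cases "multilinear f")
    case True
    note gs = Symf_gs[OF True]
    show ?thesis
      using gs_ml[OF gs_append_right[OF gs]]
      by (simp add: sym_mult_apply True E_gs_apply[OF gs_append_left[OF gs]]) (simp add: tensor_def E_apply True)
  qed (simp add: sym_mult_apply E_apply)
qed

lemma E_sym_mult_E: "sym_mult (E us) (E vs) = E (us @ vs)"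
proof
  fix f
  show "sym_mult (E us) (E vs) f = E (us @ vs) f"
  proof (cases "multilinear f")
    case True
    note gs = Symf_gs[OF True]
    show ?thesis
      by (simp add: sym_mult_apply True E_gs_apply[OF gs_append_left[OF gs]] E_gs_apply[OF gs_append_right[OF gs]])
        (simp add: E_apply True)
  qed (simp add: sym_mult_apply E_apply)
qed

text \<open>In a word of length at most 1 there are no neighbours to exchange, so \<open>f\<close>
  restricted to that length is graded symmetric.\<close>

lemma E_short:
  assumes "length vs \<le> 1"
  shows "E vs = tensor vs"
proof
  fix f
  show "E vs f = tensor vs f"
  proof (cases "multilinear f")
    case True
    let ?n = "length vs"
    have "graded_symmetric (restr ?n f)"
      by (rule graded_symmetricI[OF restr_ml[OF True]]) (use assms in \<open>simp add: restr_def\<close>)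
    then have "Symf (restr ?n f) vs = f vs" by (simp add: Symf_id restr_def)
    moreover have "Symf (restr ?n f) vs = Symf f vs"
      by (simp add: Symf_length[of _ ?n] permf_def)
        (intro arg_cong2[where f = "(/)"] sum.cong hx_cong refl, simp add: index_act_def restr_def)
    ultimately show ?thesis using True by (simp add: E_apply tensor_def)
  qed (simp add: E_apply tensor_def)
qed

lemma unit_eq: "unit = E []"
  by (simp add: unit_def E_short)

lemma incl_eq: "incl v = E [v]"
  by (simp add: incl_def E_short)

lemma sym_prod_eq: "sym_prod vs = E vs"
proof (induction vs)
  case Nil
  then show ?case by (simp add: sym_prod_def unit_eq)
next
  case (Cons v vs)
  then show ?case using tensor_sym_mult_E[of "[v]" vs] by (simp add: sym_prod_def incl_def)
qed

end

section \<open>Contractions of homogeneous words in closed form\<close>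

context graded_lcs_form
begin

lemma gr_par: "homogeneous w \<Longrightarrow> gr True w = scale ((- 1) ^ par w) w"
  using gr_homogeneous[of w False True] gr_homogeneous[of w True True]
  by (auto simp: homogeneous_def par_def Vpar_def)

lemma ml_map_gr_homogeneous:
  assumes "multilinear f" "\<forall>v\<in>set vs. homogeneous v"
  shows "f (map (gr True) vs) = (- 1) ^ (\<Sum>i<length vs. par (vs ! i)) * f vs"
  using assms
proof (induction vs arbitrary: f)
  case (Cons v vs)
  have "f (map (gr True) (v # vs)) = (- 1) ^ par v * f (v # map (gr True) vs)"
    using Cons.prems lin_form_scale[OF ml_Cons_lin[OF Cons.prems(1)]] by (simp add: gr_par)
  also have "f (v # map (gr True) vs) = (- 1) ^ (\<Sum>i<length vs. par (vs ! i)) * f (v # vs)"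
    using Cons.prems by (intro Cons.IH[OF ml_Cons]) auto
  finally show ?case by (simp add: sum.lessThan_Suc_shift power_add del: sum.lessThan_Suc)
qed simp

lemma contr_homogeneous:
  assumes "multilinear f" "\<forall>w\<in>set ws. homogeneous w"
  shows "contr e l f ws = (\<Sum>j<length ws. (if e then (- 1) ^ (\<Sum>i<j. par (ws ! i)) else 1) * l (ws ! j) * f (omit j ws))"
  using assms
proof (induction ws arbitrary: f)
  case (Cons w ws)
  let ?s = "if e then (- 1) ^ par w else 1 :: 'k"
  have gr: "f (gr e w # us) = ?s * f (w # us)" for us
    using Cons.prems lin_form_scale[OF ml_Cons_lin[OF Cons.prems(1)]] by (cases e) (simp_all add: gr_par)
  have "contr e l f (w # ws) = l w * f ws + ?s * contr e l (\<lambda>us. f (w # us)) ws"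
    by (simp only: contr.simps gr contr_times)
  also have "contr e l (\<lambda>us. f (w # us)) ws =
     (\<Sum>j<length ws. (if e then (- 1) ^ (\<Sum>i<j. par (ws ! i)) else 1) * l (ws ! j) * f (w # omit j ws))"
    using Cons.prems by (intro Cons.IH[OF ml_Cons]) auto
  finally show ?case
    by (simp add: sum.lessThan_Suc_shift power_add omit_def sum_distrib_left mult.assoc del: sum.lessThan_Suc cong: sum.cong)
qed simp

lemma Pc_homogeneous:
  assumes "bi_ml g" "\<forall>v\<in>set vs. homogeneous v" "\<forall>w\<in>set ws. homogeneous w"
  shows "Pc g vs ws = (\<Sum>k<length vs. \<Sum>l<length ws.
     (- 1) ^ (par (vs ! k) * (\<Sum>i\<in>{k<..<length vs}. par (vs ! i)) + par (ws ! l) * (\<Sum>i<l. par (ws ! i)))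
       * \<Lambda> (vs ! k) (ws ! l) * g (omit k vs) (omit l ws))"
  using assms
proof (induction vs arbitrary: g)
  case (Cons v vs)
  have ml: "multilinear (\<lambda>vs. g vs ws)" "multilinear (g vs)" for vs ws
    using Cons.prems(1) by (auto simp: bi_ml_def)
  have hv: "homogeneous v" and hvs: "\<forall>v\<in>set vs. homogeneous v" using Cons.prems by auto
  have S0: "(\<Sum>i\<in>{0<..<Suc n}. F i) = (\<Sum>i<n. F (Suc i))" for n and F :: "nat \<Rightarrow> nat"
  proof -
    have "{0<..<Suc n} = Suc ` {..<n}" by (auto simp: image_iff) (metis Suc_less_eq gr0_conv_Suc lessThan_iff)
    then show ?thesis by (simp add: sum.reindex)
  qed
  have S1: "(\<Sum>i\<in>{Suc k<..<Suc n}. F i) = (\<Sum>i\<in>{k<..<n}. F (Suc i))" for n k and F :: "nat \<Rightarrow> nat"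
  proof -
    have "{Suc k<..<Suc n} = Suc ` {k<..<n}"
      by (auto simp: image_iff) (metis Suc_less_eq Suc_lessE greaterThanLessThan_iff)
    then show ?thesis by (simp add: sum.reindex)
  qed
  \<comment> \<open>Two even vectors leave only \<open>e = False\<close>, with no sign on either
    side; two odd ones leave only \<open>e = True\<close>, with both signs. For mixed parities
    everything vanishes by evenness of \<Lambda>.\<close>
  have trm: "(\<Sum>e\<in>UNIV. (if e then (- 1) ^ (\<Sum>i<l. par (ws ! i)) else 1) * Lam e v (ws ! l) * g (map (gr e) vs) (omit l ws)) =
      (- 1) ^ (par v * (\<Sum>i<length vs. par (vs ! i)) + par (ws ! l) * (\<Sum>i<l. par (ws ! i))) * \<Lambda> v (ws ! l) * g vs (omit l ws)"
    if l: "l < length ws" for l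
  proof -
    let ?w = "ws ! l"
    have hw: "homogeneous ?w" using Cons.prems l by simp
    have G: "g (map (gr True) vs) (omit l ws) = (- 1) ^ (\<Sum>i<length vs. par (vs ! i)) * g vs (omit l ws)"
      by (rule ml_map_gr_homogeneous[OF ml(1) hvs])
    consider "v \<in> V0" "?w \<in> V0" | "v \<in> V0" "?w \<notin> V0" "?w \<in> V1" | "v \<notin> V0" "v \<in> V1" "?w \<in> V0"
      | "v \<notin> V0" "v \<in> V1" "?w \<notin> V0" "?w \<in> V1"
      using hv hw by (auto simp: homogeneous_def)
    then show ?thesis
    proof cases
      case 1
      then have "Lam True v ?w = 0" "par v = 0" "par ?w = 0"
        using Lam_pr[of True False v] by (auto simp: par_def pr_same Vpar_def)
      then show ?thesis using Lam_sum[of v ?w] by (simp add: UNIV_bool_sum)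
    next
      case 2
      then have "\<Lambda> v ?w = 0" using Lambda_even by (simp add: even_bilinear_form_def)
      moreover have "Lam True v ?w = 0"
        using 2 Lam_pr[of True False v] by (auto simp: pr_same Vpar_def)
      ultimately show ?thesis using Lam_sum[of v ?w] by (simp add: UNIV_bool_sum)
    next
      case 3
      then have "\<Lambda> v ?w = 0" using Lambda_even by (simp add: even_bilinear_form_def)
      moreover have "Lam False v ?w = 0"
        using 3 Lam_pr[of False True v] by (auto simp: pr_same Vpar_def)
      ultimately show ?thesis using Lam_sum[of v ?w] by (simp add: UNIV_bool_sum)
    next
      case 4
      then have "Lam False v ?w = 0" "par v = 1" "par ?w = 1"
        using Lam_pr[of False True v] by (auto simp: par_def pr_same Vpar_def)
      then show ?thesis using Lam_sum[of v ?w] by (simp add: UNIV_bool_sum G power_add)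
    qed
  qed
  have "Lam_right v g vs ws =
     (\<Sum>e\<in>UNIV. \<Sum>l<length ws. (if e then (- 1) ^ (\<Sum>i<l. par (ws ! i)) else 1) * Lam e v (ws ! l) * g (map (gr e) vs) (omit l ws))"
    unfolding Lam_right_def contr_right_def by (simp only: contr_homogeneous[OF ml(2) Cons.prems(3)])
  also have "\<dots> = (\<Sum>l<length ws. \<Sum>e\<in>UNIV. (if e then (- 1) ^ (\<Sum>i<l. par (ws ! i)) else 1) * Lam e v (ws ! l) * g (map (gr e) vs) (omit l ws))"
    by (rule sum.swap)
  also have "\<dots> = (\<Sum>l<length ws. (- 1) ^ (par v * (\<Sum>i<length vs. par (vs ! i)) + par (ws ! l) * (\<Sum>i<l. par (ws ! i))) * \<Lambda> v (ws ! l) * g vs (omit l ws))"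
    by (rule sum.cong[OF refl], rule trm) simp
  finally have L: "Lam_right v g vs ws = \<dots>" .
  have "bi_ml (\<lambda>us. g (v # us))"
    using Cons.prems(1) ml_Cons[OF ml(1)] by (simp add: bi_ml_def)
  note IH = Cons.IH[OF this hvs Cons.prems(3)]
  have o: "omit 0 (v # vs) = vs" "omit (Suc k) (v # vs) = v # omit k vs" for k
    by (simp_all add: omit_def)
  show ?case
    unfolding Pc.simps IH L list.size add_0_right add_Suc_right sum.lessThan_Suc_shift nth_Cons_0 nth_Cons_Suc o S0 S1
    by (rule add.commute)
qed simp

subsection \<open>The Poisson operator on the symmetric algebra\<close>

lemma E_slot:
  shows "E (us @ (u + v) # ws) = E (us @ u # ws) + E (us @ v # ws)"
    "E (us @ scale c u # ws) = fscale c (E (us @ u # ws))"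
    "E (us @ x # y # ws) = E (us @ y # x # ws) + fscale (-2) (E (us @ pr True y # pr True x # ws))"
proof -
  show "E (us @ (u + v) # ws) = E (us @ u # ws) + E (us @ v # ws)"
    "E (us @ scale c u # ws) = fscale c (E (us @ u # ws))"
    by (auto simp: fun_eq_iff ml_add[OF gs_ml[OF E_gs]] ml_scale[OF gs_ml[OF E_gs]] fun_arith_apply)
  show "E (us @ x # y # ws) = E (us @ y # x # ws) + fscale (-2) (E (us @ pr True y # pr True x # ws))"
  proof
    fix f
    show "E (us @ x # y # ws) f = (E (us @ y # x # ws) + fscale (-2) (E (us @ pr True y # pr True x # ws))) f"
      by (subst gs_swap[OF E_gs[of f]]) (simp add: fun_arith_apply)
  qed
qed

lemma bilin_E_gs:
  assumes B: "bilin B" and b: "b \<in> tensor_algebra"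
  shows "graded_symmetric (\<lambda>vs. B (E vs) b)" "graded_symmetric (\<lambda>ws. B b (E ws))"
proof -
  have add: "B (x + y) b = B x b + B y b" "B b (x + y) = B b x + B b y"
    and scale: "B (fscale c x) b = c * B x b" "B b (fscale c x) = c * B b x"
    if "x \<in> tensor_algebra" "y \<in> tensor_algebra" for x y c
    using B b that by (auto simp: bilin_def)
  have "multilinear (\<lambda>vs. B (E vs) b)" "multilinear (\<lambda>vs. B b (E vs))"
    by (rule multilinearI; simp add: E_slot(1,2) add scale[OF E_T E_T])+
  moreover have "B (E (us @ x # y # ws)) b = B (E (us @ y # x # ws)) b - 2 * B (E (us @ pr True y # pr True x # ws)) b"
    "B b (E (us @ x # y # ws)) = B b (E (us @ y # x # ws)) - 2 * B b (E (us @ pr True y # pr True x # ws))" for us x y ws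
    unfolding E_slot(3)[of us x y ws] by (simp_all add: add scale[OF E_T E_T] del: fs.scale_minus_left)
  ultimately show "graded_symmetric (\<lambda>vs. B (E vs) b)" "graded_symmetric (\<lambda>ws. B b (E ws))"
    by (intro graded_symmetricI; blast)+
qed

text \<open>A bilinear form on the tensor algebra, seen on products of vectors only. This is a form
  in two words, to which \<open>Pc\<close> applies, and on the symmetric algebra
  \<open>pairing\<close> recovers the bilinear form.\<close>

definition word_form where
  "word_form B vs ws = (B (E vs) (E ws) :: 'k)"

lemma word_form_bi_gs: "bilin B \<Longrightarrow> bi_gs (word_form B)"
  by (simp add: bi_gs_def word_form_def[abs_def] bilin_E_gs)

lemma bi_gs_ml: "bi_gs g \<Longrightarrow> bi_ml g"
  by (simp add: bi_gs_def bi_ml_def gs_ml)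

lemma pairing_E:
  assumes "bi_gs g"
  shows "pairing g (E vs) (E ws) = g vs ws"
proof -
  have "E ws (g us) = g us ws" for us
    using assms by (simp add: bi_gs_def E_gs_apply)
  moreover have "E vs (\<lambda>us. g us ws) = g vs ws"
    using assms by (simp add: bi_gs_def E_gs_apply)
  ultimately show ?thesis by (simp add: pairing_def)
qed

lemma word_form_pairing: "bi_gs g \<Longrightarrow> word_form (pairing g) = g"
  by (simp add: word_form_def fun_eq_iff pairing_E)

definition SS where
  "SS = fs.span {tensor_pair (E vs) (E ws) |vs ws. (\<forall>v\<in>set vs. homogeneous v) \<and> (\<forall>w\<in>set ws. homogeneous w)}"

definition PT where
  "PT u = (\<lambda>B. if bilin B then u (pairing (Pc (word_form B))) else (0 :: 'k))"

lemma PT_add: "PT (u + v) = PT u + PT v"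
  and PT_scale: "PT (fscale c u) = fscale c (PT u)"
  by (auto simp: PT_def fun_eq_iff fun_arith_apply)

definition P_words where
  "P_words vs ws = (\<Sum>k<length vs. \<Sum>l<length ws.
         fscale ((- 1) ^ (par (vs ! k) * (\<Sum>i\<in>{k<..<length vs}. par (vs ! i))
                          + par (ws ! l) * (\<Sum>i<l. par (ws ! i)))
                 * \<Lambda> (vs ! k) (ws ! l))
           (tensor_pair (E (omit k vs)) (E (omit l ws))))"

lemma PT_words:
  assumes "\<forall>v\<in>set vs. homogeneous v" "\<forall>w\<in>set ws. homogeneous w"
  shows "PT (tensor_pair (E vs) (E ws)) = P_words vs ws"
proof
  fix B
  show "PT (tensor_pair (E vs) (E ws)) B = P_words vs ws B"
  proof (cases "bilin B")
    case True
    note gs = word_form_bi_gs[OF True]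
    note P = Pc_bi_gs[OF gs]
    have "PT (tensor_pair (E vs) (E ws)) B = Pc (word_form B) vs ws"
      using True by (simp add: PT_def tensor_pair_eq pairing_bilin[OF bi_gs_ml[OF P]] pairing_E[OF P])
    also have "\<dots> = P_words vs ws B"
      unfolding Pc_homogeneous[OF bi_gs_ml[OF gs] assms] P_words_def
      using True by (simp add: fun_arith_apply tensor_pair_eq word_form_def)
    finally show ?thesis .
  qed (simp add: PT_def P_words_def fun_arith_apply tensor_pair_eq)
qed

lemma set_omit: "set (omit k vs) \<subseteq> set vs"
  by (auto simp: omit_def dest: in_set_takeD in_set_dropD)

lemma P_words_SS:
  assumes "\<forall>v\<in>set vs. homogeneous v" "\<forall>w\<in>set ws. homogeneous w"
  shows "P_words vs ws \<in> SS"
  unfolding P_words_def SS_def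
proof (intro fs.span_sum fs.span_scale fs.span_base)
  fix k l
  show "tensor_pair (E (omit k vs)) (E (omit l ws)) \<in> {tensor_pair (E vs) (E ws) |vs ws.
      (\<forall>v\<in>set vs. homogeneous v) \<and> (\<forall>w\<in>set ws. homogeneous w)}"
    using assms set_omit[of k vs] set_omit[of l ws] by blast
qed

lemma PT_SS: "u \<in> SS \<Longrightarrow> PT u \<in> SS"
  unfolding SS_def
  by (rule fs_span_map[where \<Phi> = PT, OF PT_add PT_scale])
    (use PT_words P_words_SS in \<open>auto simp: SS_def\<close>)

lemma P_Lambda_eq:
  assumes "u \<in> SS"
  shows "P_Lambda \<Lambda> u = PT u"
  unfolding P_Lambda_def sym_prod_eq
proof (rule lin_ext_eq[where \<Phi> = PT, OF PT_add PT_scale])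
  let ?G = "{(tensor_pair (E vs) (E ws), \<Sum>k<length vs. \<Sum>l<length ws.
         fscale ((- 1) ^ (par (vs ! k) * (\<Sum>i\<in>{k<..<length vs}. par (vs ! i))
                          + par (ws ! l) * (\<Sum>i<l. par (ws ! i)))
                 * \<Lambda> (vs ! k) (ws ! l))
           (tensor_pair (E (omit k vs)) (E (omit l ws)))) |vs ws.
        (\<forall>v\<in>set vs. homogeneous v) \<and> (\<forall>w\<in>set ws. homogeneous w)}"
  show "y = PT x" if "(x, y) \<in> ?G" for x y
    using that
  proof clarify
    fix vs ws :: "'v list"
    assume h: "\<forall>v\<in>set vs. homogeneous v" "\<forall>w\<in>set ws. homogeneous w"
    show "(\<Sum>k<length vs. \<Sum>l<length ws.
         fscale ((- 1) ^ (par (vs ! k) * (\<Sum>i\<in>{k<..<length vs}. par (vs ! i))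
                          + par (ws ! l) * (\<Sum>i<l. par (ws ! i)))
                 * \<Lambda> (vs ! k) (ws ! l))
           (tensor_pair (E (omit k vs)) (E (omit l ws)))) = PT (tensor_pair (E vs) (E ws))"
      unfolding PT_words[OF h] P_words_def by (rule refl)
  qed
  show "u \<in> fs.span (fst ` ?G)"
    using assms unfolding SS_def
    by (rule set_mp[OF fs.span_mono, rotated]) (force simp: image_iff)
qed

lemma S_homogeneous_span:
  "a \<in> sym_algebra \<Longrightarrow> a \<in> fs.span {E vs |vs. \<forall>v\<in>set vs. homogeneous v}"
  unfolding sym_algebra_eq
proof (rule fs_span_map[where \<Phi> = "\<lambda>t. t", rotated -1], assumption)
  fix a assume "a \<in> range E"
  then obtain vs where a: "a = symT (tensor vs)" by (auto simp: E_def)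
  show "a \<in> fs.span {E vs |vs. \<forall>v\<in>set vs. homogeneous v}"
    unfolding a
    by (rule fs_span_map[where \<Phi> = symT, OF symT_add symT_scale _ tensor_homogeneous_span])
      (auto simp: E_def intro!: fs.span_base)
qed auto

lemma tensor_pair_SS:
  assumes a: "a \<in> sym_algebra" and b: "b \<in> sym_algebra"
  shows "tensor_pair a b \<in> SS"
proof -
  have 1: "tensor_pair (E vs) b \<in> SS" if vs: "\<forall>v\<in>set vs. homogeneous v" for vs
  proof -
    have "b \<in> tensor_algebra \<and> tensor_pair (E vs) b \<in> SS"
      using S_homogeneous_span[OF b]
    proof (induction rule: fs.span_induct_alt)
      case base
      show ?case by (simp add: tensor_pair_0 SS_def fs.span_zero)
    next
      case (step c x y)
      then obtain ws where x: "x = E ws" "\<forall>w\<in>set ws. homogeneous w" by blast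
      then have "tensor_pair (E vs) (E ws) \<in> SS"
        unfolding SS_def using vs by (intro fs.span_base) blast
      then show ?case using step.IH x
        by (auto simp: bilin_tensor_pair_add SS_def intro!: fs.span_add fs.span_scale)
    qed
    then show ?thesis by simp
  qed
  have "a \<in> tensor_algebra \<and> tensor_pair a b \<in> SS"
    using S_homogeneous_span[OF a]
  proof (induction rule: fs.span_induct_alt)
    case base
    show ?case using S_T[OF b] by (simp add: tensor_pair_0 SS_def fs.span_zero)
  next
    case (step c x y)
    then obtain vs where x: "x = E vs" "\<forall>w\<in>set vs. homogeneous w" by blast
    then show ?case using step.IH 1[OF x(2)] S_T[OF b]
      by (auto simp: bilin_tensor_pair_add SS_def intro!: fs.span_add fs.span_scale)
  qed
  then show ?thesis by simp
qed

lemma SS_TT: "u \<in> SS \<Longrightarrow> u \<in> TT"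
  unfolding SS_def
proof (induction rule: fs.span_induct_alt)
  case base
  show ?case by (simp add: TT_def fs.span_zero)
next
  case (step c x y)
  then obtain vs ws where "x = tensor_pair (E vs) (E ws)" by blast
  then have "x \<in> TT" by (simp add: tensor_pair_TT)
  with step.IH show ?case unfolding TT_def by (intro fs.span_add fs.span_scale)
qed

lemma TT_not_bilin: "u \<in> TT \<Longrightarrow> \<not> bilin B \<Longrightarrow> u B = 0"
  unfolding TT_def
  by (induction rule: fs.span_induct_alt) (auto simp: fun_arith_apply tensor_pair_eq)

lemma pairing_word_form:
  assumes "a \<in> sym_algebra" "b \<in> sym_algebra" and B: "bilin B"
  shows "pairing (word_form B) a b = B a b"
proof -
  have 1: "E vs (\<lambda>us. B (E us) c) = B (E vs) c" "E vs (\<lambda>us. B c (E us)) = B c (E vs)"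
    if "c \<in> tensor_algebra" for vs c
    using bilin_E_gs[OF B that] by (auto simp: E_gs_apply)
  have 2: "b (\<lambda>ws. B (E vs) (E ws)) = B (E vs) b" for vs
    using assms(2)
  proof (induction rule: S_induct)
    case zero
    have "B (E vs) 0 = 0" using B[unfolded bilin_def, THEN conjunct2, rule_format, of "E vs" 0 0] by simp
    then show ?case by (metis zero_fun_apply)
  next
    case (step c us s)
    have "B (E vs) (fscale c (E us) + s) = c * B (E vs) (E us) + B (E vs) s"
      using B S_T[OF step.hyps] by (simp add: bilin_def)
    moreover have "(fscale c (E us) + s) h = c * E us h + s h" for h by (simp add: fun_arith_apply)
    ultimately show ?case using 1[OF E_T] step.IH by metis
  qed
  have "a (\<lambda>vs. B (E vs) b) = B a b"
    using assms(1)
  proof (induction rule: S_induct)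
    case zero
    have "B 0 b = 0" using B[unfolded bilin_def, THEN conjunct2, rule_format, of 0 b 0] S_T[OF assms(2)] by simp
    then show ?case by (metis zero_fun_apply)
  next
    case (step c us s)
    have "B (fscale c (E us) + s) b = c * B (E us) b + B s b"
      using B S_T[OF step.hyps] S_T[OF assms(2)] by (simp add: bilin_def)
    moreover have "(fscale c (E us) + s) h = c * E us h + s h" for h by (simp add: fun_arith_apply)
    ultimately show ?case using 1[OF S_T[OF assms(2)]] step.IH by metis
  qed
  then show ?thesis by (simp add: pairing_def word_form_def[abs_def] 2)
qed

lemma P_pow_SS:
  assumes "a \<in> sym_algebra" "b \<in> sym_algebra"
  shows "(P_Lambda \<Lambda> ^^ k) (tensor_pair a b) \<in> SS"
  by (induction k) (simp_all add: tensor_pair_SS assms P_Lambda_eq PT_SS)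

text \<open>Transposition reverses the order of composition: the outermost \<open>P_Lambda\<close>
  becomes the first \<open>Pc\<close> that is applied to the form. For this reason the induction
  lets \<open>B\<close> vary.\<close>

lemma P_pow_apply:
  assumes "a \<in> sym_algebra" "b \<in> sym_algebra" and B: "bilin B"
  shows "(P_Lambda \<Lambda> ^^ k) (tensor_pair a b) B = pairing ((Pc ^^ k) (word_form B)) a b"
  using B
proof (induction k arbitrary: B)
  case 0
  then show ?case using assms by (simp add: pairing_word_form tensor_pair_eq)
next
  case (Suc k)
  note P = Pc_bi_gs[OF word_form_bi_gs[OF Suc.prems]]
  have "(P_Lambda \<Lambda> ^^ Suc k) (tensor_pair a b) B = PT ((P_Lambda \<Lambda> ^^ k) (tensor_pair a b)) B"
    using P_pow_SS[OF assms(1,2)] by (simp add: P_Lambda_eq)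
  also have "\<dots> = (P_Lambda \<Lambda> ^^ k) (tensor_pair a b) (pairing (Pc (word_form B)))"
    using Suc.prems by (simp add: PT_def)
  also have "\<dots> = pairing ((Pc ^^ k) (word_form (pairing (Pc (word_form B))))) a b"
    by (rule Suc.IH[OF pairing_bilin[OF bi_gs_ml[OF P]]])
  also have "\<dots> = pairing ((Pc ^^ Suc k) (word_form B)) a b"
    by (simp add: word_form_pairing[OF P] funpow_swap1)
  finally show ?case .
qed

lemma P_pow:
  assumes "a \<in> sym_algebra" "b \<in> sym_algebra"
  shows "(P_Lambda \<Lambda> ^^ k) (tensor_pair a b) \<in> SS \<and>
    (\<forall>B. bilin B \<longrightarrow> (P_Lambda \<Lambda> ^^ k) (tensor_pair a b) B = pairing ((Pc ^^ k) (word_form B)) a b)"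
  using P_pow_SS[OF assms] P_pow_apply[OF assms] by blast

subsection \<open>The star product in terms of forms\<close>

lemma E_form_SF: "graded_symmetric f \<Longrightarrow> SF (\<lambda>u. E u f) = SF f"
  by (simp add: E_gs_apply)

lemma SF_inner_ml:
  assumes "b \<in> tensor_algebra" "graded_symmetric f"
  shows "multilinear (\<lambda>vs. b (SF f vs))"
  by (rule pairing_inner_ml[OF bi_gs_ml[OF SF_bi_gs[OF assms(2)]] assms(1)])

lemma mu_0: "mu 0 = 0"
proof -
  have "(0::_ \<Rightarrow> 'k) \<in> TT" by (simp add: TT_def fs.span_zero)
  then show ?thesis by (simp add: mu_eq) (auto simp: fun_eq_iff symT_def concT_def fun_arith_apply)
qed

text \<open>A bound \<open>N\<close> on the degrees in \<open>a\<close> cuts off both the sum in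
  \<open>star\<close>, over the nonvanishing powers, and the sum in \<open>SF\<close>, whose range
  depends on the word. Writing \<open>E u f\<close> for \<open>f\<close> symmetrizes the form and
  also covers functions that are not multilinear, where both sides are 0.\<close>

lemma star_apply:
  assumes a: "a \<in> sym_algebra" and b: "b \<in> sym_algebra"
  shows "star \<Lambda> z a b f = a (\<lambda>vs. b (SF (\<lambda>u. E u f) vs))"
proof -
  note aT = S_T[OF a] and bT = S_T[OF b]
  let ?P = "\<lambda>k. (P_Lambda \<Lambda> ^^ k) (tensor_pair a b)"
  obtain N where N: "\<And>h. multilinear h \<Longrightarrow> (\<forall>vs. length vs < N \<longrightarrow> h vs = 0) \<Longrightarrow> a h = 0"
    using T_bound[OF aT] by blast
  have P0: "?P k = 0" if "k \<ge> N" for k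
  proof
    fix B
    show "?P k B = 0 B"
    proof (cases "bilin B")
      case True
      let ?g = "(Pc ^^ k) (word_form B)"
      have gs: "bi_gs ?g" by (rule Pc_pow_bi_gs[OF word_form_bi_gs[OF True]])
      have "b (?g vs) = 0" if "length vs < N" for vs
      proof -
        have "?g vs = (\<lambda>ws. 0)" using that \<open>k \<ge> N\<close> by (auto simp: fun_eq_iff Pc_pow_zero)
        then show ?thesis using T_form_zero[OF bT] by simp
      qed
      then have "pairing ?g a b = 0"
        unfolding pairing_def using pairing_inner_ml[OF bi_gs_ml[OF gs] bT] by (intro N) auto
      then show ?thesis using P_pow[OF a b] True by (simp add: zero_fun_apply)
    qed (use P_pow[OF a b] TT_not_bilin[OF SS_TT] in \<open>auto simp: zero_fun_apply\<close>)
  qed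
  have "star \<Lambda> z a b = (\<Sum>k<N. fscale (z ^ k / fact k) (mu (?P k)))"
    unfolding star_def
  proof (rule sum.mono_neutral_left)
    show "{k. ?P k \<noteq> 0} \<subseteq> {..<N}" using P0 by (force simp: not_le[symmetric])
  qed (auto simp: mu_0)
  then have S: "star \<Lambda> z a b f = (\<Sum>k<N. z ^ k / fact k * mu (?P k) f)"
    by (simp add: fun_arith_apply)
  have mu: "mu (?P k) = symT (concT (?P k))" for k
    using P_pow[OF a b] SS_TT by (simp add: mu_eq)
  show ?thesis
  proof (cases "multilinear f")
    case True
    let ?h = "Symf f"
    let ?D = "\<lambda>vs ws. ?h (vs @ ws)"
    note gs = Symf_gs[OF True]
    have D: "bi_gs ?D"
      using gs_append_left[OF gs] gs_append_right[OF gs] by (simp add: bi_gs_def)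
    have E: "(\<lambda>u. E u f) = ?h" using True by (simp add: fun_eq_iff E_apply)
    have m: "mu (?P k) f = a (\<lambda>vs. b ((Pc ^^ k) ?D vs))" for k
    proof -
      have "mu (?P k) f = ?P k (pairing ?D)"
        using True gs_ml[OF gs] by (simp add: mu symT_def concT_def)
      also have "\<dots> = pairing ((Pc ^^ k) (word_form (pairing ?D))) a b"
        using P_pow[OF a b] pairing_bilin[OF bi_gs_ml[OF D]] by blast
      finally show ?thesis by (simp add: word_form_pairing[OF D] pairing_def)
    qed
    have mP: "multilinear (\<lambda>vs. b ((Pc ^^ k) ?D vs))" for k
      by (rule pairing_inner_ml[OF bi_gs_ml[OF Pc_pow_bi_gs[OF D]] bT])
    have mPr: "multilinear ((Pc ^^ k) ?D vs)" for k vs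
      using bi_gs_ml[OF Pc_pow_bi_gs[OF D]] by (simp add: bi_ml_def)
    let ?G = "\<lambda>vs. \<Sum>k<N. z ^ k / fact k * b ((Pc ^^ k) ?D vs)"
    have mG: "multilinear ?G" by (intro ml_sum ml_times mP)
    \<comment> \<open>The two forms are compared on words shorter than \<open>N\<close> only; at
      greater length their difference is invisible to \<open>a\<close> by the choice of
      \<open>N\<close>.\<close>
    have "a (\<lambda>vs. b (SF ?h vs) + (-1) * ?G vs) = 0"
    proof (rule N)
      show "multilinear (\<lambda>vs. b (SF ?h vs) + (-1) * ?G vs)"
        by (intro ml_plus ml_times SF_inner_ml[OF bT gs] mG)
      show "\<forall>vs. length vs < N \<longrightarrow> b (SF ?h vs) + (-1) * ?G vs = 0"
      proof (intro allI impI)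
        fix vs :: "'v list" assume l: "length vs < N"
        then have "SF ?h vs = (\<lambda>ws. \<Sum>k<N. z ^ k / fact k * (Pc ^^ k) ?D vs ws)"
          using SF_eq[of vs "N - 1" ?h] by (cases N) (auto simp: fun_eq_iff lessThan_Suc_atMost)
        then have "b (SF ?h vs) = ?G vs"
          by (simp only: T_form_sum[OF bT ml_times[OF mPr]] T_form_times[OF bT mPr])
        then show "b (SF ?h vs) + (-1) * ?G vs = 0" by simp
      qed
    qed
    then have "a (\<lambda>vs. b (SF ?h vs)) + (-1) * a ?G = 0"
      by (simp only: T_form_plus[OF aT SF_inner_ml[OF bT gs] ml_times[OF mG]] T_form_times[OF aT mG])
    then have "a (\<lambda>vs. b (SF ?h vs)) = a ?G" by simp
    also have "\<dots> = (\<Sum>k<N. z ^ k / fact k * a (\<lambda>vs. b ((Pc ^^ k) ?D vs)))"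
      by (simp only: T_form_sum[OF aT ml_times[OF mP]] T_form_times[OF aT mP])
    finally show ?thesis using S m E by simp
  next
    case False
    have "(\<lambda>u. E u f) = (\<lambda>u. 0)" using False by (simp add: fun_eq_iff E_apply)
    then have "SF (\<lambda>u. E u f) = (\<lambda>vs ws. 0)" by (simp add: fun_eq_iff)
    then show ?thesis using S False
      by (simp add: mu symT_def T_form_zero[OF aT] T_form_zero[OF bT])
  qed
qed

lemma star_gs:
  assumes "a \<in> sym_algebra" "b \<in> sym_algebra" "graded_symmetric f"
  shows "star \<Lambda> z a b f = a (\<lambda>vs. b (SF f vs))"
  by (simp add: star_apply assms E_form_SF)

lemma star_S [simp]: "a \<in> sym_algebra \<Longrightarrow> b \<in> sym_algebra \<Longrightarrow> star \<Lambda> z a b \<in> sym_algebra"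
  unfolding star_def using P_pow SS_TT mu_S by (intro S_sum S_scale) blast

lemma star_add_left:
  "a \<in> sym_algebra \<Longrightarrow> a' \<in> sym_algebra \<Longrightarrow> b \<in> sym_algebra \<Longrightarrow> star \<Lambda> z (a + a') b = star \<Lambda> z a b + star \<Lambda> z a' b"
  by (simp add: fun_eq_iff star_apply fun_arith_apply)

lemma star_scale_left:
  "a \<in> sym_algebra \<Longrightarrow> b \<in> sym_algebra \<Longrightarrow> star \<Lambda> z (fscale c a) b = fscale c (star \<Lambda> z a b)"
  by (simp add: fun_eq_iff star_apply fun_arith_apply)

lemma star_add_right:
  "a \<in> sym_algebra \<Longrightarrow> b \<in> sym_algebra \<Longrightarrow> b' \<in> sym_algebra \<Longrightarrow> star \<Lambda> z a (b + b') = star \<Lambda> z a b + star \<Lambda> z a b'"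
  by (rule ext) (simp add: star_apply plus_fun_apply T_form_plus[OF S_T SF_inner_ml[OF S_T E_gs] SF_inner_ml[OF S_T E_gs]])

lemma star_scale_right:
  "a \<in> sym_algebra \<Longrightarrow> b \<in> sym_algebra \<Longrightarrow> star \<Lambda> z a (fscale c b) = fscale c (star \<Lambda> z a b)"
  by (rule ext) (simp add: star_apply fscale_apply T_form_times[OF S_T SF_inner_ml[OF S_T E_gs]])

lemma star_0_left: "b \<in> sym_algebra \<Longrightarrow> star \<Lambda> z 0 b = 0"
  using star_scale_left[of 0 b 0] by simp

lemma star_0_right: "a \<in> sym_algebra \<Longrightarrow> star \<Lambda> z a 0 = 0"
  using star_scale_right[of a 0 0] by simp

lemma star_diff_left:
  assumes "a \<in> sym_algebra" "a' \<in> sym_algebra" "b \<in> sym_algebra"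
  shows "star \<Lambda> z (a - a') b = star \<Lambda> z a b - star \<Lambda> z a' b"
  using star_add_left[of "a - a'" a' b] assms by simp

lemma star_diff_right:
  assumes "a \<in> sym_algebra" "b \<in> sym_algebra" "b' \<in> sym_algebra"
  shows "star \<Lambda> z a (b - b') = star \<Lambda> z a b - star \<Lambda> z a b'"
  using star_add_right[of a "b - b'" b'] assms by simp

lemma star_sum_left:
  "(\<And>i. i \<in> A \<Longrightarrow> F i \<in> sym_algebra) \<Longrightarrow> b \<in> sym_algebra \<Longrightarrow> star \<Lambda> z (\<Sum>i\<in>A. F i) b = (\<Sum>i\<in>A. star \<Lambda> z (F i) b)"
  by (induction A rule: infinite_finite_induct) (simp_all add: star_0_left star_add_left)

lemma star_sum_right:
  "(\<And>i. i \<in> A \<Longrightarrow> F i \<in> sym_algebra) \<Longrightarrow> a \<in> sym_algebra \<Longrightarrow> star \<Lambda> z a (\<Sum>i\<in>A. F i) = (\<Sum>i\<in>A. star \<Lambda> z a (F i))"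
  by (induction A rule: infinite_finite_induct) (simp_all add: star_0_right star_add_right)

text \<open>With one vector on the left the exponential series ends with the linear term.\<close>

lemma star_single_gs:
  assumes "b \<in> sym_algebra" "graded_symmetric f"
  shows "star \<Lambda> z (E [v]) b f = b (\<lambda>ws. f (v # ws) + z * (\<Sum>e\<in>UNIV. contr e (Lam e v) f ws))"
proof -
  have "star \<Lambda> z (E [v]) b f = b (SF f [v])"
    using assms E_gs_apply[of "\<lambda>vs. b (SF f vs)" "[v]"] SF_bi_gs[OF assms(2)] S_T[OF assms(1)]
  proof -
    note gs = SF_bi_gs[OF assms(2)]
    have "E [v] (\<lambda>vs. b (SF f vs)) = b (SF f [v])"
      using SF_inner_ml[OF S_T[OF assms(1)] assms(2)] by (simp add: E_short tensor_def)
    then show ?thesis using assms by (simp add: star_gs)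
  qed
  also have "SF f [v] = (\<lambda>ws. f (v # ws) + z * (\<Sum>e\<in>UNIV. contr e (Lam e v) f ws))"
    by (simp add: fun_eq_iff SF_Cons Lam_right_eq SF_Nil[abs_def])
  finally show ?thesis .
qed

lemma star_E_E_gs: "graded_symmetric f \<Longrightarrow> star \<Lambda> z (E vs) (E ws) f = SF f vs ws"
  using pairing_E[OF SF_bi_gs[of f], of vs ws] by (simp add: star_gs pairing_def)

lemma single_gs:
  assumes "graded_symmetric f"
  shows "graded_symmetric (\<lambda>ws. f (v # ws) + z * (\<Sum>e\<in>UNIV. contr e (Lam e v) f ws))"
  by (rule gs_plus[OF gs_Cons[OF assms] gs_times[OF gs_sum[OF contr_gs[OF assms Lam_par_form]]]])

lemma star_assoc_single_words:
  "star \<Lambda> z (star \<Lambda> z (E [v]) (E vs)) (E ws) = star \<Lambda> z (E [v]) (star \<Lambda> z (E vs) (E ws))"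
proof (rule S_eqI)
  fix f assume f: "graded_symmetric f"
  note gs = SF_bi_gs[OF f]
  have 1: "E ws (SF f us) = SF f us ws" for us
    using gs by (simp add: bi_gs_def E_gs_apply)
  have g: "graded_symmetric (\<lambda>us. SF f us ws)" using gs by (simp add: bi_gs_def)
  have "star \<Lambda> z (star \<Lambda> z (E [v]) (E vs)) (E ws) f = star \<Lambda> z (E [v]) (E vs) (\<lambda>us. SF f us ws)"
    by (simp add: star_gs f 1)
  also have "\<dots> = SF f (v # vs) ws + z * (\<Sum>e\<in>UNIV. contr_left e (Lam e v) (SF f) vs ws)"
    by (simp add: star_single_gs[OF S_E g] E_gs_apply[OF single_gs[OF g]] contr_left_def)
  also have "\<dots> = SF (\<lambda>us. f (v # us) + z * (\<Sum>e\<in>UNIV. contr e (Lam e v) f us)) vs ws"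
    by (rule SF_assoc)
  also have "\<dots> = star \<Lambda> z (E [v]) (star \<Lambda> z (E vs) (E ws)) f"
    by (simp add: star_single_gs f star_E_E_gs single_gs)
  finally show "star \<Lambda> z (star \<Lambda> z (E [v]) (E vs)) (E ws) f = star \<Lambda> z (E [v]) (star \<Lambda> z (E vs) (E ws)) f" .
qed auto

lemma star_assoc_single:
  assumes "b \<in> sym_algebra" "c \<in> sym_algebra"
  shows "star \<Lambda> z (star \<Lambda> z (E [v]) b) c = star \<Lambda> z (E [v]) (star \<Lambda> z b c)"
proof -
  have 1: "star \<Lambda> z (star \<Lambda> z (E [v]) (E vs)) c = star \<Lambda> z (E [v]) (star \<Lambda> z (E vs) c)" for vs
    using assms(2)
    by (induction rule: S_induct)
      (simp_all add: star_0_right star_add_right star_scale_right star_assoc_single_words)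
  show ?thesis
    using assms
    by (induction rule: S_induct)
      (simp_all add: star_0_left star_0_right star_add_right star_scale_right star_add_left star_scale_left 1)
qed

text \<open>Contraction returns combinations of shorter products, which is what an induction on the
  degree needs. The prefix \<open>ps\<close> collects the vectors that the contraction has
  passed.\<close>

lemma lifted_span:
  "(\<lambda>f. contr e l (\<lambda>u. E (ps @ u) f) us) \<in> fs.span {E u |u. length u < length ps + length us}"
proof (induction us arbitrary: ps)
  case Nil
  have "(\<lambda>f. contr e l (\<lambda>u. E (ps @ u) f) []) = 0" by (simp add: fun_eq_iff zero_fun_apply)
  then show ?case by (simp only: fs.span_zero)
next
  case (Cons w us)
  have eq: "(\<lambda>f. contr e l (\<lambda>u. E (ps @ u) f) (w # us)) =
     fscale (l w) (E (ps @ us)) + (\<lambda>f. contr e l (\<lambda>u. E ((ps @ [gr e w]) @ u) f) us)"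
    by (simp add: fun_eq_iff fun_arith_apply)
  have "E (ps @ us) \<in> fs.span {E u |u. length u < length ps + length (w # us)}"
    by (rule fs.span_base) auto
  moreover have "(\<lambda>f. contr e l (\<lambda>u. E ((ps @ [gr e w]) @ u) f) us) \<in> fs.span {E u |u. length u < length ps + length (w # us)}"
    using Cons.IH[of "ps @ [gr e w]"] by simp
  ultimately show ?case unfolding eq by (intro fs.span_add fs.span_scale)
qed

lemma star_unit_left:
  assumes b: "b \<in> sym_algebra"
  shows "star \<Lambda> z unit b = b"
proof (rule S_eqI)
  fix f assume f: "graded_symmetric f"
  have "star \<Lambda> z unit b f = E [] (\<lambda>vs. b (SF f vs))"
    by (simp add: unit_eq star_gs b f)
  also have "\<dots> = b (SF f [])"
    by (simp add: E_short tensor_def SF_inner_ml[OF S_T[OF b] f])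
  finally show "star \<Lambda> z unit b f = b f" by (simp add: SF_Nil[abs_def])
qed (auto simp: unit_eq b)

lemma star_assoc_word:
  assumes "b \<in> sym_algebra" "c \<in> sym_algebra"
  shows "star \<Lambda> z (star \<Lambda> z (E us) b) c = star \<Lambda> z (E us) (star \<Lambda> z b c)"
proof -
  let ?A = "{a \<in> sym_algebra. \<forall>b\<in>sym_algebra. \<forall>c\<in>sym_algebra. star \<Lambda> z (star \<Lambda> z a b) c = star \<Lambda> z a (star \<Lambda> z b c)}"
  have sub: "fs.subspace ?A"
    by (rule fs.subspaceI) (auto simp: star_0_left star_add_left star_scale_left)
  have "E us \<in> ?A"
  proof (induction "length us" arbitrary: us rule: less_induct)
    case less
    show ?case
    proof (cases us)
      case Nil
      have "star \<Lambda> z (E []) b = b" if "b \<in> sym_algebra" for b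
        using star_unit_left[OF that] by (simp add: unit_eq)
      then show ?thesis using Nil by auto
    next
      case (Cons v vs)
      let ?X = "\<lambda>e. (\<lambda>f. contr e (Lam e v) (\<lambda>u. E u f) vs)"
      have X: "?X e \<in> ?A" for e
      proof -
        have "?X e \<in> fs.span {E u |u. length u < length vs}"
          using lifted_span[of e "Lam e v" "[]" vs] by simp
        also have "\<dots> \<subseteq> fs.span ?A"
          using less Cons by (intro fs.span_mono) auto
        also have "\<dots> = ?A" by (rule fs.span_eq_iff[THEN iffD2, OF sub])
        finally show ?thesis .
      qed
      have "E vs \<in> ?A" using less Cons by auto
      have st: "star \<Lambda> z (E [v]) (E vs) \<in> ?A"
        using \<open>E vs \<in> ?A\<close> by (auto simp: star_assoc_single)
      \<comment> \<open>The product of \<open>v\<close> with the remaining vectors differs from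
        their star product by terms of lower degree, so vectors generate the symmetric algebra under
        \<open>star\<close> as well. The set \<open>?A\<close> of good left factors is a subspace
        that contains both contributions.\<close>
      have "E us = star \<Lambda> z (E [v]) (E vs) - fscale z (\<Sum>e\<in>UNIV. ?X e)"
      proof (rule S_eqI)
        fix f assume f: "graded_symmetric f"
        show "E us f = (star \<Lambda> z (E [v]) (E vs) - fscale z (\<Sum>e\<in>UNIV. ?X e)) f"
          by (simp add: fun_arith_apply fun_diff_def star_single_gs[OF S_E f] E_gs_apply f E_gs_apply[OF single_gs[OF f]] Cons)
      qed (use X in auto)
      also have "\<dots> \<in> ?A"
        using X st by (intro fs.subspace_diff[OF sub] fs.subspace_scale[OF sub] fs.subspace_sum[OF sub]) auto
      finally show ?thesis .
    qed
  qed
  then show ?thesis using assms by blast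
qed

lemma star_assoc:
  assumes "a \<in> sym_algebra" "b \<in> sym_algebra" "c \<in> sym_algebra"
  shows "star \<Lambda> z (star \<Lambda> z a b) c = star \<Lambda> z a (star \<Lambda> z b c)"
  using assms
  by (induction rule: S_induct) (simp_all add: star_0_left star_add_left star_scale_left star_assoc_word)

lemma SF_Nil_right: "SF f vs [] = f vs"
proof -
  have "SF f vs [] = (\<Sum>k\<le>length vs. if k = 0 then f vs else 0)"
    unfolding SF_def by (rule sum.cong) (auto simp: Pc_pow_zero)
  then show ?thesis by simp
qed

lemma star_unit_right: "a \<in> sym_algebra \<Longrightarrow> star \<Lambda> z a unit = a"
proof (rule S_eqI)
  fix f assume a: "a \<in> sym_algebra" and f: "graded_symmetric f"
  have "E [] (SF f vs) = f vs" for vs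
    using SF_bi_gs[OF f] by (simp add: bi_gs_def E_gs_apply SF_Nil_right)
  then show "star \<Lambda> z a unit f = a f"
    using a f by (simp add: unit_eq star_gs)
qed (auto simp: unit_eq)

subsection \<open>Commutators with even vectors\<close>

definition derv :: "('v \<Rightarrow> 'k) \<Rightarrow> (('v list \<Rightarrow> 'k) \<Rightarrow> 'k) \<Rightarrow> ('v list \<Rightarrow> 'k) \<Rightarrow> 'k" where
  "derv \<phi> a = (\<lambda>f. a (contr False \<phi> (\<lambda>u. E u f)))"

lemma derv_add: "derv \<phi> (a + b) = derv \<phi> a + derv \<phi> b"
  and derv_scale: "derv \<phi> (fscale c a) = fscale c (derv \<phi> a)"
  by (auto simp: derv_def fun_eq_iff fun_arith_apply)

lemma derv_gs: "graded_symmetric f \<Longrightarrow> derv \<phi> a f = a (contr False \<phi> f)"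
  by (simp add: derv_def E_gs_apply)

lemma derv_S:
  assumes "par_form False \<phi>" "a \<in> sym_algebra"
  shows "derv \<phi> a \<in> sym_algebra"
  using assms(2)
proof (induction rule: S_induct)
  case zero
  have "derv \<phi> 0 = 0" by (simp add: derv_def fun_eq_iff zero_fun_apply)
  then show ?case by simp
next
  case (step c vs s)
  have "derv \<phi> (E vs) = (\<lambda>f. contr False \<phi> (\<lambda>u. E ([] @ u) f) vs)"
    by (simp add: derv_def fun_eq_iff E_gs_apply[OF contr_gs[OF E_gs assms(1)]])
  also have "\<dots> \<in> fs.span (range E)"
    by (rule set_mp[OF fs.span_mono lifted_span]) auto
  finally show ?case using step by (simp add: derv_add derv_scale sym_algebra_eq fs.span_add fs.span_scale)
qed

lemma Lam_even_vector:
  assumes "w \<in> V0"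
  shows "Lam True w = (\<lambda>v. 0)" "Lam True v w = 0" "Lam False w = \<Lambda> w" "Lam False v w = \<Lambda> v w"
proof -
  have w: "pr True w = 0" using assms by (intro pr_other) (simp add: Vpar_def)
  show 1: "Lam True w = (\<lambda>v. 0)" using Lam_pr[of True False w] assms by (simp add: pr_same Vpar_def)
  show 2: "Lam True v w = 0" using w by (simp add: Lam_def lin_form_0[OF Lambda_lin(1)])
  show "Lam False w = \<Lambda> w" using Lam_sum[of w] by (simp add: fun_eq_iff 1)
  show "Lam False v w = \<Lambda> v w" using Lam_sum[of v w] 2 by simp
qed

text \<open>\<open>SF\<close> unfolds along the left word only, so the single vector on the right is
  reached by induction. Being even, \<open>w\<close> moves to the front without a sign and meets
  only the even part of \<Lambda>.\<close>

lemma SF_right_even: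
  assumes "graded_symmetric f" "w \<in> V0"
  shows "SF f vs [w] = f (w # vs) + z * contr False (\<lambda>v. \<Lambda> v w) f vs"
  using assms(1)
proof (induction vs arbitrary: f)
  case (Cons v vs)
  have w: "pr True w = 0" using assms(2) by (intro pr_other) (simp add: Vpar_def)
  have 0: "f (0 # us) = 0" for us
    using lin_form_0[OF ml_Cons_lin[OF gs_ml[OF Cons.prems]]] .
  have "f (v # w # vs) = f (w # v # vs)"
    by (subst gs_swap_Cons[OF Cons.prems]) (simp add: w 0)
  then show ?case
    unfolding SF_Cons Cons.IH[OF gs_Cons[OF Cons.prems]]
    by (simp add: Lam_right_eq UNIV_bool_sum Lam_even_vector[OF assms(2)] SF_Nil_right algebra_simps)
qed simp

text \<open>Both products contain the same term \<open>f (w # ws)\<close>; the contractions with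
  \<Lambda>(w, -) and \<Lambda>(-, w) remain, and no higher order arises because \<open>w\<close> is
  a single vector. By \<open>sharp_even\<close> the form on the right is 2 z times
  \<open>sharp \<Lambda> w\<close>.\<close>

lemma star_commutator:
  assumes w: "w \<in> V0" and a: "a \<in> sym_algebra"
  shows "star \<Lambda> z (E [w]) a - star \<Lambda> z a (E [w]) = derv (\<lambda>v. z * (\<Lambda> w v - \<Lambda> v w)) a"
proof -
  let ?\<phi> = "\<lambda>v. z * (\<Lambda> w v - \<Lambda> v w)"
  have lin: "lin_form ?\<phi>"
    using lin_form_add[OF Lambda_lin(1)] lin_form_scale[OF Lambda_lin(1)]
      lin_form_add[OF Lambda_lin(2)] lin_form_scale[OF Lambda_lin(2)]
    by (simp add: lin_form_def algebra_simps)
  have "?\<phi> (pr True v) = 0" for v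
    using w Lambda_even pr_in[of True v] by (simp add: even_bilinear_form_def Vpar_def)
  then have par: "par_form False ?\<phi>" using lin by (simp add: par_form_def)
  show ?thesis
  proof (rule S_eqI)
    fix f assume f: "graded_symmetric f"
    note aT = S_T[OF a]
    have l: "lin_form (\<Lambda> w)" "lin_form (\<lambda>v. \<Lambda> v w)" by (rule Lambda_lin)+
    have E: "E [w] (SF f vs) = SF f vs [w]" for vs
      using SF_bi_gs[OF f] by (simp add: bi_gs_def E_gs_apply)
    have m: "multilinear (\<lambda>ws. f (w # ws))" "multilinear (\<lambda>ws. z * contr False (\<Lambda> w) f ws)"
      "multilinear (\<lambda>ws. z * contr False (\<lambda>v. \<Lambda> v w) f ws)"
      using ml_Cons[OF gs_ml[OF f]] by (auto intro!: ml_times contr_ml[OF gs_ml[OF f]] l)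
    have "star \<Lambda> z (E [w]) a f = a (\<lambda>ws. f (w # ws) + z * contr False (\<Lambda> w) f ws)"
      by (simp add: star_single_gs[OF a f] UNIV_bool_sum Lam_even_vector[OF w])
    moreover have "star \<Lambda> z a (E [w]) f = a (\<lambda>ws. f (w # ws) + z * contr False (\<lambda>v. \<Lambda> v w) f ws)"
      by (simp add: star_gs a f E SF_right_even w)
    moreover have "contr False ?\<phi> f = (\<lambda>ws. z * contr False (\<Lambda> w) f ws + (-1) * (z * contr False (\<lambda>v. \<Lambda> v w) f ws))"
    proof
      fix ws
      have "contr False ?\<phi> f ws = contr False (\<lambda>v. z * \<Lambda> w v + (- z) * \<Lambda> v w) f ws"
        by (simp add: algebra_simps)
      then show "contr False ?\<phi> f ws = z * contr False (\<Lambda> w) f ws + (-1) * (z * contr False (\<lambda>v. \<Lambda> v w) f ws)"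
        by (simp only: contr_form_plus contr_form_times) simp
    qed
    moreover have "a (\<lambda>ws. z * contr False (\<Lambda> w) f ws + (-1) * (z * contr False (\<lambda>v. \<Lambda> v w) f ws)) =
       a (\<lambda>ws. z * contr False (\<Lambda> w) f ws) + (-1) * a (\<lambda>ws. z * contr False (\<lambda>v. \<Lambda> v w) f ws)"
      by (simp only: T_form_plus[OF aT m(2) ml_times[OF m(3)]] T_form_times[OF aT m(3)])
    ultimately show "(star \<Lambda> z (E [w]) a - star \<Lambda> z a (E [w])) f = derv ?\<phi> a f"
      using T_form_plus[OF aT m(1) m(2)] T_form_plus[OF aT m(1) m(3)]
      by (simp only: fun_diff_def derv_gs[OF f]) simp
  qed (use a derv_S[OF par a] in auto)
qed

subsection \<open>The translation automorphism\<close>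

text \<open>The transpose of replacing every vector \<open>v\<close> of a product by
  \<open>v\<close> + \<phi>(v) 1, with the product multiplied out.\<close>

fun tf :: "('v \<Rightarrow> 'k) \<Rightarrow> ('v list \<Rightarrow> 'k) \<Rightarrow> 'v list \<Rightarrow> 'k" where
  "tf \<phi> f [] = f []"
| "tf \<phi> f (v # vs) = tf \<phi> (\<lambda>us. f (v # us)) vs + \<phi> v * tf \<phi> f vs"

lemma contr_pow_Cons:
  "(contr False \<phi> ^^ Suc k) f (v # vs) =
     (contr False \<phi> ^^ Suc k) (\<lambda>us. f (v # us)) vs + of_nat (Suc k) * (\<phi> v * (contr False \<phi> ^^ k) f vs)"
proof (induction k arbitrary: vs)
  case (Suc k)
  have eq: "(\<lambda>us. (contr False \<phi> ^^ Suc k) f (v # us)) =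
     (\<lambda>vs. (contr False \<phi> ^^ Suc k) (\<lambda>us. f (v # us)) vs + of_nat (Suc k) * (\<phi> v * (contr False \<phi> ^^ k) f vs))"
    using Suc.IH by (simp add: fun_eq_iff)
  have "(contr False \<phi> ^^ Suc (Suc k)) f (v # vs) = \<phi> v * (contr False \<phi> ^^ Suc k) f vs +
     contr False \<phi> (\<lambda>us. (contr False \<phi> ^^ Suc k) f (v # us)) vs"
    by simp
  also have "\<dots> = \<phi> v * (contr False \<phi> ^^ Suc k) f vs + ((contr False \<phi> ^^ Suc (Suc k)) (\<lambda>us. f (v # us)) vs
      + of_nat (Suc k) * (\<phi> v * (contr False \<phi> ^^ Suc k) f vs))"
    unfolding eq contr_plus contr_times by simp
  finally show ?case by (simp add: algebra_simps)
qed simp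

lemma contr_pow_zero: "length vs < k \<Longrightarrow> (contr False \<phi> ^^ k) f vs = 0"
proof (induction vs arbitrary: k f)
  case Nil
  then show ?case by (cases k) auto
next
  case (Cons v vs)
  then obtain k' where "k = Suc k'" by (cases k) auto
  then show ?case using Cons by (simp add: contr_pow_Cons del: funpow.simps)
qed

text \<open>Again the exponential of a derivation that maps vectors to scalars: by
  \<open>contr_pow_Cons\<close> each vector is contracted at most once, and 1/(k+1)! becomes
  1/k!.\<close>

lemma tf_exp: "length vs \<le> n \<Longrightarrow> tf \<phi> f vs = (\<Sum>k\<le>n. 1 / fact k * (contr False \<phi> ^^ k) f vs)"
proof (induction vs arbitrary: f n)
  case Nil
  have "(\<Sum>k\<le>n. 1 / fact k * (contr False \<phi> ^^ k) f []) = (\<Sum>k\<le>n. if k = 0 then f [] else 0)"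
    by (rule sum.cong) (auto simp: contr_pow_zero)
  then show ?case by simp
next
  case (Cons v vs)
  then obtain m where n: "n = Suc m" "length vs \<le> m" by (cases n) auto
  have "(\<Sum>k\<le>n. 1 / fact k * (contr False \<phi> ^^ k) f (v # vs)) = f (v # vs) +
     (\<Sum>k\<le>m. 1 / fact (Suc k) * (contr False \<phi> ^^ Suc k) f (v # vs))"
    unfolding n by (simp add: sum.atMost_Suc_shift del: sum.atMost_Suc funpow.simps)
  also have "(\<Sum>k\<le>m. 1 / fact (Suc k) * (contr False \<phi> ^^ Suc k) f (v # vs)) =
     (\<Sum>k\<le>m. 1 / fact (Suc k) * (contr False \<phi> ^^ Suc k) (\<lambda>us. f (v # us)) vs) +
     (\<Sum>k\<le>m. \<phi> v * (1 / fact k * (contr False \<phi> ^^ k) f vs))"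
    unfolding contr_pow_Cons sum.distrib[symmetric]
    by (rule sum.cong) (auto simp: field_simps simp del: funpow.simps of_nat_Suc)
  also have "f (v # vs) + \<dots> = (\<Sum>k\<le>n. 1 / fact k * (contr False \<phi> ^^ k) (\<lambda>us. f (v # us)) vs) +
      \<phi> v * (\<Sum>k\<le>m. 1 / fact k * (contr False \<phi> ^^ k) f vs)"
    unfolding n by (subst sum.atMost_Suc_shift) (simp add: sum_distrib_left del: sum.atMost_Suc funpow.simps)
  finally show ?case using Cons.IH[of n] Cons.IH[of m] n by simp
qed

lemma tf_plus: "tf \<phi> (\<lambda>us. f us + g us) vs = tf \<phi> f vs + tf \<phi> g vs"
  by (induction vs arbitrary: f g) (auto simp: algebra_simps)

lemma tf_times: "tf \<phi> (\<lambda>us. c * f us) vs = c * tf \<phi> f vs"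
  by (induction vs arbitrary: f) (auto simp: algebra_simps)

lemma tf_gs:
  assumes "par_form False \<phi>" "graded_symmetric f"
  shows "graded_symmetric (tf \<phi> f)"
proof -
  have P: "graded_symmetric ((contr False \<phi> ^^ k) f)" for k
    by (induction k) (auto simp: assms(2) contr_gs[OF _ assms(1)])
  have "tf \<phi> f = (\<lambda>vs. (\<Sum>k\<le>length vs. 1 / fact k * (contr False \<phi> ^^ k) f vs))"
    by (rule ext) (rule tf_exp[OF order_refl])
  then show ?thesis
    using gs_by_length[where F = "\<lambda>n vs. \<Sum>k\<le>n. 1 / fact k * (contr False \<phi> ^^ k) f vs", OF gs_sum[OF gs_times[OF P]]]
    by (simp only:)
qed

text \<open>Multiplicativity of the translation in transposed form, since the product of words is
  concatenation.\<close>

lemma tf_append: "tf \<phi> f (us @ vs) = tf \<phi> (\<lambda>x. tf \<phi> (\<lambda>y. f (x @ y)) vs) us"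
  by (induction us arbitrary: f) (auto simp: tf_plus)

lemma tf_inverse: "tf (\<lambda>v. - \<phi> v) (tf \<phi> f) vs = f vs"
proof (induction vs arbitrary: f)
  case (Cons v vs)
  have "(\<lambda>us. tf \<phi> f (v # us)) = (\<lambda>us. tf \<phi> (\<lambda>us. f (v # us)) us + \<phi> v * tf \<phi> f us)"
    by (simp add: fun_eq_iff)
  then show ?case
    unfolding tf.simps(2)[of "\<lambda>v. - \<phi> v"] by (simp only: Cons tf_plus tf_times) simp
qed simp

definition tauT :: "('v \<Rightarrow> 'k) \<Rightarrow> (('v list \<Rightarrow> 'k) \<Rightarrow> 'k) \<Rightarrow> ('v list \<Rightarrow> 'k) \<Rightarrow> 'k" where
  "tauT \<phi> a = (\<lambda>f. a (tf \<phi> (\<lambda>u. E u f)))"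

lemma tauT_add: "tauT \<phi> (a + b) = tauT \<phi> a + tauT \<phi> b"
  and tauT_scale: "tauT \<phi> (fscale c a) = fscale c (tauT \<phi> a)"
  by (auto simp: tauT_def fun_eq_iff fun_arith_apply)

lemma tauT_0: "tauT \<phi> 0 = 0"
  by (simp add: tauT_def fun_eq_iff zero_fun_apply)

lemma tauT_gs: "graded_symmetric f \<Longrightarrow> tauT \<phi> a f = a (tf \<phi> f)"
  by (simp add: tauT_def E_gs_apply)

lemma tauT_S:
  assumes phi: "par_form False \<phi>" and a: "a \<in> sym_algebra"
  shows "tauT \<phi> a \<in> sym_algebra"
  using a
proof (induction rule: S_induct)
  case zero
  then show ?case by (simp add: tauT_0)
next
  case (step c vs s)
  have "(\<lambda>f. tf \<phi> (\<lambda>u. E (ps @ u) f) vs) \<in> sym_algebra" for ps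
  proof (induction vs arbitrary: ps)
    case (Cons v vs)
    have "(\<lambda>f. tf \<phi> (\<lambda>u. E (ps @ u) f) (v # vs)) =
       (\<lambda>f. tf \<phi> (\<lambda>u. E ((ps @ [v]) @ u) f) vs) + fscale (\<phi> v) (\<lambda>f. tf \<phi> (\<lambda>u. E (ps @ u) f) vs)"
      by (simp add: fun_eq_iff fun_arith_apply)
    then show ?case using Cons.IH[of ps] Cons.IH[of "ps @ [v]"] by (simp only: S_add S_scale)
  qed simp
  from this[of "[]"] have "tauT \<phi> (E vs) \<in> sym_algebra"
    by (simp add: tauT_def E_gs_apply[OF tf_gs[OF phi E_gs]])
  then show ?case using step by (simp add: tauT_add tauT_scale)
qed

context
  fixes \<phi> :: "'v \<Rightarrow> 'k"
  assumes phi: "par_form False \<phi>"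
begin

lemma sym_mult_gs:
  "a \<in> tensor_algebra \<Longrightarrow> b \<in> tensor_algebra \<Longrightarrow> graded_symmetric f \<Longrightarrow>
    sym_mult a b f = a (\<lambda>vs. b (\<lambda>ws. f (vs @ ws)))"
  by (simp add: sym_mult_apply gs_ml Symf_id)

lemma sym_mult_bilinear:
  assumes "a \<in> tensor_algebra" "a' \<in> tensor_algebra" "b \<in> tensor_algebra"
  shows "sym_mult (fscale c a + a') b = fscale c (sym_mult a b) + sym_mult a' b"
    "sym_mult b (fscale c a + a') = fscale c (sym_mult b a) + sym_mult b a'"
proof -
  have m: "multilinear (\<lambda>vs. a (\<lambda>ws. f (vs @ ws)))" "multilinear (\<lambda>ws. f (vs @ ws))"
    if "multilinear f" "a \<in> tensor_algebra" for f a vs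
    using pairing_inner_ml[OF append_bi_ml[OF that(1)] that(2)] ml_append_left[OF that(1)] by auto
  show "sym_mult (fscale c a + a') b = fscale c (sym_mult a b) + sym_mult a' b"
    using assms by (intro ext) (simp add: sym_mult_apply fun_arith_apply)
  show "sym_mult b (fscale c a + a') = fscale c (sym_mult b a) + sym_mult b a'"
  proof
    fix f
    show "sym_mult b (fscale c a + a') f = (fscale c (sym_mult b a) + sym_mult b a') f"
    proof (cases "multilinear f")
      case True
      note M = m(1)[OF Symf_ml[OF True]]
      have "b (\<lambda>vs. c * a (\<lambda>ws. Symf f (vs @ ws)) + a' (\<lambda>ws. Symf f (vs @ ws))) =
        c * b (\<lambda>vs. a (\<lambda>ws. Symf f (vs @ ws))) + b (\<lambda>vs. a' (\<lambda>ws. Symf f (vs @ ws)))"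
        using assms by (simp only: T_form_plus[OF assms(3) ml_times[OF M[OF assms(1)]] M[OF assms(2)]] T_form_times[OF assms(3) M[OF assms(1)]])
      then show ?thesis using True assms by (simp add: sym_mult_apply fun_arith_apply)
    qed (use assms in \<open>simp add: sym_mult_apply fun_arith_apply\<close>)
  qed
qed

lemma tauT_word_mult: "tauT \<phi> (sym_mult (E us) (E vs)) = sym_mult (tauT \<phi> (E us)) (tauT \<phi> (E vs))"
proof (rule S_eqI)
  fix f assume f: "graded_symmetric f"
  have T: "tauT \<phi> (E us) \<in> tensor_algebra" for us by (simp add: S_T tauT_S[OF phi])
  have tE: "tauT \<phi> (E vs) g = tf \<phi> g vs" if "graded_symmetric g" for g vs
    by (simp add: tauT_gs that E_gs_apply tf_gs[OF phi])
  have g: "graded_symmetric (\<lambda>x. tf \<phi> (\<lambda>y. f (x @ y)) vs)"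
  proof (rule graded_symmetricI)
    have "(\<lambda>x. tf \<phi> (\<lambda>y. f (x @ y)) vs) = (\<lambda>x. tauT \<phi> (E vs) (\<lambda>y. f (x @ y)))"
      by (simp add: fun_eq_iff tE gs_append_left[OF f])
    then show "multilinear (\<lambda>x. tf \<phi> (\<lambda>y. f (x @ y)) vs)"
      using pairing_inner_ml[OF append_bi_ml[OF gs_ml[OF f]] T] by simp
    fix ps x y qs
    have "(\<lambda>u. f ((ps @ x # y # qs) @ u)) = (\<lambda>u. f ((ps @ y # x # qs) @ u) + (-2) * f ((ps @ pr True y # pr True x # qs) @ u))"
    proof
      fix u
      show "f ((ps @ x # y # qs) @ u) = f ((ps @ y # x # qs) @ u) + (-2) * f ((ps @ pr True y # pr True x # qs) @ u)"
        by (subst gs_swap[OF gs_append_right[OF f]]) simp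
    qed
    then show "tf \<phi> (\<lambda>u. f ((ps @ x # y # qs) @ u)) vs = tf \<phi> (\<lambda>u. f ((ps @ y # x # qs) @ u)) vs -
        2 * tf \<phi> (\<lambda>u. f ((ps @ pr True y # pr True x # qs) @ u)) vs"
      by (simp only: tf_plus tf_times) simp
  qed
  show "tauT \<phi> (sym_mult (E us) (E vs)) f = sym_mult (tauT \<phi> (E us)) (tauT \<phi> (E vs)) f"
    by (simp add: E_sym_mult_E tE f tf_append sym_mult_gs T gs_append_left[OF f] g)
qed (auto simp: tauT_S[OF phi] sym_mult_S S_T)

lemma tauT_mult:
  assumes "a \<in> sym_algebra" "b \<in> sym_algebra"
  shows "tauT \<phi> (sym_mult a b) = sym_mult (tauT \<phi> a) (tauT \<phi> b)"
proof -
  note T = S_T S_T[OF tauT_S[OF phi]] sym_mult_bilinear tauT_add tauT_scale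
  have z: "sym_mult 0 c = 0" "sym_mult c 0 = 0" if "c \<in> tensor_algebra" for c
    using sym_mult_bilinear[of 0 0 c "-1"] that by simp_all
  have 1: "tauT \<phi> (sym_mult (E us) b) = sym_mult (tauT \<phi> (E us)) (tauT \<phi> b)" for us
    using assms(2) by (induction rule: S_induct) (simp_all add: T tauT_word_mult z tauT_0)
  show ?thesis
    using assms(1) by (induction rule: S_induct) (simp_all add: T 1 assms z tauT_0)
qed

text \<open>The inverse is the translation by -\<phi>. Restriction to the algebra matches the
  extensionality in \<open>tau\<close>.\<close>

lemma tauT_automorphism:
  "unital_algebra_automorphism fscale sym_algebra sym_mult unit (restrict (tauT \<phi>) sym_algebra)"
proof -
  have phi': "par_form False (\<lambda>v. - \<phi> v)"
    using phi by (auto simp: par_form_def lin_form_def)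
  have inv: "tauT (\<lambda>v. - \<psi> v) (tauT \<psi> a) = a" "tauT \<psi> (tauT (\<lambda>v. - \<psi> v) a) = a"
    if a: "a \<in> sym_algebra" and psi: "par_form False \<psi>" "par_form False (\<lambda>v. - \<psi> v)"
      "tauT \<psi> (tauT (\<lambda>v. - \<psi> v) a) \<in> sym_algebra" "tauT (\<lambda>v. - \<psi> v) (tauT \<psi> a) \<in> sym_algebra" for a \<psi>
  proof -
    have t: "tf \<psi> (tf (\<lambda>v. - \<psi> v) f) = f" "tf (\<lambda>v. - \<psi> v) (tf \<psi> f) = f" for f
      using tf_inverse[of "\<lambda>v. - \<psi> v" f] tf_inverse[of \<psi> f] by (simp_all add: fun_eq_iff)
    show "tauT (\<lambda>v. - \<psi> v) (tauT \<psi> a) = a"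
      by (rule S_eqI[OF psi(4) a]) (simp add: tauT_gs tf_gs[OF psi(2)] t)
    show "tauT \<psi> (tauT (\<lambda>v. - \<psi> v) a) = a"
      by (rule S_eqI[OF psi(3) a]) (simp add: tauT_gs tf_gs[OF psi(1)] t)
  qed
  have "bij_betw (tauT \<phi>) sym_algebra sym_algebra"
    by (rule bij_betw_byWitness[where f' = "tauT (\<lambda>v. - \<phi> v)"])
      (use inv[OF _ phi phi'] tauT_S[OF phi'] tauT_S[OF phi] in auto)
  then have "bij_betw (restrict (tauT \<phi>) sym_algebra) sym_algebra sym_algebra"
    by (rule bij_betw_cong[THEN iffD1, rotated]) simp
  moreover have "tauT \<phi> unit = unit"
    by (rule S_eqI) (simp_all add: tauT_S[OF phi] unit_eq tauT_gs E_gs_apply tf_gs[OF phi])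
  ultimately show ?thesis
    by (auto simp: unital_algebra_automorphism_def tauT_add tauT_scale tauT_mult sym_mult_S S_T unit_eq)
qed

lemma tauT_incl: "tauT \<phi> (incl v) = incl v + fscale (\<phi> v) unit"
  by (rule S_eqI) (simp_all add: tauT_S[OF phi] incl_eq unit_eq tauT_gs E_gs_apply tf_gs[OF phi] fun_arith_apply)

text \<open>Uniqueness holds because products of vectors arise from the elements
  \<open>incl v\<close> by multiplication, and there the automorphism is prescribed.\<close>

lemma tau_eq:
  assumes "a \<in> sym_algebra"
  shows "tau \<phi> a = tauT \<phi> a"
proof -
  have "tau \<phi> = restrict (tauT \<phi>) sym_algebra"
    unfolding tau_def
  proof (rule the_equality)
    show "restrict (tauT \<phi>) sym_algebra \<in> extensional sym_algebra \<and>
       unital_algebra_automorphism fscale sym_algebra sym_mult unit (restrict (tauT \<phi>) sym_algebra) \<and>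
       (\<forall>v. restrict (tauT \<phi>) sym_algebra (incl v) = incl v + fscale (\<phi> v) unit)"
      using tauT_automorphism tauT_incl by (simp add: incl_eq)
    fix g assume g: "g \<in> extensional sym_algebra \<and>
       unital_algebra_automorphism fscale sym_algebra sym_mult unit g \<and>
       (\<forall>v. g (incl v) = incl v + fscale (\<phi> v) unit)"
    then have add: "g (a + b) = g a + g b" and scale: "g (fscale c a) = fscale c (g a)"
      and mult: "g (sym_mult a b) = sym_mult (g a) (g b)" and unit: "g unit = unit"
      if "a \<in> sym_algebra" "b \<in> sym_algebra" for a b c
      using that by (auto simp: unital_algebra_automorphism_def)
    have gE: "g (E vs) = tauT \<phi> (E vs)" for vs
    proof (induction vs)
      case Nil
      show ?case using unit[of 0 0] tauT_automorphism by (simp add: unital_algebra_automorphism_def unit_eq)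
    next
      case (Cons v vs)
      have E: "E (v # vs) = sym_mult (incl v) (E vs)" by (simp add: incl_eq E_sym_mult_E)
      have "g (E (v # vs)) = sym_mult (g (incl v)) (g (E vs))"
        unfolding E by (rule mult) (simp_all add: incl_eq)
      also have "\<dots> = sym_mult (tauT \<phi> (incl v)) (tauT \<phi> (E vs))"
        using g Cons tauT_incl by simp
      also have "\<dots> = tauT \<phi> (E (v # vs))"
        unfolding E by (rule tauT_mult[symmetric]) (simp_all add: incl_eq)
      finally show ?case .
    qed
    have "g a = tauT \<phi> a" if "a \<in> sym_algebra" for a
      using that
    proof (induction rule: S_induct)
      case zero
      show ?case using scale[of 0 0 0] by (simp add: tauT_0)
    next
      case (step c vs s)
      then show ?case by (simp add: add scale[of _ 0] gE tauT_add tauT_scale)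
    qed
    then show "g = restrict (tauT \<phi>) sym_algebra"
      using g by (intro extensionalityI[of g sym_algebra]) auto
  qed
  then show ?thesis using assms by simp
qed

lemma derv_pow_S: "a \<in> sym_algebra \<Longrightarrow> (derv \<phi> ^^ k) a \<in> sym_algebra"
  by (induction k) (auto intro: derv_S[OF phi])

text \<open>Local nilpotency in the form that is needed later: from the degree bound of
  \<open>a\<close> on, the partial sums are constant and equal to the translation.\<close>

lemma tauT_exp:
  assumes a: "a \<in> sym_algebra"
  shows "\<exists>N0. \<forall>N\<ge>N0. (\<Sum>k<N. fscale (1 / fact k) ((derv \<phi> ^^ k) a)) = tauT \<phi> a"
proof -
  note aT = S_T[OF a]
  obtain N0 where N0: "\<And>h. multilinear h \<Longrightarrow> (\<forall>vs. length vs < N0 \<longrightarrow> h vs = 0) \<Longrightarrow> a h = 0"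
    using T_bound[OF aT] by blast
  have "(\<Sum>k<N. fscale (1 / fact k) ((derv \<phi> ^^ k) a)) = tauT \<phi> a" if "N \<ge> N0" for N
  proof (rule S_eqI)
    fix f assume f: "graded_symmetric f"
    have P: "graded_symmetric ((contr False \<phi> ^^ k) f)" for k
      by (induction k) (auto simp: f contr_gs[OF _ phi])
    have D: "(derv \<phi> ^^ k) a g = a ((contr False \<phi> ^^ k) g)" if "graded_symmetric g" for g k
      using that
    proof (induction k arbitrary: g)
      case (Suc k)
      have "(derv \<phi> ^^ Suc k) a g = (derv \<phi> ^^ k) a (contr False \<phi> g)"
        by (simp add: derv_gs[OF Suc.prems])
      also have "\<dots> = a ((contr False \<phi> ^^ k) (contr False \<phi> g))"
        by (rule Suc.IH[OF contr_gs[OF Suc.prems phi]])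
      finally show ?case by (simp only: funpow_Suc_right comp_apply)
    qed simp
    let ?G = "\<lambda>vs. \<Sum>k<N. 1 / fact k * (contr False \<phi> ^^ k) f vs"
    note mP = gs_ml[OF P] and mt = gs_ml[OF tf_gs[OF phi f]]
    have mG: "multilinear ?G" by (intro ml_sum ml_times mP)
    have "a (\<lambda>vs. tf \<phi> f vs + (-1) * ?G vs) = 0"
    proof (rule N0)
      show "multilinear (\<lambda>vs. tf \<phi> f vs + (-1) * ?G vs)"
        by (intro ml_plus ml_times mt mG)
      show "\<forall>vs. length vs < N0 \<longrightarrow> tf \<phi> f vs + (-1) * ?G vs = 0"
      proof (intro allI impI)
        fix vs :: "'v list" assume "length vs < N0"
        then have "tf \<phi> f vs = ?G vs"
          using tf_exp[of vs "N - 1" \<phi> f] that by (cases N) (auto simp: lessThan_Suc_atMost)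
        then show "tf \<phi> f vs + (-1) * ?G vs = 0" by simp
      qed
    qed
    then have "a (tf \<phi> f) + (-1) * a ?G = 0"
      by (simp only: T_form_plus[OF aT mt ml_times[OF mG]] T_form_times[OF aT mG])
    moreover have "a ?G = (\<Sum>k<N. 1 / fact k * a ((contr False \<phi> ^^ k) f))"
      by (simp only: T_form_sum[OF aT ml_times[OF mP]] T_form_times[OF aT mP])
    ultimately show "(\<Sum>k<N. fscale (1 / fact k) ((derv \<phi> ^^ k) a)) f = tauT \<phi> a f"
      by (simp add: fun_arith_apply D f tauT_gs)
  qed (auto simp: derv_pow_S a tauT_S[OF phi])
  then show ?thesis by blast
qed

end

subsection \<open>Star powers of an even vector\<close>

lemma contr_replicate: "contr False l f (replicate m w) = of_nat m * l w * f (replicate (m - 1) w)"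
proof (induction m arbitrary: f)
  case (Suc m)
  show ?case
    unfolding replicate_Suc contr.simps Suc by (cases m) (simp_all add: algebra_simps)
qed simp

text \<open>The three-term recursion of Hermite polynomials: star multiplication by \<open>w\<close>
  raises the power, or contracts one of the \<open>m\<close> equal factors. For \<open>m = 0\<close>
  the factor \<open>of_nat m\<close> removes the second term.\<close>

lemma star_replicate:
  assumes "w \<in> V0"
  shows "star \<Lambda> z (E [w]) (E (replicate m w)) =
    E (replicate (Suc m) w) + fscale (z * \<Lambda> w w * of_nat m) (E (replicate (m - 1) w))"
proof (rule S_eqI)
  fix f assume f: "graded_symmetric f"
  have "star \<Lambda> z (E [w]) (E (replicate m w)) f =
     f (w # replicate m w) + z * (\<Sum>e\<in>UNIV. contr e (Lam e w) f (replicate m w))"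
    by (simp add: star_single_gs[OF S_E f] E_gs_apply[OF single_gs[OF f]])
  then show "star \<Lambda> z (E [w]) (E (replicate m w)) f =
    (E (replicate (Suc m) w) + fscale (z * \<Lambda> w w * of_nat m) (E (replicate (m - 1) w))) f"
    by (simp add: fun_arith_apply E_gs_apply[OF f] UNIV_bool_sum Lam_even_vector[OF assms] contr_replicate)
qed auto

end

section \<open>Seminorm estimates for words and for the star product\<close>

text \<open>The bracket on the left bounds the \<open>k\<close>-fold contractions together with the
  weight of what remains. Binomial coefficients are at most powers of 2, which replaces n!/(n-k)! by
  k! 2^n, m!/(m-k)! by k! 2^m and (n+m-2k)! by (n-k)! (m-k)! 2^(n+m). One k! cancels against the
  exponential series, the other one is absorbed by the weights as \<open>R\<close> is at least 1/2;
  \<open>R \<le> 1\<close> bounds the leftover power of 2.\<close>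

lemma factorial_weight_bound:
  fixes Z R :: real
  assumes Z: "Z \<ge> 0" and R: "1/2 \<le> R" "R \<le> 1" and k: "k \<le> n" "k \<le> m"
  shows "Z ^ k / fact k * (2 ^ k * (fact n / fact (n - k)) * (fact m / fact (m - k)) * fact (n + m - 2 * k) powr R)
     \<le> (4 * (1 + 2 * Z)) ^ n * 4 ^ m * fact n powr R * fact m powr R"
proof -
  have nk: "(n - k) + (m - k) = n + m - 2 * k" using k by simp
  have ch: "real (n choose k) \<le> 2 ^ n" "real (m choose k) \<le> 2 ^ m" for n m k :: nat
    using binomial_le_pow2[of n k] binomial_le_pow2[of m k]
    by (metis of_nat_le_iff of_nat_numeral of_nat_power)+
  have c: "fact n = fact k * fact (n - k) * real (n choose k)" "fact m = fact k * fact (m - k) * real (m choose k)"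
    using binomial_fact_lemma[OF k(1)] binomial_fact_lemma[OF k(2)]
    by (metis of_nat_fact of_nat_mult)+
  have f1: "fact n / fact (n - k) / fact k \<le> (2::real) ^ n"
    using ch(1)[of n k] unfolding c(1) by simp
  have f2: "fact m / fact (m - k) \<le> fact k * (2::real) ^ m"
    using ch(1)[of m k] unfolding c(2) by simp
  have ge1: "real (n choose k) \<ge> 1" "real (m choose k) \<ge> 1"
    using k by (simp_all add: Suc_leI)
  have le: "fact k * fact (n - k) \<le> (fact n :: real)" "fact k * fact (m - k) \<le> (fact m :: real)"
    unfolding c using mult_left_mono[OF ge1(1), of "fact k * fact (n - k)"] mult_left_mono[OF ge1(2), of "fact k * fact (m - k)"]
    by simp_all
  have c3: "fact (n + m - 2 * k) = fact (n - k) * fact (m - k) * real ((n + m - 2 * k) choose (n - k))"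
    using binomial_fact_lemma[of "n - k" "n + m - 2 * k"] k
    by (metis nk diff_add_inverse le_add1 of_nat_fact of_nat_mult)
  have "real ((n + m - 2 * k) choose (n - k)) \<le> 2 ^ (n + m - 2 * k)" by (rule ch)
  also have "\<dots> \<le> 2 ^ (n + m)" by (rule power_increasing) auto
  finally have c4: "fact (n + m - 2 * k) \<le> fact (n - k) * fact (m - k) * (2::real) ^ (n + m)"
    unfolding c3 by (intro mult_left_mono) auto
  have "fact k * fact (n + m - 2 * k) powr R \<le> (fact k * fact k) powr R * fact (n + m - 2 * k) powr R"
  proof (rule mult_right_mono)
    have "(fact k :: real) powr 1 \<le> fact k powr (2 * R)"
      using R by (intro powr_mono) (auto simp: fact_ge_1)
    also have "\<dots> = (fact k * fact k) powr R"
      by (simp only: mult_2 powr_add powr_mult fact_ge_zero)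
    finally show "fact k \<le> (fact k * fact k :: real) powr R" by simp
  qed simp
  also have "\<dots> = (fact k * fact k * fact (n + m - 2 * k)) powr R"
    by (simp add: powr_mult)
  also have "\<dots> \<le> (fact n * fact m * 2 ^ (n + m)) powr R"
  proof (rule powr_mono2)
    have "fact k * fact k * fact (n + m - 2 * k) \<le> fact k * fact k * (fact (n - k) * fact (m - k) * (2::real) ^ (n + m))"
      using c4 by (intro mult_left_mono) auto
    also have "\<dots> = (fact k * fact (n - k)) * (fact k * fact (m - k)) * 2 ^ (n + m)" by simp
    also have "\<dots> \<le> fact n * fact m * 2 ^ (n + m)"
      using le by (intro mult_right_mono mult_mono) auto
    finally show "fact k * fact k * fact (n + m - 2 * k) \<le> fact n * fact m * (2::real) ^ (n + m)" .
  qed (use R in auto)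
  also have "\<dots> = fact n powr R * fact m powr R * (2 ^ (n + m)) powr R"
    by (simp add: powr_mult)
  also have "\<dots> \<le> fact n powr R * fact m powr R * (2 ^ (n + m)) powr 1"
    using R by (intro mult_left_mono powr_mono) auto
  finally have b: "fact k * fact (n + m - 2 * k) powr R \<le> fact n powr R * fact m powr R * (2 ^ (n + m))"
    by simp
  have "(2 * Z) ^ k \<le> (1 + 2 * Z) ^ k" using Z by (intro power_mono) auto
  also have "\<dots> \<le> (1 + 2 * Z) ^ n" using Z k by (intro power_increasing) auto
  finally have z: "(2 * Z) ^ k \<le> (1 + 2 * Z) ^ n" .
  have "Z ^ k / fact k * (2 ^ k * (fact n / fact (n - k)) * (fact m / fact (m - k)) * fact (n + m - 2 * k) powr R) =
    (2 * Z) ^ k * (fact n / fact (n - k) / fact k) * (fact m / fact (m - k)) * fact (n + m - 2 * k) powr R"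
    by (simp add: power_mult_distrib mult_ac)
  also have "\<dots> \<le> (1 + 2 * Z) ^ n * 2 ^ n * (fact k * 2 ^ m) * fact (n + m - 2 * k) powr R"
    using z f1 f2 Z by (intro mult_right_mono mult_mono) auto
  also have "\<dots> = (1 + 2 * Z) ^ n * 2 ^ n * 2 ^ m * (fact k * fact (n + m - 2 * k) powr R)"
    by simp
  also have "\<dots> \<le> (1 + 2 * Z) ^ n * 2 ^ n * 2 ^ m * (fact n powr R * fact m powr R * (2 ^ (n + m)))"
    using b Z by (intro mult_left_mono) auto
  also have "\<dots> = (4 * (1 + 2 * Z)) ^ n * 4 ^ m * fact n powr R * fact m powr R"
  proof -
    have 4: "(4::real) ^ n = 2 ^ n * 2 ^ n" for n by (simp flip: power_mult_distrib)
    show ?thesis by (simp only: power_mult_distrib power_add 4 mult_ac)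
  qed
  finally show ?thesis .
qed

context graded_lcs
begin

definition pword :: "('v \<Rightarrow> real) \<Rightarrow> 'v list \<Rightarrow> real" where
  "pword p vs = prod_list (map p vs)"

text \<open>What an elementary tensor contributes at most to
  \<open>weyl_seminorm R p\<close>.\<close>

definition weight :: "real \<Rightarrow> ('v \<Rightarrow> real) \<Rightarrow> 'v list \<Rightarrow> real" where
  "weight R p vs = pword p vs * fact (length vs) powr R"

text \<open>
  The weighted seminorms are infima over representations by elementary tensors; \<open>dominated\<close> keeps the
  representation, so estimates for elementary tensors extend to all of them without infima.
\<close>

definition dominated :: "('v list \<Rightarrow> real) \<Rightarrow> (('v list \<Rightarrow> 'k) \<Rightarrow> 'k) \<Rightarrow> real \<Rightarrow> bool" where
  "dominated \<omega> t C \<longleftrightarrow>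
     (\<exists>xs. t = (\<Sum>(c, vs)\<leftarrow>xs. fscale c (tensor vs)) \<and> (\<Sum>(c, vs)\<leftarrow>xs. norm c * \<omega> vs) \<le> C)"

lemma dominated_mono: "dominated \<omega> t C \<Longrightarrow> C \<le> C' \<Longrightarrow> dominated \<omega> t C'"
  unfolding dominated_def by force

lemma dominated_0: "0 \<le> C \<Longrightarrow> dominated \<omega> 0 C"
  unfolding dominated_def by (intro exI[of _ "[]"]) simp

lemma dominated_tensor: "dominated \<omega> (tensor vs) (\<omega> vs)"
  unfolding dominated_def by (intro exI[of _ "[(1, vs)]"]) simp

lemma dominated_add:
  assumes "dominated \<omega> s C" "dominated \<omega> t D"
  shows "dominated \<omega> (s + t) (C + D)"
proof -
  obtain xs ys where "s = (\<Sum>(c, vs)\<leftarrow>xs. fscale c (tensor vs))" "(\<Sum>(c, vs)\<leftarrow>xs. norm c * \<omega> vs) \<le> C"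
    "t = (\<Sum>(c, vs)\<leftarrow>ys. fscale c (tensor vs))" "(\<Sum>(c, vs)\<leftarrow>ys. norm c * \<omega> vs) \<le> D"
    using assms unfolding dominated_def by blast
  then show ?thesis
    unfolding dominated_def by (intro exI[of _ "xs @ ys"]) simp
qed

lemma dominated_scale:
  assumes "dominated \<omega> t D"
  shows "dominated \<omega> (fscale c t) (norm c * D)"
proof -
  obtain xs where xs: "t = (\<Sum>(c, vs)\<leftarrow>xs. fscale c (tensor vs))" "(\<Sum>(c, vs)\<leftarrow>xs. norm c * \<omega> vs) \<le> D"
    using assms unfolding dominated_def by blast
  have "fscale c (\<Sum>(c, vs)\<leftarrow>xs. fscale c (tensor vs)) = (\<Sum>(c, vs)\<leftarrow>map (\<lambda>(d, vs). (c * d, vs)) xs. fscale c (tensor vs))"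
    by (induction xs) (auto simp: fs.scale_right_distrib)
  moreover have "(\<Sum>(c, vs)\<leftarrow>map (\<lambda>(d, vs). (c * d, vs)) xs. norm c * \<omega> vs) = norm c * (\<Sum>(c, vs)\<leftarrow>xs. norm c * \<omega> vs)"
    by (induction xs) (auto simp: norm_mult algebra_simps)
  moreover have "norm c * (\<Sum>(c, vs)\<leftarrow>xs. norm c * \<omega> vs) \<le> norm c * D"
    using xs(2) by (intro mult_left_mono) auto
  ultimately show ?thesis
    unfolding dominated_def xs(1) by metis
qed

lemma dominated_sum:
  assumes "\<And>i. i \<in> A \<Longrightarrow> dominated \<omega> (F i) (C i)"
  shows "dominated \<omega> (\<Sum>i\<in>A. F i) (\<Sum>i\<in>A. C i)"
  using assms by (induction A rule: infinite_finite_induct) (auto simp: dominated_0 dominated_add)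

lemma dominated_T: "dominated \<omega> t C \<Longrightarrow> t \<in> tensor_algebra"
proof -
  have "(\<Sum>(c, vs)\<leftarrow>xs. fscale c (tensor vs)) \<in> tensor_algebra" for xs :: "('k \<times> 'v list) list"
    by (induction xs) auto
  then show "dominated \<omega> t C \<Longrightarrow> t \<in> tensor_algebra" unfolding dominated_def by blast
qed

lemma dominated_weight_mono:
  assumes "dominated \<omega> t C" "\<And>vs. \<omega>' vs \<le> \<omega> vs"
  shows "dominated \<omega>' t C"
proof -
  obtain xs where xs: "t = (\<Sum>(c, vs)\<leftarrow>xs. fscale c (tensor vs))" "(\<Sum>(c, vs)\<leftarrow>xs. norm c * \<omega> vs) \<le> C"
    using assms(1) unfolding dominated_def by blast
  have "(\<Sum>(c, vs)\<leftarrow>xs. norm c * \<omega>' vs) \<le> (\<Sum>(c, vs)\<leftarrow>xs. norm c * \<omega> vs)"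
    by (rule sum_list_mono) (auto intro: mult_left_mono assms(2))
  then show ?thesis unfolding dominated_def using xs by force
qed

lemma seminorm_facts:
  assumes "seminorm scale p"
  shows "p 0 = 0" "p (- v) = p v" "p v \<ge> 0" "p (v + w) \<le> p v + p w" "p (scale c v) = norm c * p v"
proof -
  show s: "p (scale c v) = norm c * p v" "p (v + w) \<le> p v + p w" for c v w
    using assms by (auto simp: seminorm_def)
  show 0: "p 0 = 0" using s(1)[of 0 0] by simp
  show m: "p (- v) = p v" using s(1)[of "-1" v] by simp
  show "p v \<ge> 0" using s(2)[of v "- v"] m 0 by simp
qed

lemma pword_nonneg: "seminorm scale p \<Longrightarrow> pword p vs \<ge> 0"
  unfolding pword_def by (induction vs) (auto simp: seminorm_facts)

lemma weight_nonneg: "seminorm scale p \<Longrightarrow> weight R p vs \<ge> 0"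
  by (simp add: weight_def pword_nonneg)

lemma weight_mono:
  assumes "seminorm scale p" "\<And>v. p v \<le> q v"
  shows "weight R p vs \<le> weight R q vs"
proof -
  have "pword p vs \<le> pword q vs"
    unfolding pword_def
  proof (induction vs)
    case (Cons v vs)
    then show ?case
      using assms seminorm_facts(3)[OF assms(1)] pword_nonneg[OF assms(1), of vs]
      by (auto simp: pword_def intro!: mult_mono intro: order_trans)
  qed simp
  then show ?thesis by (auto simp: weight_def intro: mult_right_mono)
qed

lemma comp_sum_list:
  "comp n (\<Sum>(c, vs)\<leftarrow>xs. fscale c (tensor vs)) = (\<Sum>(c, vs)\<leftarrow>filter (\<lambda>(c, vs). length vs = n) xs. fscale c (tensor vs))"
proof (induction xs)
  case Nil
  show ?case using comp_scale[of n 0 0] by simp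
qed (auto simp: comp_add comp_scale comp_tensor)

lemma proj_seminorm_le:
  assumes p: "seminorm scale p" and xs: "\<forall>(c, vs)\<in>set xs. length vs = n"
  shows "proj_seminorm p n (\<Sum>(c, vs)\<leftarrow>xs. fscale c (tensor vs)) \<le> (\<Sum>(c, vs)\<leftarrow>xs. norm c * pword p vs)"
  unfolding proj_seminorm_def pword_def
proof (rule cInf_lower)
  show "bdd_below {\<Sum>(c, vs)\<leftarrow>ys. norm c * prod_list (map p vs) |ys. (\<forall>(c, vs)\<in>set ys. length vs = n) \<and>
      (\<Sum>(c, vs)\<leftarrow>xs. fscale c (tensor vs)) = (\<Sum>(c, vs)\<leftarrow>ys. fscale c (tensor vs))}"
    using pword_nonneg[OF p] by (intro bdd_belowI[of _ 0]) (auto simp: pword_def intro!: sum_list_nonneg)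
qed (use xs in blast)

lemma weyl_seminorm_le:
  assumes p: "seminorm scale p" and t: "dominated (weight R p) t C"
  shows "weyl_seminorm R p t \<le> C"
proof -
  obtain xs where xs: "t = (\<Sum>(c, vs)\<leftarrow>xs. fscale c (tensor vs))" "(\<Sum>(c, vs)\<leftarrow>xs. norm c * weight R p vs) \<le> C"
    using t unfolding dominated_def by blast
  let ?f = "\<lambda>n. filter (\<lambda>(c, vs). length vs = n) xs"
  let ?L = "(\<lambda>(c, vs). length vs) ` set xs"
  have comp: "component n t = (\<Sum>(c, vs)\<leftarrow>?f n. fscale c (tensor vs))" for n
    unfolding component_eq[OF dominated_T[OF t]] unfolding xs(1) by (rule comp_sum_list)
  have sub: "{n. component n t \<noteq> 0} \<subseteq> ?L"
  proof
    fix n assume "n \<in> {n. component n t \<noteq> 0}"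
    then have "?f n \<noteq> []" unfolding comp by auto
    then obtain x where "x \<in> set (?f n)" by (meson list.set_sel(1))
    then show "n \<in> ?L" by auto
  qed
  have "weyl_seminorm R p t \<le> (\<Sum>n | component n t \<noteq> 0. \<Sum>(c, vs)\<leftarrow>?f n. norm c * weight R p vs)"
    unfolding weyl_seminorm_def
  proof (rule sum_mono)
    fix n
    have "proj_seminorm p n (component n t) * fact n powr R \<le> (\<Sum>(c, vs)\<leftarrow>?f n. norm c * pword p vs) * fact n powr R"
      unfolding comp by (intro mult_right_mono proj_seminorm_le[OF p]) auto
    also have "\<dots> = (\<Sum>(c, vs)\<leftarrow>?f n. norm c * weight R p vs)"
      by (induction xs) (auto simp: weight_def algebra_simps)
    finally show "proj_seminorm p n (component n t) * fact n powr R \<le> (\<Sum>(c, vs)\<leftarrow>?f n. norm c * weight R p vs)" .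
  qed
  also have "\<dots> \<le> (\<Sum>n\<in>?L. \<Sum>(c, vs)\<leftarrow>?f n. norm c * weight R p vs)"
    using sub weight_nonneg[OF p] by (intro sum_mono2) (auto intro!: sum_list_nonneg)
  also have "\<dots> = (\<Sum>(c, vs)\<leftarrow>xs. norm c * weight R p vs)"
  proof -
    have "(\<Sum>n\<in>A. \<Sum>x\<leftarrow>filter (\<lambda>(c, vs). length vs = n) xs. g x) = (\<Sum>x\<leftarrow>xs. g x)"
      if "finite A" "(\<lambda>(c, vs). length vs) ` set xs \<subseteq> A" for A and g :: "'k \<times> 'v list \<Rightarrow> real"
      using that(2)
    proof (induction xs)
      case (Cons x xs)
      obtain c vs where x: "x = (c, vs)" by fastforce
      have "(\<Sum>n\<in>A. \<Sum>x\<leftarrow>filter (\<lambda>(c, vs). length vs = n) (x # xs). g x) =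
         (\<Sum>n\<in>A. (if n = length vs then g x else 0) + (\<Sum>x\<leftarrow>filter (\<lambda>(c, vs). length vs = n) xs. g x))"
        by (rule sum.cong) (auto simp: x)
      then show ?case using Cons that(1) x by (simp add: sum.distrib)
    qed simp
    then show ?thesis by simp
  qed
  finally show ?thesis using xs(2) by simp
qed

lemma tensor_power_expansion:
  assumes "t \<in> tensor_power n"
  shows "\<exists>xs. (\<forall>(c, vs)\<in>set xs. length vs = n) \<and> t = (\<Sum>(c, vs)\<leftarrow>xs. fscale c (tensor vs))"
  using assms unfolding tensor_power_def
proof (induction rule: fs.span_induct_alt)
  case base
  show ?case by (intro exI[of _ "[]"]) simp
next
  case (step c x y)
  then obtain vs xs where "x = tensor vs" "length vs = n" "\<forall>(c, vs)\<in>set xs. length vs = n"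
    "y = (\<Sum>(c, vs)\<leftarrow>xs. fscale c (tensor vs))" by blast
  then show ?case by (intro exI[of _ "(c, vs) # xs"]) auto
qed

lemma proj_seminorm_approx:
  assumes p: "seminorm scale p" and t: "t \<in> tensor_power n"
  shows "proj_seminorm p n t \<ge> 0"
    and "e > 0 \<Longrightarrow> dominated (weight R p) t (proj_seminorm p n t * fact n powr R + e)"
proof -
  let ?S = "{\<Sum>(c, vs)\<leftarrow>xs. norm c * prod_list (map p vs) |xs.
     (\<forall>(c, vs)\<in>set xs. length vs = n) \<and> t = (\<Sum>(c, vs)\<leftarrow>xs. fscale c (tensor vs))}"
  have ne: "?S \<noteq> {}" using tensor_power_expansion[OF t] by blast
  have nn: "0 \<le> x" if "x \<in> ?S" for x
    using that pword_nonneg[OF p] by (auto simp: pword_def intro!: sum_list_nonneg)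
  show "proj_seminorm p n t \<ge> 0"
    unfolding proj_seminorm_def by (rule cInf_greatest[OF ne nn])
  assume e: "e > 0"
  \<comment> \<open>The slack is divided by the weight, so that exactly \<open>e\<close> is left
    after multiplying with it.\<close>
  then have "Inf ?S < proj_seminorm p n t + e / fact n powr R"
    by (simp add: proj_seminorm_def)
  from cInf_lessD[OF ne this] obtain xs where xs: "\<forall>(c, vs)\<in>set xs. length vs = n" "t = (\<Sum>(c, vs)\<leftarrow>xs. fscale c (tensor vs))"
    and lt: "(\<Sum>(c, vs)\<leftarrow>xs. norm c * prod_list (map p vs)) < proj_seminorm p n t + e / fact n powr R"
    by blast
  have "(\<Sum>(c, vs)\<leftarrow>xs. norm c * weight R p vs) = (\<Sum>(c, vs)\<leftarrow>xs. norm c * prod_list (map p vs)) * fact n powr R"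
    using xs(1) by (induction xs) (auto simp: weight_def pword_def algebra_simps)
  also have "\<dots> \<le> (proj_seminorm p n t + e / fact n powr R) * fact n powr R"
    using lt by (intro mult_right_mono) auto
  also have "\<dots> = proj_seminorm p n t * fact n powr R + e"
    by (simp add: algebra_simps)
  finally show "dominated (weight R p) t (proj_seminorm p n t * fact n powr R + e)"
    unfolding dominated_def using xs(2) by blast
qed

lemma weyl_seminorm_nonneg:
  assumes "seminorm scale p" "t \<in> tensor_algebra"
  shows "weyl_seminorm R p t \<ge> 0"
  unfolding weyl_seminorm_def component_eq[OF assms(2)]
  by (intro sum_nonneg mult_nonneg_nonneg proj_seminorm_approx(1)[OF assms(1) comp_tensor_power[OF assms(2)]]) auto

text \<open>The converse of \<open>weyl_seminorm_le\<close>. The infima need not be attained, hence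
  the strict inequality.\<close>

lemma dominated_weyl_seminorm:
  assumes p: "seminorm scale p" and t: "t \<in> tensor_algebra" and C: "weyl_seminorm R p t < C"
  shows "dominated (weight R p) t C"
proof -
  let ?A = "{n. comp n t \<noteq> 0}"
  obtain N where N: "\<And>M. M \<ge> N \<Longrightarrow> comp M t = 0" "t = (\<Sum>n<N. comp n t)"
    using T_decomp[OF t] by blast
  have sub: "?A \<subseteq> {..<N}" using N(1) by (metis (mono_tags) lessThan_iff mem_Collect_eq not_le subsetI)
  then have fin: "finite ?A" by (rule finite_subset) simp
  have t_eq: "t = (\<Sum>n\<in>?A. comp n t)"
    using N(2) sum.mono_neutral_right[OF _ sub, of "\<lambda>n. comp n t"] by simp
  \<comment> \<open>The gap is shared among the nonzero components; the added 1 keeps the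
    denominator positive if there are none.\<close>
  define d where "d = (C - weyl_seminorm R p t) / (real (card ?A) + 1)"
  have d: "d > 0" using C by (simp add: d_def)
  have "dominated (weight R p) (\<Sum>n\<in>?A. comp n t) (\<Sum>n\<in>?A. proj_seminorm p n (comp n t) * fact n powr R + d)"
    by (intro dominated_sum proj_seminorm_approx(2)[OF p comp_tensor_power[OF t] d])
  then have "dominated (weight R p) t (weyl_seminorm R p t + card ?A * d)"
    unfolding t_eq[symmetric] by (simp add: sum.distrib weyl_seminorm_def component_eq[OF t])
  then show ?thesis
  proof (rule dominated_mono)
    have "card ?A * d \<le> (real (card ?A) + 1) * d" using d by simp
    also have "\<dots> = C - weyl_seminorm R p t" by (simp add: d_def)
    finally show "weyl_seminorm R p t + card ?A * d \<le> C" by simp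
  qed
qed

subsection \<open>Graded seminorms\<close>

text \<open>Additivity over the two components makes \<open>gr\<close> isometric and lets words be
  split into homogeneous ones without loss. These seminorms still define the topology, see
  \<open>graded_seminorm_exists\<close>.\<close>

definition graded_seminorm :: "('v \<Rightarrow> real) \<Rightarrow> bool" where
  "graded_seminorm p \<longleftrightarrow> seminorm scale p \<and> (\<forall>v. p v = p (pr False v) + p (pr True v))"

lemma graded_seminormD:
  assumes "graded_seminorm p"
  shows "seminorm scale p" "p v = p (pr False v) + p (pr True v)"
  using assms unfolding graded_seminorm_def by blast+

lemma graded_seminorm_pr:
  assumes "graded_seminorm p"
  shows "p (pr e v) \<le> p v"
proof -
  have "p v = p (pr False v) + p (pr True v)" "p (pr False v) \<ge> 0" "p (pr True v) \<ge> 0"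
    using graded_seminormD[OF assms] seminorm_facts(3) by blast+
  then show ?thesis by (cases e) simp_all
qed

lemma graded_seminorm_gr: "graded_seminorm p \<Longrightarrow> p (gr e v) = p v"
proof (cases e)
  case True
  assume g: "graded_seminorm p"
  note s = graded_seminormD(1)[OF g]
  have "p (gr True v) = p (pr False (gr True v)) + p (pr True (gr True v))"
    by (rule graded_seminormD(2)[OF g])
  also have "\<dots> = p (pr False v) + p (pr True v)"
    by (simp add: pr_gr seminorm_facts(2)[OF s])
  also have "\<dots> = p v" by (rule graded_seminormD(2)[OF g, symmetric])
  finally show ?thesis using True by simp
qed simp

lemma continuous_pr: "continuous_on UNIV (pr e)"
  using continuous_proj0 continuous_proj1 by (simp add: pr_def)

lemma graded_seminorm_exists:
  assumes "cont_seminorm scale p"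
  shows "\<exists>q. cont_seminorm scale q \<and> graded_seminorm q \<and> (\<forall>v. p v \<le> q v)"
proof (intro exI conjI allI)
  let ?q = "\<lambda>v. p (pr False v) + p (pr True v)"
  have s: "seminorm scale p" and c: "continuous_on UNIV p" using assms by (auto simp: cont_seminorm_def)
  note f = seminorm_facts[OF s]
  have "?q (v + w) \<le> ?q v + ?q w" for v w
    using f(4)[of "pr False v" "pr False w"] f(4)[of "pr True v" "pr True w"] by (simp add: pr_add)
  then have q: "seminorm scale ?q"
    unfolding seminorm_def by (simp add: pr_scale f algebra_simps)
  have "continuous_on UNIV (\<lambda>v. p (pr e v))" for e
    using continuous_on_compose2[OF c continuous_pr] by simp
  then show "cont_seminorm scale ?q" using q by (auto simp: cont_seminorm_def intro!: continuous_intros)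
  show "graded_seminorm ?q" using q by (simp add: graded_seminorm_def f)
  show "p v \<le> ?q v" for v using f(4)[of "pr False v" "pr True v"] by (simp add: pr_sum)
qed

lemma pword_append: "pword p (us @ vs) = pword p us * pword p vs"
  by (simp add: pword_def)

lemma pword_Cons [simp]: "pword p (v # vs) = p v * pword p vs"
  by (simp add: pword_def)

lemma pword_map_gr: "graded_seminorm p \<Longrightarrow> pword p (map (gr e) vs) = pword p vs"
  by (induction vs) (auto simp: graded_seminorm_gr pword_def)

end

context graded_lcs_form
begin

text \<open>Symmetrization does not increase the weight: for a homogeneous word it is an average of
  signed permutations of equal weight, and a general word is split into homogeneous ones whose
  weights add up exactly.\<close>

lemma dominated_E:
  assumes p: "graded_seminorm p"
  shows "dominated (weight R p) (E u) (weight R p u)"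
proof -
  note s = graded_seminormD(1)[OF p]
  have hom: "dominated (weight R p) (E u) (weight R p u)" if h: "\<forall>v\<in>set u. homogeneous v" for u
  proof -
    let ?n = "length u" and ?P = "{\<sigma>. \<sigma> permutes {..<length u}}"
    let ?w = "\<lambda>\<sigma>. map (\<lambda>i. u ! \<sigma> i) [0..<?n]"
    have t: "tensor u \<in> tensor_power ?n"
      unfolding tensor_power_def by (auto intro: fs.span_base)
    have "E u = fscale (1 / fact ?n) (\<Sum>\<sigma>\<in>?P. fscale (koszul_sign u \<sigma>) (tensor (?w \<sigma>)))"
      unfolding E_def symmetrizer_deg_eq[OF t, symmetric] symmetrizer_deg_def
      by (intro arg_cong2[where f = fscale] sum.cong refl) (simp add: perm_action_eq[OF _ t] permT_homogeneous h)
    moreover have "dominated (weight R p) (fscale (koszul_sign u \<sigma>) (tensor (?w \<sigma>))) (weight R p u)" if "\<sigma> \<in> ?P" for \<sigma>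
    proof -
      have "pword p (?w \<sigma>) = (\<Prod>i\<in>{..<?n}. p (u ! \<sigma> i))"
        unfolding pword_def by (simp add: prod.list_conv_set_nth lessThan_atLeast0)
      also have "\<dots> = (\<Prod>i\<in>{..<?n}. p (u ! i))"
        using that prod.reindex_bij_betw[OF permutes_imp_bij, of \<sigma> "{..<?n}" "\<lambda>i. p (u ! i)"] by simp
      also have "\<dots> = pword p u"
        unfolding pword_def by (simp add: prod.list_conv_set_nth lessThan_atLeast0)
      finally have "weight R p (?w \<sigma>) = weight R p u" by (simp add: weight_def)
      moreover have "norm (koszul_sign u \<sigma>) = 1" by (simp add: koszul_sign_def norm_power)
      ultimately show ?thesis
        using dominated_scale[OF dominated_tensor, of "weight R p" "koszul_sign u \<sigma>" "?w \<sigma>"] by simp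
    qed
    ultimately have "dominated (weight R p) (E u) (norm (1 / fact ?n :: 'k) * (\<Sum>\<sigma>\<in>?P. weight R p u))"
      by (simp only:) (intro dominated_scale dominated_sum)
    then show ?thesis by (simp add: card_permutations norm_divide)
  qed
  have "dominated (weight R p) (E (us @ vs)) (weight R p (us @ vs))" if "\<forall>v\<in>set us. homogeneous v" for us vs
    using that
  proof (induction vs arbitrary: us)
    case Nil
    then show ?case using hom by simp
  next
    case (Cons v vs)
    have h: "homogeneous (pr e v)" for e
      using pr_in[of e v] by (cases e) (auto simp: homogeneous_def Vpar_def)
    have "E (us @ v # vs) = E ((us @ [pr False v]) @ vs) + E ((us @ [pr True v]) @ vs)"
      using E_slot(1)[of us "pr False v" "pr True v" vs] by (simp add: pr_sum)
    moreover have "weight R p (us @ v # vs) = weight R p ((us @ [pr False v]) @ vs) + weight R p ((us @ [pr True v]) @ vs)"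
    proof -
      have "p v = p (pr False v) + p (pr True v)" by (rule graded_seminormD(2)[OF p])
      then show ?thesis by (simp add: weight_def pword_append algebra_simps)
    qed
    ultimately show ?case
      using dominated_add[OF Cons.IH[of "us @ [pr False v]"] Cons.IH[of "us @ [pr True v]"]] Cons.prems h by simp
  qed
  from this[of "[]"] show ?thesis by simp
qed

text \<open>Reading \<open>contr\<close> at \<open>\<lambda>u. G u f\<close> for fixed words and
  variable \<open>f\<close> turns the transposed operator back into one on tensors. Each of the
  \<open>Suc n\<close> positions costs a value of \<open>l\<close>, bounded by \<open>M\<close>
  times \<open>p\<close>, and leaves a word of length \<open>n\<close>.\<close>

lemma dominated_contr:
  assumes p: "graded_seminorm p" and l: "\<And>v. norm (l v) \<le> M * p v" and M: "0 \<le> M" "0 \<le> K"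
    and G: "\<And>u. length u = n \<Longrightarrow> dominated \<omega> (G u) (K * pword p u)"
    and ws: "length ws = Suc n"
  shows "dominated \<omega> (\<lambda>f. contr e l (\<lambda>u. G u f) ws) (real (Suc n) * M * K * pword p ws)"
  using ws G M(2)
proof (induction ws arbitrary: n G K)
  case (Cons w ws)
  note s = graded_seminormD(1)[OF p]
  have eq: "(\<lambda>f. contr e l (\<lambda>u. G u f) (w # ws)) = fscale (l w) (G ws) + (\<lambda>f. contr e l (\<lambda>u. G (gr e w # u) f) ws)"
    by (simp add: fun_eq_iff fun_arith_apply)
  have "dominated \<omega> (fscale (l w) (G ws)) (norm (l w) * (K * pword p ws))"
    using Cons.prems by (intro dominated_scale) auto
  then have 1: "dominated \<omega> (fscale (l w) (G ws)) (M * p w * (K * pword p ws))"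
    by (rule dominated_mono) (use l Cons.prems pword_nonneg[OF s] in \<open>auto intro!: mult_right_mono\<close>)
  have 2: "dominated \<omega> (\<lambda>f. contr e l (\<lambda>u. G (gr e w # u) f) ws) (real n * M * (K * p w) * pword p ws)"
  proof (cases n)
    case 0
    then have "(\<lambda>f. contr e l (\<lambda>u. G (gr e w # u) f) ws) = 0" using Cons.prems by (simp add: fun_eq_iff zero_fun_apply)
    then show ?thesis using 0 by (simp add: dominated_0)
  next
    case (Suc m)
    have "dominated \<omega> (G (gr e w # u)) (K * p w * pword p u)" if "length u = m" for u
      using Cons.prems(2)[of "gr e w # u"] that Suc by (simp add: graded_seminorm_gr[OF p] mult.assoc)
    then show ?thesis
      using Cons.IH[of m "\<lambda>u. G (gr e w # u)" "K * p w"] Cons.prems Suc seminorm_facts(3)[OF s] by simp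
  qed
  show ?case
    unfolding eq using dominated_add[OF 1 2] by (rule dominated_mono) (simp add: algebra_simps)
qed simp

text \<open>The factor 2 counts the two parities in \<open>Lam_right\<close>; the next two factors
  count the pairs of contracted vectors.\<close>

lemma dominated_Pc:
  assumes p: "graded_seminorm p" and L: "\<And>v w. norm (\<Lambda> v w) \<le> p v * p w" and K: "0 \<le> K"
    and G: "\<And>a b. length a = n \<Longrightarrow> length b = m \<Longrightarrow> dominated \<omega> (G a b) (K * (pword p a * pword p b))"
    and vs: "length vs = Suc n" and ws: "length ws = Suc m"
  shows "dominated \<omega> (\<lambda>f. Pc (\<lambda>a b. G a b f) vs ws) (2 * real (Suc n) * real (Suc m) * K * (pword p vs * pword p ws))"
  using vs G K
proof (induction vs arbitrary: n G K)
  case (Cons v vs)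
  note s = graded_seminormD(1)[OF p]
  have pn: "p v \<ge> 0" for v by (rule seminorm_facts(3)[OF s])
  have eq: "(\<lambda>f. Pc (\<lambda>a b. G a b f) (v # vs) ws) = (\<lambda>f. Pc (\<lambda>a b. G (v # a) b f) vs ws) +
      (\<Sum>e\<in>UNIV. (\<lambda>f. contr e (Lam e v) (\<lambda>b. G (map (gr e) vs) b f) ws))"
    by (simp add: fun_eq_iff fun_arith_apply Lam_right_def contr_right_def)
  have 1: "dominated \<omega> (\<lambda>f. Pc (\<lambda>a b. G (v # a) b f) vs ws) (2 * real n * real (Suc m) * (K * p v) * (pword p vs * pword p ws))"
  proof (cases n)
    case 0
    then have "(\<lambda>f. Pc (\<lambda>a b. G (v # a) b f) vs ws) = 0" using Cons.prems by (simp add: fun_eq_iff zero_fun_apply)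
    then show ?thesis using 0 by (simp add: dominated_0)
  next
    case (Suc k)
    have "dominated \<omega> (G (v # a) b) (K * p v * (pword p a * pword p b))" if "length a = k" "length b = m" for a b
      using Cons.prems(2)[of "v # a" b] that Suc by (simp add: mult.assoc)
    then show ?thesis
      using Cons.IH[of k "\<lambda>a. G (v # a)" "K * p v"] Cons.prems Suc pn by simp
  qed
  have 2: "dominated \<omega> (\<lambda>f. contr e (Lam e v) (\<lambda>b. G (map (gr e) vs) b f) ws) (real (Suc m) * p v * (K * pword p vs) * pword p ws)" for e
  proof (rule dominated_contr[OF p _ pn _ _ ws])
    show "norm (Lam e v w) \<le> p v * p w" for w
      unfolding Lam_def
      by (rule order_trans[OF L]) (intro mult_mono graded_seminorm_pr[OF p] pn)
    show "0 \<le> K * pword p vs" using Cons.prems(3) pword_nonneg[OF s] by simp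
    show "dominated \<omega> (G (map (gr e) vs) u) (K * pword p vs * pword p u)" if "length u = m" for u
      using Cons.prems(2)[of "map (gr e) vs" u] Cons.prems(1) that by (simp add: pword_map_gr[OF p] mult.assoc)
  qed
  have "dominated \<omega> (\<lambda>f. Pc (\<lambda>a b. G a b f) (v # vs) ws)
     (2 * real n * real (Suc m) * (K * p v) * (pword p vs * pword p ws) +
      (\<Sum>e\<in>(UNIV::bool set). real (Suc m) * p v * (K * pword p vs) * pword p ws))"
    unfolding eq by (intro dominated_add 1 dominated_sum 2)
  then show ?case
    by (rule dominated_mono) (simp add: UNIV_bool algebra_simps)
qed simp

text \<open>The quotients of factorials count the ordered choices of \<open>k\<close> vectors in
  each word.\<close>

lemma dominated_Pc_pow:
  assumes p: "graded_seminorm p" and L: "\<And>v w. norm (\<Lambda> v w) \<le> p v * p w" and K: "0 \<le> K"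
    and G: "\<And>a b. length a = n \<Longrightarrow> length b = m \<Longrightarrow> dominated \<omega> (G a b) (K * (pword p a * pword p b))"
    and vs: "length vs = n + k" and ws: "length ws = m + k"
  shows "dominated \<omega> (\<lambda>f. (Pc ^^ k) (\<lambda>a b. G a b f) vs ws)
     (2 ^ k * (fact (n + k) / fact n) * (fact (m + k) / fact m) * K * (pword p vs * pword p ws))"
  using vs ws
proof (induction k arbitrary: vs ws)
  case 0
  then show ?case using G by simp
next
  case (Suc k)
  let ?K = "2 ^ k * (fact (n + k) / fact n) * (fact (m + k) / fact m) * K"
  have X: "dominated \<omega> (\<lambda>f. Pc (\<lambda>a b. (Pc ^^ k) (\<lambda>a b. G a b f) a b) vs ws)
     (2 * real (Suc (n + k)) * real (Suc (m + k)) * ?K * (pword p vs * pword p ws))"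
  proof (rule dominated_Pc[OF p L])
    show "0 \<le> ?K" using K by simp
    show "dominated \<omega> (\<lambda>f. (Pc ^^ k) (\<lambda>a b. G a b f) a b) (?K * (pword p a * pword p b))"
      if "length a = n + k" "length b = m + k" for a b
      using Suc.IH[OF that] by (simp add: mult.assoc)
  qed (use Suc.prems in auto)
  have eq: "2 * real (Suc (n + k)) * real (Suc (m + k)) * ?K =
      2 ^ Suc k * (fact (n + Suc k) / fact n) * (fact (m + Suc k) / fact m) * K"
    by (simp only: add_Suc_right fact_Suc power_Suc divide_inverse mult_ac)
  show ?case using X unfolding eq funpow.simps comp_apply .
qed

lemma weight_scaled: "weight R (\<lambda>v. D * p v) vs = D ^ length vs * weight R p vs"
proof -
  have "pword (\<lambda>v. D * p v) vs = D ^ length vs * pword p vs"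
    by (induction vs) (auto simp: pword_def)
  then show ?thesis by (simp add: weight_def)
qed

text \<open>Scaling \<open>p\<close> by a constant multiplies the weight of a word by a power of it,
  which absorbs geometric factors. The constant consists of 4 (1 + 2 |z|) from
  \<open>factorial_weight_bound\<close> and of 2 for the number n+1 \<le> 2^n of summands.\<close>

lemma dominated_star_E:
  assumes p: "graded_seminorm p" and L: "\<And>v w. norm (\<Lambda> v w) \<le> p v * p w" and R: "1/2 \<le> R" "R \<le> 1"
  defines "q \<equiv> \<lambda>v. 8 * (1 + 2 * norm z) * p v"
  shows "dominated (weight R p) (star \<Lambda> z (E vs) (E ws)) (weight R q vs * weight R q ws)"
proof -
  let ?n = "length vs" and ?m = "length ws" and ?D = "1 + 2 * norm z"
  note s = graded_seminormD(1)[OF p]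
  let ?F = "\<lambda>k. (\<lambda>f. (Pc ^^ k) (\<lambda>a b. E (a @ b) f) vs ws)"
  let ?C = "(4 * ?D) ^ ?n * 4 ^ ?m * (weight R p vs * weight R p ws)"
  have C: "?C \<ge> 0" using weight_nonneg[OF s] by simp
  have "star \<Lambda> z (E vs) (E ws) f = SF (\<lambda>u. E u f) vs ws" for f
    using pairing_E[OF SF_bi_gs[OF E_gs]] by (simp add: star_apply pairing_def)
  then have eq: "star \<Lambda> z (E vs) (E ws) = (\<Sum>k\<le>?n. fscale (z ^ k / fact k) (?F k))"
    by (simp add: fun_eq_iff SF_def fun_arith_apply)
  have F: "dominated (weight R p) (fscale (z ^ k / fact k) (?F k)) ?C" if kn: "k \<le> ?n" for k
  proof (cases "k \<le> ?m")
    case False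
    then have "?F k = 0" by (simp add: fun_eq_iff Pc_pow_zero zero_fun_apply)
    then show ?thesis using C by (simp add: dominated_0)
  next
    case True
    let ?K = "fact (?n + ?m - 2 * k) powr R"
    have "dominated (weight R p) (E (a @ b)) (?K * (pword p a * pword p b))"
      if "length a = ?n - k" "length b = ?m - k" for a b
    proof -
      have "length a + length b = ?n + ?m - 2 * k" using that kn True by simp
      then have "weight R p (a @ b) = ?K * (pword p a * pword p b)"
        by (simp add: weight_def pword_append)
      then show ?thesis using dominated_E[OF p, of R "a @ b"] by simp
    qed
    then have "dominated (weight R p) (?F k) (2 ^ k * (fact (?n - k + k) / fact (?n - k)) * (fact (?m - k + k) / fact (?m - k)) * ?K * (pword p vs * pword p ws))"
      using kn True by (intro dominated_Pc_pow[OF p L]) auto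
    then have "dominated (weight R p) (fscale (z ^ k / fact k) (?F k))
      (norm (z ^ k / fact k) * (2 ^ k * (fact ?n / fact (?n - k)) * (fact ?m / fact (?m - k)) * ?K * (pword p vs * pword p ws)))"
      using kn True by (intro dominated_scale) simp
    then show ?thesis
    proof (rule dominated_mono)
      have "norm (z ^ k / fact k) = norm z ^ k / fact k" by (simp add: norm_divide norm_power)
      then have "norm (z ^ k / fact k) * (2 ^ k * (fact ?n / fact (?n - k)) * (fact ?m / fact (?m - k)) * ?K * (pword p vs * pword p ws)) =
         (norm z ^ k / fact k * (2 ^ k * (fact ?n / fact (?n - k)) * (fact ?m / fact (?m - k)) * ?K)) * (pword p vs * pword p ws)"
        by simp
      also have "\<dots> \<le> ((4 * ?D) ^ ?n * 4 ^ ?m * fact ?n powr R * fact ?m powr R) * (pword p vs * pword p ws)"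
        using factorial_weight_bound[OF norm_ge_zero R kn True, of z] pword_nonneg[OF s] by (intro mult_right_mono) auto
      also have "\<dots> = ?C" by (simp add: weight_def)
      finally show "norm (z ^ k / fact k) * (2 ^ k * (fact ?n / fact (?n - k)) * (fact ?m / fact (?m - k)) * ?K * (pword p vs * pword p ws)) \<le> ?C" .
    qed
  qed
  have "dominated (weight R p) (star \<Lambda> z (E vs) (E ws)) (\<Sum>k\<le>?n. ?C)"
    unfolding eq by (rule dominated_sum) (use F in auto)
  then show ?thesis
  proof (rule dominated_mono)
    have "(\<Sum>k\<le>?n. ?C) = real (Suc ?n) * ?C" by simp
    also have "\<dots> \<le> 2 ^ ?n * ?C"
    proof (rule mult_right_mono[OF _ C])
      have "Suc ?n \<le> 2 ^ ?n" by (rule Suc_leI[OF less_exp])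
      then show "real (Suc ?n) \<le> 2 ^ ?n" by (metis of_nat_le_iff of_nat_numeral of_nat_power)
    qed
    also have "\<dots> = (8 * ?D) ^ ?n * 4 ^ ?m * (weight R p vs * weight R p ws)"
    proof -
      have "(8 * ?D) ^ ?n = (2 * (4 * ?D)) ^ ?n" by simp
      then show ?thesis by (simp only: power_mult_distrib mult_ac)
    qed
    also have "\<dots> \<le> (8 * ?D) ^ ?n * (8 * ?D) ^ ?m * (weight R p vs * weight R p ws)"
      using weight_nonneg[OF s] by (intro mult_right_mono mult_left_mono power_mono) auto
    also have "\<dots> = weight R q vs * weight R q ws"
      unfolding q_def weight_scaled by simp
    finally show "(\<Sum>k\<le>?n. ?C) \<le> weight R q vs * weight R q ws" .
  qed
qed

text \<open>Symmetrizing a representation by elementary tensors leaves its coefficients and words as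
  they are.\<close>

lemma dominated_S:
  assumes "dominated \<omega> a A" "a \<in> sym_algebra"
  obtains xs where "a = (\<Sum>(c, vs)\<leftarrow>xs. fscale c (E vs))" "(\<Sum>(c, vs)\<leftarrow>xs. norm c * \<omega> vs) \<le> A"
proof -
  obtain xs where xs: "a = (\<Sum>(c, vs)\<leftarrow>xs. fscale c (tensor vs))" "(\<Sum>(c, vs)\<leftarrow>xs. norm c * \<omega> vs) \<le> A"
    using assms(1) unfolding dominated_def by blast
  have "symT (\<Sum>(c, vs)\<leftarrow>xs. fscale c (tensor vs)) = (\<Sum>(c, vs)\<leftarrow>xs. fscale c (E vs))"
    by (induction xs) (auto simp: symT_add symT_scale E_def)
  then have "a = (\<Sum>(c, vs)\<leftarrow>xs. fscale c (E vs))"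
    using symT_id[OF assms(2)] xs(1) by simp
  then show thesis using xs(2) that by blast
qed

lemma dominated_star:
  assumes p: "graded_seminorm p" and L: "\<And>v w. norm (\<Lambda> v w) \<le> p v * p w" and R: "1/2 \<le> R" "R \<le> 1"
    and a: "a \<in> sym_algebra" "dominated (weight R (\<lambda>v. 8 * (1 + 2 * norm z) * p v)) a A"
    and b: "b \<in> sym_algebra" "dominated (weight R (\<lambda>v. 8 * (1 + 2 * norm z) * p v)) b B"
  shows "dominated (weight R p) (star \<Lambda> z a b) (A * B)"
proof -
  let ?w = "weight R (\<lambda>v. 8 * (1 + 2 * norm z) * p v)"
  have w: "?w vs \<ge> 0" for vs
    unfolding weight_scaled using weight_nonneg[OF graded_seminormD(1)[OF p]] by simp
  have S: "(\<Sum>(c, vs)\<leftarrow>xs. fscale c (E vs)) \<in> sym_algebra" for xs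
    by (induction xs) auto
  obtain xs where xs: "a = (\<Sum>(c, vs)\<leftarrow>xs. fscale c (E vs))" "(\<Sum>(c, vs)\<leftarrow>xs. norm c * ?w vs) \<le> A"
    using dominated_S[OF a(2,1)] .
  obtain ys where ys: "b = (\<Sum>(c, vs)\<leftarrow>ys. fscale c (E vs))" "(\<Sum>(c, vs)\<leftarrow>ys. norm c * ?w vs) \<le> B"
    using dominated_S[OF b(2,1)] .
  have 1: "dominated (weight R p) (star \<Lambda> z (E vs) (\<Sum>(c, vs)\<leftarrow>ys. fscale c (E vs))) (?w vs * (\<Sum>(c, vs)\<leftarrow>ys. norm c * ?w vs))" for vs
  proof (induction ys)
    case (Cons y ys)
    obtain c ws where y: "y = (c, ws)" by fastforce
    show ?case
      using dominated_add[OF dominated_scale[OF dominated_star_E[OF p L R], of c] Cons.IH, of vs ws] S[of ys]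
      by (simp add: y star_add_right star_scale_right distrib_left mult.left_commute)
  qed (simp add: star_0_right dominated_0)
  have 2: "dominated (weight R p) (star \<Lambda> z (\<Sum>(c, vs)\<leftarrow>xs. fscale c (E vs)) b) ((\<Sum>(c, vs)\<leftarrow>xs. norm c * ?w vs) * (\<Sum>(c, vs)\<leftarrow>ys. norm c * ?w vs))"
  proof (induction xs)
    case (Cons x xs)
    obtain c vs where x: "x = (c, vs)" by fastforce
    show ?case
      using dominated_add[OF dominated_scale[OF 1, of c] Cons.IH, of vs] S[of xs] b(1)
      by (simp add: x star_add_left star_scale_left distrib_right mult.assoc ys(1)[symmetric])
  qed (simp add: star_0_left b dominated_0)
  have "(\<Sum>(c, vs)\<leftarrow>xs. norm c * ?w vs) * (\<Sum>(c, vs)\<leftarrow>ys. norm c * ?w vs) \<le> A * B"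
    using xs(2) ys(2) w by (intro mult_mono order_trans[OF sum_list_nonneg xs(2)] sum_list_nonneg) auto
  then show ?thesis using 2 dominated_mono by (simp add: xs(1)[symmetric])
qed

text \<open>Continuity at the origin gives |\<Lambda>| < 1 on a product of unit balls, and scaling
  gives the bound s t for all s > p(v) and t > p(w). Letting both decrease also settles vectors on
  which the seminorm vanishes.\<close>

lemma Lambda_seminorm:
  "\<exists>p. cont_seminorm scale p \<and> (\<forall>v w. norm (\<Lambda> v w) \<le> p v * p w)"
proof -
  have "open ((\<lambda>(v, w). \<Lambda> v w) -` ball 0 1)"
    using Lambda_bilinear by (auto simp: continuous_bilinear_form_def intro!: open_vimage)
  moreover have "(0, 0) \<in> (\<lambda>(v, w). \<Lambda> v w) -` ball 0 1"
    by (simp add: lin_form_0[OF Lambda_lin(1)])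
  ultimately obtain U W where UW: "open U" "open W" "0 \<in> U" "0 \<in> W" "U \<times> W \<subseteq> (\<lambda>(v, w). \<Lambda> v w) -` ball 0 1"
    by (metis open_prod_def mem_Sigma_iff)
  obtain p1 p2 where p: "cont_seminorm scale p1" "{v. p1 v < 1} \<subseteq> U" "cont_seminorm scale p2" "{v. p2 v < 1} \<subseteq> W"
    using locally_convex[OF UW(1,3)] locally_convex[OF UW(2,4)] by blast
  let ?p = "\<lambda>v. p1 v + p2 v"
  have s: "seminorm scale p1" "seminorm scale p2" using p by (auto simp: cont_seminorm_def)
  note f1 = seminorm_facts[OF s(1)] and f2 = seminorm_facts[OF s(2)]
  have "p1 (v + w) + p2 (v + w) \<le> (p1 v + p2 v) + (p1 w + p2 w)" for v w
    using f1(4)[of v w] f2(4)[of v w] by simp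
  then have c: "cont_seminorm scale ?p"
    using p by (auto simp: cont_seminorm_def seminorm_def f1 f2 algebra_simps intro!: continuous_intros)
  then have sp: "seminorm scale ?p" by (simp add: cont_seminorm_def)
  note f = seminorm_facts[OF sp]
  have small: "norm (\<Lambda> v w) < 1" if "?p v < 1" "?p w < 1" for v w
  proof -
    have "p1 v < 1" "p2 w < 1" using that f2(3)[of v] f1(3)[of w] by auto
    then have "(v, w) \<in> U \<times> W" using p(2,4) by auto
    then have "(v, w) \<in> (\<lambda>(v, w). \<Lambda> v w) -` ball 0 1" using UW(5) by blast
    then show ?thesis by simp
  qed
  have scaled: "norm (\<Lambda> v w) \<le> s * t" if "?p v < s" "?p w < t" for v w s t
  proof -
    have pos: "s > 0" "t > 0" using that f(3)[of v] f(3)[of w] by linarith+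
    have sc: "?p (scale (of_real (inverse r)) u) < 1" if "r > 0" "?p u < r" for r u
    proof -
      have "?p (scale (of_real (inverse r)) u) = inverse r * ?p u"
        using f(5)[of "of_real (inverse r)" u] that(1) by (simp add: norm_inverse)
      also have "\<dots> < inverse r * r"
        using that by (intro mult_strict_left_mono) auto
      finally show ?thesis using that(1) by simp
    qed
    have "norm (\<Lambda> (scale (of_real (inverse s)) v) (scale (of_real (inverse t)) w)) < 1"
      by (rule small) (use sc that pos in blast)+
    then have "inverse s * inverse t * norm (\<Lambda> v w) < 1"
      using pos by (simp add: lin_form_scale[OF Lambda_lin(1)] lin_form_scale[OF Lambda_lin(2)] norm_mult norm_inverse mult_ac)
    then show ?thesis using pos by (simp add: field_simps)
  qed
  have "norm (\<Lambda> v w) \<le> ?p v * ?p w" for v w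
  proof (rule tendsto_lowerbound)
    show "((\<lambda>e. (?p v + e) * (?p w + e)) \<longlongrightarrow> ?p v * ?p w) (at_right 0)"
      by (auto intro!: tendsto_eq_intros)
    show "\<forall>\<^sub>F e in at_right 0. norm (\<Lambda> v w) \<le> (?p v + e) * (?p w + e)"
      using scaled by (intro eventually_at_rightI[of 0 1]) auto
  qed simp
  then show ?thesis using c by blast
qed

lemma good_seminorm:
  assumes "cont_seminorm scale p0"
  shows "\<exists>p. cont_seminorm scale p \<and> graded_seminorm p \<and> (\<forall>v. p0 v \<le> p v) \<and> (\<forall>v w. norm (\<Lambda> v w) \<le> p v * p w)"
proof -
  obtain l where l: "cont_seminorm scale l" "\<And>v w. norm (\<Lambda> v w) \<le> l v * l w"
    using Lambda_seminorm by blast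
  have s: "seminorm scale p0" "seminorm scale l" using assms l by (auto simp: cont_seminorm_def)
  note f1 = seminorm_facts[OF s(1)] and f2 = seminorm_facts[OF s(2)]
  let ?p = "\<lambda>v. p0 v + l v"
  have "p0 (v + w) + l (v + w) \<le> (p0 v + l v) + (p0 w + l w)" for v w
    using f1(4)[of v w] f2(4)[of v w] by simp
  then have "cont_seminorm scale ?p"
    using assms l(1) by (auto simp: cont_seminorm_def seminorm_def f1 f2 algebra_simps intro!: continuous_intros)
  then obtain q where q: "cont_seminorm scale q" "graded_seminorm q" "\<And>v. ?p v \<le> q v"
    using graded_seminorm_exists by blast
  have "p0 v \<le> q v" "l v \<le> q v" for v using q(3)[of v] f1(3)[of v] f2(3)[of v] by linarith+
  moreover have "norm (\<Lambda> v w) \<le> q v * q w" for v w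
    using order_trans[OF l(2) mult_mono] \<open>\<And>v. l v \<le> q v\<close> f2(3) order_trans[OF f2(3) \<open>\<And>v. l v \<le> q v\<close>] by blast
  ultimately show ?thesis using q by blast
qed

lemma star_continuous:
  assumes "cont_seminorm scale p0" and R: "1/2 \<le> R" "R \<le> 1"
  shows "\<exists>q. cont_seminorm scale q \<and> (\<forall>v. p0 v \<le> q v) \<and> (\<forall>a\<in>sym_algebra. \<forall>b\<in>sym_algebra. \<forall>A B.
    dominated (weight R q) a A \<longrightarrow> dominated (weight R q) b B \<longrightarrow> dominated (weight R p0) (star \<Lambda> z a b) (A * B))"
proof -
  obtain p where p: "cont_seminorm scale p" "graded_seminorm p" "\<And>v. p0 v \<le> p v" "\<And>v w. norm (\<Lambda> v w) \<le> p v * p w"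
    using good_seminorm[OF assms(1)] by blast
  let ?D = "8 * (1 + 2 * norm z)"
  have s: "seminorm scale p" "seminorm scale p0" using p(1) assms(1) by (auto simp: cont_seminorm_def)
  have D: "?D \<ge> 1" by simp
  have "seminorm scale (\<lambda>v. ?D * p v)"
    unfolding seminorm_def using seminorm_facts[OF s(1)] by (simp flip: distrib_left) (simp add: mult_left_mono)
  then have q: "cont_seminorm scale (\<lambda>v. ?D * p v)"
    using p(1) by (auto simp: cont_seminorm_def intro!: continuous_intros)
  have "p0 v \<le> ?D * p v" for v
    using p(3)[of v] mult_right_mono[OF D seminorm_facts(3)[OF s(1), of v]] by simp
  moreover have "dominated (weight R p0) (star \<Lambda> z a b) (A * B)"
    if "a \<in> sym_algebra" "b \<in> sym_algebra" "dominated (weight R (\<lambda>v. ?D * p v)) a A" "dominated (weight R (\<lambda>v. ?D * p v)) b B"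
    for a b A B
    by (rule dominated_weight_mono[OF dominated_star[OF p(2,4) R that(1,3,2,4)] weight_mono[OF s(2) p(3)]])
  ultimately show ?thesis using q by blast
qed

subsection \<open>The exponential series\<close>

definition sym_exp_term :: "'v \<Rightarrow> nat \<Rightarrow> ('v list \<Rightarrow> 'k) \<Rightarrow> 'k" where
  "sym_exp_term w m = fscale (1 / fact m) (E (replicate m w))"

text \<open>
  For even \<open>w\<close> the star exponential is the symmetric exponential times the constant
  \<open>exp (z \<Lambda>(w, w) / 2)\<close>, whose coefficients are those below.
\<close>

definition gauss_coeff :: "'k \<Rightarrow> nat \<Rightarrow> 'k" where
  "gauss_coeff c i = (if even i then (c / 2) ^ (i div 2) / fact (i div 2) else 0)"

definition exp_term :: "'v \<Rightarrow> nat \<Rightarrow> ('v list \<Rightarrow> 'k) \<Rightarrow> 'k" where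
  "exp_term w n = (\<Sum>i\<le>n. fscale (gauss_coeff (z * \<Lambda> w w) i) (sym_exp_term w (n - i)))"

lemma exp_term_S: "exp_term w n \<in> sym_algebra"
  by (simp add: exp_term_def sym_exp_term_def)

text \<open>The differential equation g' = c t g of g(t) = exp(c t^2/2), read on
  coefficients.\<close>

lemma gauss_coeff_rec: "of_nat (Suc (Suc i)) * gauss_coeff c (Suc (Suc i)) = c * gauss_coeff c i"
proof (cases "even i")
  case True
  then obtain k where k: "i = 2 * k" by blast
  have "gauss_coeff c (Suc (Suc i)) = (c / 2) ^ Suc k / fact (Suc k)" "gauss_coeff c i = (c / 2) ^ k / fact k"
    by (simp_all add: gauss_coeff_def k)
  moreover have "of_nat (Suc (Suc i)) = (2 * of_nat (Suc k) :: 'k)" by (simp add: k)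
  moreover have "of_nat (Suc k) \<noteq> (0::'k)" by (rule of_nat_neq_0)
  moreover have "2 * a * ((c / 2) ^ Suc k / (a * F)) = c * ((c / 2) ^ k / F)" if "a \<noteq> 0" for a F :: 'k
    using that by simp
  ultimately show ?thesis by (simp only: fact_Suc)
qed (simp add: gauss_coeff_def)

lemma star_sym_exp_term:
  assumes "w \<in> V0"
  shows "star \<Lambda> z (E [w]) (sym_exp_term w m) = fscale (of_nat (Suc m)) (sym_exp_term w (Suc m)) +
    (if m = 0 then 0 else fscale (z * \<Lambda> w w) (sym_exp_term w (m - 1)))"
proof -
  have n0: "of_nat (Suc m) \<noteq> (0::'k)" "fact m \<noteq> (0::'k)" by (rule of_nat_neq_0) simp
  have "star \<Lambda> z (E [w]) (sym_exp_term w m) = fscale (1 / fact m) (E (replicate (Suc m) w)) +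
     fscale (1 / fact m * (z * \<Lambda> w w * of_nat m)) (E (replicate (m - 1) w))"
    by (simp add: sym_exp_term_def star_scale_right star_replicate[OF assms] fs.scale_right_distrib)
  moreover have "1 / fact m = of_nat (Suc m) * (1 / fact (Suc m) :: 'k)"
    using n0 by (simp add: field_simps del: of_nat_Suc)
  moreover have "1 / fact m * (z * \<Lambda> w w * of_nat m) = z * \<Lambda> w w * (1 / fact (m - 1))" if "m \<noteq> 0"
    using that by (cases m) (simp_all add: field_simps del: of_nat_Suc)
  ultimately show ?thesis by (auto simp: sym_exp_term_def)
qed

text \<open>This recursion characterizes the terms of an exponential. In the \<open>i\<close>-th
  summand the raising part yields the factor n+1-i, and the contraction, through
  \<open>gauss_coeff_rec\<close>, the missing i.\<close>

lemma star_exp_term: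
  assumes w: "w \<in> V0"
  shows "star \<Lambda> z (E [w]) (exp_term w n) = fscale (of_nat (Suc n)) (exp_term w (Suc n))"
proof -
  let ?a = "gauss_coeff (z * \<Lambda> w w)" and ?c = "z * \<Lambda> w w" and ?e = "sym_exp_term w"
  have e: "?e m \<in> sym_algebra" for m by (simp add: sym_exp_term_def)
  have "star \<Lambda> z (E [w]) (exp_term w n) = (\<Sum>i\<le>n. fscale (?a i) (star \<Lambda> z (E [w]) (?e (n - i))))"
    unfolding exp_term_def using e by (simp add: star_sum_right star_scale_right)
  also have "\<dots> = (\<Sum>i\<le>n. fscale (?a i * of_nat (Suc (n - i))) (?e (Suc (n - i))) +
     (if i = n then 0 else fscale (?c * ?a i) (?e (n - i - 1))))"
    by (rule sum.cong) (auto simp: star_sym_exp_term[OF w] fs.scale_right_distrib mult.commute simp del: of_nat_Suc)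
  also have "\<dots> = (\<Sum>i\<le>n. fscale (?a i * of_nat (Suc (n - i))) (?e (Suc (n - i)))) +
     (\<Sum>i\<le>n. if i = n then 0 else fscale (?c * ?a i) (?e (n - i - 1)))"
    by (rule sum.distrib)
  also have "(\<Sum>i\<le>n. fscale (?a i * of_nat (Suc (n - i))) (?e (Suc (n - i)))) =
     (\<Sum>i\<le>Suc n. fscale (?a i * of_nat (Suc n - i)) (?e (Suc n - i)))"
    by (simp del: of_nat_Suc) (rule sum.cong, auto simp: Suc_diff_le)
  also have "(\<Sum>i\<le>n. if i = n then 0 else fscale (?c * ?a i) (?e (n - i - 1))) =
     (\<Sum>i<n. fscale (?c * ?a i) (?e (n - i - 1)))"
    by (simp flip: lessThan_Suc_atMost)
  also have "\<dots> = (\<Sum>i<n. fscale (of_nat (Suc (Suc i)) * ?a (Suc (Suc i))) (?e (Suc n - Suc (Suc i))))"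
    by (simp only: gauss_coeff_rec) simp
  \<comment> \<open>Shift by two: the summands for \<open>i = 0\<close> and \<open>i = 1\<close> are
    added, the first being 0 by its factor and the second because odd coefficients vanish.\<close>
  also have "\<dots> = (\<Sum>i\<le>Suc n. fscale (of_nat i * ?a i) (?e (Suc n - i)))"
  proof -
    have "?a (Suc 0) = 0" by (simp add: gauss_coeff_def)
    then show ?thesis
      unfolding lessThan_Suc_atMost[symmetric] sum.lessThan_Suc_shift by simp
  qed
  also have "(\<Sum>i\<le>Suc n. fscale (?a i * of_nat (Suc n - i)) (?e (Suc n - i))) + \<dots> =
     (\<Sum>i\<le>Suc n. fscale (of_nat (Suc n)) (fscale (?a i) (?e (Suc n - i))))"
    unfolding sum.distrib[symmetric]
  proof (rule sum.cong)
    fix i assume "i \<in> {..Suc n}"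
    then have "of_nat (Suc n - i) + of_nat i = (of_nat (Suc n) :: 'k)"
      by (simp flip: of_nat_add)
    then have "?a i * of_nat (Suc n - i) + of_nat i * ?a i = of_nat (Suc n) * ?a i"
      by (metis distrib_left mult.commute)
    then show "fscale (?a i * of_nat (Suc n - i)) (?e (Suc n - i)) + fscale (of_nat i * ?a i) (?e (Suc n - i)) =
       fscale (of_nat (Suc n)) (fscale (?a i) (?e (Suc n - i)))"
      by (simp only: fs.scale_left_distrib[symmetric] fs.scale_scale)
  qed simp
  finally show ?thesis by (simp only: exp_term_def fs.scale_sum_right)
qed

lemma star_power_exp_term:
  assumes w: "w \<in> V0"
  shows "fscale (1 / fact n) (star_power \<Lambda> z (incl w) n) = exp_term w n" "star_power \<Lambda> z (incl w) n \<in> sym_algebra"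
proof -
  have "star_power \<Lambda> z (incl w) n = fscale (fact n) (exp_term w n)"
  proof (induction n)
    case 0
    show ?case by (simp add: star_power_def exp_term_def gauss_coeff_def sym_exp_term_def unit_eq)
  next
    case (Suc n)
    have "star_power \<Lambda> z (incl w) (Suc n) = star \<Lambda> z (E [w]) (fscale (fact n) (exp_term w n))"
      using Suc by (simp add: star_power_def incl_eq)
    also have "\<dots> = fscale (fact n) (fscale (of_nat (Suc n)) (exp_term w (Suc n)))"
      by (simp add: star_scale_right exp_term_S star_exp_term[OF w] del: of_nat_Suc)
    finally show ?case by (simp add: mult.commute del: of_nat_Suc)
  qed
  then show "fscale (1 / fact n) (star_power \<Lambda> z (incl w) n) = exp_term w n" "star_power \<Lambda> z (incl w) n \<in> sym_algebra"
    by (simp_all add: exp_term_S)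
qed

text \<open>Up to sign the ratio of consecutive terms is |y| (n+1)^(R-1), which tends to 0.\<close>

lemma summable_power_fact_powr:
  fixes y R :: real
  assumes "R < 1"
  shows "summable (\<lambda>m. y ^ m / fact m * fact m powr R)"
proof (cases "y = 0")
  case True
  have "(\<lambda>m. y ^ m / fact m * fact m powr R) = (\<lambda>m. if m = 0 then 1 else 0)"
    using True by (auto simp: fun_eq_iff)
  then show ?thesis by simp
next
  case False
  have lim: "(\<lambda>n. \<bar>y\<bar> * real (Suc n) powr (R - 1)) \<longlonglongrightarrow> 0"
  proof -
    have "(\<lambda>n. real (Suc n) powr (R - 1)) \<longlonglongrightarrow> 0"
      using assms by (intro tendsto_neg_powr filterlim_compose[OF filterlim_real_sequentially filterlim_Suc]) auto
    then show ?thesis using tendsto_mult_right_zero by blast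
  qed
  then obtain N where N: "\<And>n. n \<ge> N \<Longrightarrow> \<bar>y\<bar> * real (Suc n) powr (R - 1) < 1/2"
    using order_tendstoD(2)[OF lim, of "1/2"] by (auto simp: eventually_sequentially)
  show ?thesis
  proof (rule summable_ratio_test[of "1/2" N])
    fix n assume n: "N \<le> n"
    have "\<bar>y ^ Suc n / fact (Suc n) * fact (Suc n) powr R\<bar> =
       (\<bar>y\<bar> * (real (Suc n) powr R / real (Suc n))) * \<bar>y ^ n / fact n * fact n powr R\<bar>"
      by (simp add: abs_mult power_abs powr_mult field_simps del: of_nat_Suc)
    also have "real (Suc n) powr R / real (Suc n) = real (Suc n) powr (R - 1)"
      by (simp add: powr_diff)
    also have "\<bar>y\<bar> * real (Suc n) powr (R - 1) * \<bar>y ^ n / fact n * fact n powr R\<bar> \<le> 1/2 * \<bar>y ^ n / fact n * fact n powr R\<bar>"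
      using N[OF n] by (intro mult_right_mono) auto
    finally show "norm (y ^ Suc n / fact (Suc n) * fact (Suc n) powr R) \<le> 1/2 * norm (y ^ n / fact n * fact n powr R)"
      by simp
  qed simp
qed

text \<open>The bound is the Cauchy product of the Gaussian series with the series of the symmetric
  exponential. Symmetric powers of \<open>w\<close> have weight at most p(w)^m (m!)^R, with one and
  the same seminorm for all \<open>m\<close>.\<close>

lemma exp_term_dominated:
  assumes p0: "cont_seminorm scale p0" and R: "R < 1"
  shows "\<exists>\<gamma>. summable \<gamma> \<and> (\<forall>n. \<gamma> n \<ge> 0 \<and> dominated (weight R p0) (exp_term w n) (\<gamma> n))"
proof -
  obtain p where p: "cont_seminorm scale p" "graded_seminorm p" "\<And>v. p0 v \<le> p v"
    using graded_seminorm_exists[OF p0] by blast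
  have s: "seminorm scale p" "seminorm scale p0" using p(1) p0 by (auto simp: cont_seminorm_def)
  define \<beta> where "\<beta> m = p w ^ m / fact m * fact m powr R" for m
  let ?a = "\<lambda>i. norm (gauss_coeff (z * \<Lambda> w w) i)"
  have \<beta>: "\<beta> m \<ge> 0" for m unfolding \<beta>_def using seminorm_facts(3)[OF s(1)] by simp
  have "pword p (replicate m w) = p w ^ m" for m by (induction m) (auto simp: pword_def)
  then have e: "dominated (weight R p) (sym_exp_term w m) (\<beta> m)" for m
    using dominated_scale[OF dominated_E[OF p(2), of R "replicate m w"], of "1 / fact m"]
    by (simp add: sym_exp_term_def \<beta>_def weight_def norm_divide)
  let ?\<gamma> = "\<lambda>n. \<Sum>i\<le>n. ?a i * \<beta> (n - i)"
  have "dominated (weight R p) (exp_term w n) (?\<gamma> n)" for n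
    unfolding exp_term_def by (intro dominated_sum dominated_scale e)
  then have d: "dominated (weight R p0) (exp_term w n) (?\<gamma> n)" for n
    by (rule dominated_weight_mono) (rule weight_mono[OF s(2) p(3)])
  have "summable ?a"
  proof -
    let ?r = "norm (z * \<Lambda> w w / 2)"
    have "summable (\<lambda>k. ?r ^ k / fact k)"
      using summable_exp_generic[of ?r] by (simp add: field_simps)
    then obtain S where S: "(\<lambda>k. ?r ^ k / fact k) sums S" by (auto simp: summable_def)
    have "?a = (\<lambda>n. if even n then ?r ^ (n div 2) / fact (n div 2) else (\<lambda>_. 0) ((n - 1) div 2))"
      by (auto simp: fun_eq_iff gauss_coeff_def norm_divide norm_power norm_mult)
    then show ?thesis using sums_if[OF sums_zero S] by (simp add: sums_summable)
  qed
  moreover have "summable \<beta>" unfolding \<beta>_def by (rule summable_power_fact_powr[OF R])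
  ultimately have "summable ?\<gamma>"
    using \<beta> by (intro summable_Cauchy_product) auto
  moreover have "?\<gamma> n \<ge> 0" for n using \<beta> by (intro sum_nonneg) auto
  ultimately show ?thesis using d by blast
qed

end

section \<open>Cauchy filters, Cauchy products and regularity of topological groups\<close>

text \<open>The uniformity of a topological group is pulled back from the neighbourhoods of 0 along
  differences, so these neighbourhoods suffice as a test.\<close>

lemma cauchy_filterI:
  fixes F :: "'w::uniform_topological_group_add filter"
  assumes "\<And>U. open U \<Longrightarrow> 0 \<in> U \<Longrightarrow> \<exists>P. eventually P F \<and> (\<forall>x y. P x \<longrightarrow> P y \<longrightarrow> y - x \<in> U)"
  shows "cauchy_filter F"
  unfolding cauchy_filter_def le_filter_def
proof (intro allI impI)
  fix Q assume "eventually Q (uniformity :: ('w \<times> 'w) filter)"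
  then obtain Q' where Q': "eventually Q' (nhds (0::'w))" "\<And>x y. Q' (y - x) \<Longrightarrow> Q (x, y)"
    unfolding cauchy_seq_finset_iff_vanishing eventually_filtercomap by fastforce
  then obtain U where U: "open U" "0 \<in> U" "\<And>u. u \<in> U \<Longrightarrow> Q' u"
    unfolding eventually_nhds by blast
  obtain P where P: "eventually P F" "\<And>x y. P x \<Longrightarrow> P y \<Longrightarrow> y - x \<in> U"
    using assms[OF U(1,2)] by blast
  show "eventually Q (F \<times>\<^sub>F F)"
    unfolding eventually_prod_filter
    by (intro exI[of _ P]) (use P U(3) Q'(2) in blast)
qed

text \<open>Compares a product of partial sums with the partial sum of the Cauchy product; what is
  left are the pairs beyond the diagonal.\<close>

lemma square_minus_triangle:
  fixes F :: "nat \<Rightarrow> nat \<Rightarrow> 'a::ab_group_add"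
  shows "(\<Sum>i<N. \<Sum>l<N. F i l) - (\<Sum>k<N. \<Sum>i\<le>k. F i (k - i)) =
    (\<Sum>(i, l)\<in>{(i, l). i < N \<and> l < N \<and> N \<le> i + l}. F i l)"
proof -
  have fin: "finite {(i, l). i < N \<and> l < N \<and> N \<le> i + l}"
    by (rule finite_subset[of _ "{..<N} \<times> {..<N}"]) auto
  have fin': "finite {(i, l). i + l < N}"
    by (rule finite_subset[of _ "{..<N} \<times> {..<N}"]) auto
  have "(\<Sum>i<N. \<Sum>l<N. F i l) = (\<Sum>(i, l)\<in>{..<N} \<times> {..<N}. F i l)"
    by (rule sum.cartesian_product)
  also have "{..<N} \<times> {..<N} = {(i, l). i + l < N} \<union> {(i, l). i < N \<and> l < N \<and> N \<le> i + l}" by auto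
  also have "(\<Sum>(i, l)\<in>\<dots>. F i l) = (\<Sum>(i, l)\<in>{(i, l). i + l < N}. F i l) +
      (\<Sum>(i, l)\<in>{(i, l). i < N \<and> l < N \<and> N \<le> i + l}. F i l)"
    using fin fin' by (intro sum.union_disjoint) auto
  finally show ?thesis by (simp add: sum.triangle_reindex)
qed

text \<open>Regularity of the target is what the extension of a continuous map from a dense subset
  requires. The closure of the neighbourhood x + A misses C, because x + a - b is outside C for all
  a in A and b in B.\<close>

lemma regular_space_topological_group:
  "regular_space (euclidean :: 'w::topological_group_add topology)"
  unfolding regular_space_def
proof (intro allI impI, elim conjE)
  fix C :: "'w set" and x assume C: "closedin euclidean C" and x: "x \<in> topspace euclidean - C"
  have "open ((\<lambda>(a, b). x + (a - b)) -` (- C))"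
    using C by (intro open_vimage) (auto simp: case_prod_unfold intro!: continuous_intros)
  moreover have "(0, 0) \<in> (\<lambda>(a, b). x + (a - b)) -` (- C)" using x by simp
  ultimately obtain A B where AB: "open A" "open B" "0 \<in> A" "0 \<in> B" "A \<times> B \<subseteq> (\<lambda>(a, b). x + (a - b)) -` (- C)"
    by (metis open_prod_def mem_Sigma_iff)
  define V where "V = (\<lambda>y. - x + y) -` A"
  have "continuous_on UNIV (\<lambda>y. - x + y)" by (intro continuous_intros)
  then have V: "open V" "x \<in> V" using AB(1,3) by (auto simp: V_def intro!: open_vimage)
  have "C \<inter> closure V = {}"
  proof (rule ccontr)
    assume "C \<inter> closure V \<noteq> {}"
    then obtain y where y: "y \<in> C" "y \<in> closure V" by blast
    have "continuous_on UNIV (\<lambda>u. - y + u)" by (intro continuous_intros)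
    then have "open ((\<lambda>u. - y + u) -` B)" using AB(2) by (auto intro!: open_vimage)
    moreover have "y \<in> (\<lambda>u. - y + u) -` B" using AB(4) by simp
    ultimately obtain u where u: "u \<in> V" "- y + u \<in> B"
      using y(2) by (metis (no_types, lifting) closure_iff_nhds_not_empty disjoint_iff order_refl vimage_eq)
    then have "x + ((- x + u) - (- y + u)) \<in> - C" using AB(5) by (auto simp: V_def)
    moreover have "x + ((- x + u) - (- y + u)) = y"
      by (metis add.assoc add_minus_cancel diff_conv_add_uminus minus_add minus_add_cancel minus_minus)
    ultimately show False using y(1) by simp
  qed
  then show "\<exists>U V. openin euclidean U \<and> openin euclidean V \<and> x \<in> U \<and> C \<subseteq> V \<and> disjnt U V"
    using V closure_subset[of V] by (intro exI[of _ V] exI[of _ "- closure V"]) (auto simp: disjnt_def)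
qed

section \<open>The topology of the symmetric algebra\<close>

context graded_lcs_form
begin

lemma weyl_seminorm_triangle:
  assumes p: "seminorm scale p" and st: "s \<in> tensor_algebra" "t \<in> tensor_algebra"
  shows "weyl_seminorm R p (s + t) \<le> weyl_seminorm R p s + weyl_seminorm R p t"
proof (rule field_le_epsilon)
  fix e :: real assume e: "e > 0"
  have "dominated (weight R p) (s + t) ((weyl_seminorm R p s + e/2) + (weyl_seminorm R p t + e/2))"
    using e by (intro dominated_add dominated_weyl_seminorm p st) auto
  then show "weyl_seminorm R p (s + t) \<le> weyl_seminorm R p s + weyl_seminorm R p t + e"
    using weyl_seminorm_le[OF p] by fastforce
qed

lemma weyl_seminorm_mono:
  assumes p: "seminorm scale p" "seminorm scale q" "\<And>v. p v \<le> q v" and t: "t \<in> tensor_algebra"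
  shows "weyl_seminorm R p t \<le> weyl_seminorm R q t"
proof (rule field_le_epsilon)
  fix e :: real assume e: "e > 0"
  have "dominated (weight R q) t (weyl_seminorm R q t + e)"
    using e by (intro dominated_weyl_seminorm p t) auto
  then have "dominated (weight R p) t (weyl_seminorm R q t + e)"
    by (rule dominated_weight_mono) (rule weight_mono[OF p(1,3)])
  then show "weyl_seminorm R p t \<le> weyl_seminorm R q t + e"
    by (rule weyl_seminorm_le[OF p(1)])
qed

lemma weyl_seminorm_0:
  assumes "seminorm scale p"
  shows "weyl_seminorm R p 0 = 0"
proof (rule antisym)
  show "weyl_seminorm R p 0 \<le> 0" by (rule weyl_seminorm_le[OF assms dominated_0]) simp
qed (simp add: weyl_seminorm_nonneg assms)

definition weyl_open :: "real \<Rightarrow> (('v list \<Rightarrow> 'k) \<Rightarrow> 'k) set \<Rightarrow> bool" where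
  "weyl_open R U \<longleftrightarrow> U \<subseteq> sym_algebra \<and>
     (\<forall>a\<in>U. \<exists>p e. cont_seminorm scale p \<and> e > 0 \<and> {b \<in> sym_algebra. weyl_seminorm R p (b - a) < e} \<subseteq> U)"

lemma cont_seminorm_add:
  assumes "cont_seminorm scale p" "cont_seminorm scale q"
  shows "cont_seminorm scale (\<lambda>v. p v + q v)"
proof -
  have s: "seminorm scale p" "seminorm scale q" using assms by (auto simp: cont_seminorm_def)
  have "p (v + w) + q (v + w) \<le> (p v + q v) + (p w + q w)" for v w
    using seminorm_facts(4)[OF s(1), of v w] seminorm_facts(4)[OF s(2), of v w] by simp
  then show ?thesis
    using assms by (auto simp: cont_seminorm_def seminorm_def algebra_simps intro!: continuous_intros)
qed

lemma istopology_weyl_open: "istopology (weyl_open R)"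
  unfolding istopology_def
proof (intro conjI allI impI)
  fix U W assume UW: "weyl_open R U" "weyl_open R W"
  show "weyl_open R (U \<inter> W)"
    unfolding weyl_open_def
  proof (intro conjI ballI)
    show "U \<inter> W \<subseteq> sym_algebra" using UW by (auto simp: weyl_open_def)
    fix a assume a: "a \<in> U \<inter> W"
    then obtain p d q e where p: "cont_seminorm scale p" "d > 0" "{b \<in> sym_algebra. weyl_seminorm R p (b - a) < d} \<subseteq> U"
      and q: "cont_seminorm scale q" "e > 0" "{b \<in> sym_algebra. weyl_seminorm R q (b - a) < e} \<subseteq> W"
      using UW unfolding weyl_open_def by blast
    let ?r = "\<lambda>v. p v + q v"
    have r: "cont_seminorm scale ?r" by (rule cont_seminorm_add[OF p(1) q(1)])
    have s: "seminorm scale p" "seminorm scale q" "seminorm scale ?r"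
      using p(1) q(1) r by (auto simp: cont_seminorm_def)
    have aS: "a \<in> sym_algebra" using a UW by (auto simp: weyl_open_def)
    have "weyl_seminorm R p (b - a) \<le> weyl_seminorm R ?r (b - a)" "weyl_seminorm R q (b - a) \<le> weyl_seminorm R ?r (b - a)"
      if "b \<in> sym_algebra" for b
      using that aS seminorm_facts(3)[OF s(1)] seminorm_facts(3)[OF s(2)]
      by (auto intro!: weyl_seminorm_mono s S_T)
    then have "{b \<in> sym_algebra. weyl_seminorm R ?r (b - a) < min d e} \<subseteq> U \<inter> W"
      using p(3) q(3) by (fastforce dest: order_le_less_trans)
    then show "\<exists>p e. cont_seminorm scale p \<and> e > 0 \<and> {b \<in> sym_algebra. weyl_seminorm R p (b - a) < e} \<subseteq> U \<inter> W"
      using r p(2) q(2) by (intro exI[of _ ?r] exI[of _ "min d e"]) auto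
  qed
next
  fix \<K> assume "\<forall>K\<in>\<K>. weyl_open R K"
  then show "weyl_open R (\<Union>\<K>)"
    unfolding weyl_open_def by (meson Sup_least UnionE Union_upper order_trans)
qed

lemma openin_weyl: "openin (weyl_topology R) U \<longleftrightarrow> weyl_open R U"
proof -
  have "weyl_topology R = topology (weyl_open R)"
    by (simp add: weyl_topology_def weyl_open_def[abs_def])
  then show ?thesis by (simp add: topology_inverse'[OF istopology_weyl_open])
qed

lemma topspace_weyl: "topspace (weyl_topology R) = sym_algebra"
proof (rule antisym)
  show "topspace (weyl_topology R) \<subseteq> sym_algebra"
    unfolding topspace_def openin_weyl by (auto simp: weyl_open_def)
  have "cont_seminorm scale (\<lambda>v. 0)" by (simp add: cont_seminorm_def seminorm_def)
  then have "weyl_open R sym_algebra"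
    unfolding weyl_open_def by (metis (no_types, lifting) mem_Collect_eq subsetI zero_less_one order_refl)
  then show "sym_algebra \<subseteq> topspace (weyl_topology R)"
    by (intro openin_subset) (simp add: openin_weyl)
qed

lemma weyl_ball_open:
  assumes p: "cont_seminorm scale p"
  shows "openin (weyl_topology R) {b \<in> sym_algebra. weyl_seminorm R p b < e}"
  unfolding openin_weyl weyl_open_def
proof (intro conjI ballI)
  have s: "seminorm scale p" using p by (simp add: cont_seminorm_def)
  fix a assume a: "a \<in> {b \<in> sym_algebra. weyl_seminorm R p b < e}"
  have "{b \<in> sym_algebra. weyl_seminorm R p (b - a) < e - weyl_seminorm R p a} \<subseteq> {b \<in> sym_algebra. weyl_seminorm R p b < e}"
  proof
    fix b assume b: "b \<in> {b \<in> sym_algebra. weyl_seminorm R p (b - a) < e - weyl_seminorm R p a}"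
    then have "weyl_seminorm R p ((b - a) + a) \<le> weyl_seminorm R p (b - a) + weyl_seminorm R p a"
      using a by (intro weyl_seminorm_triangle s) (auto intro: S_T)
    then show "b \<in> {b \<in> sym_algebra. weyl_seminorm R p b < e}" using b by simp
  qed
  then show "\<exists>p' d. cont_seminorm scale p' \<and> d > 0 \<and>
      {b \<in> sym_algebra. weyl_seminorm R p' (b - a) < d} \<subseteq> {b \<in> sym_algebra. weyl_seminorm R p b < e}"
    using p a by (intro exI[of _ p] exI[of _ "e - weyl_seminorm R p a"]) auto
qed auto

end

section \<open>The star product on the completion\<close>

locale weyl_completion = graded_lcs_form scale V0 V1 \<Lambda> z
  for scale :: "'k::real_normed_field \<Rightarrow> 'v::{t2_space,topological_ab_group_add} \<Rightarrow> 'v" and V0 V1 \<Lambda> z +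
  fixes R :: real
    and scaleW :: "'k \<Rightarrow> 'w \<Rightarrow> 'w::{t2_space,ab_group_add,uniform_topological_group_add}"
    and j :: "(('v list \<Rightarrow> 'k) \<Rightarrow> 'k) \<Rightarrow> 'w"
  assumes completion: "is_completion R scaleW j"
    and R_ge: "1/2 \<le> R" and R_less: "R < 1"
begin

lemma j_add: "a \<in> sym_algebra \<Longrightarrow> b \<in> sym_algebra \<Longrightarrow> j (a + b) = j a + j b"
  and j_scale: "a \<in> sym_algebra \<Longrightarrow> j (fscale c a) = scaleW c (j a)"
  and j_embedding: "embedding_map (weyl_topology R) euclidean j"
  and j_dense: "closure (j ` sym_algebra) = UNIV"
  and W_complete: "complete (UNIV :: 'w set)"
  and scaleW_cont: "continuous_on UNIV (\<lambda>(c, x). scaleW c x)"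
  and W_vector_space: "vector_space scaleW"
  using completion by (auto simp: is_completion_def)

lemma j_0: "j 0 = 0"
  using j_add[of 0 0] by simp

lemma j_diff: "a \<in> sym_algebra \<Longrightarrow> b \<in> sym_algebra \<Longrightarrow> j (a - b) = j a - j b"
  using j_add[of "a - b" b] by (simp add: algebra_simps)

lemma j_sum: "(\<And>i. i \<in> A \<Longrightarrow> F i \<in> sym_algebra) \<Longrightarrow> j (\<Sum>i\<in>A. F i) = (\<Sum>i\<in>A. j (F i))"
  by (induction A rule: infinite_finite_induct) (auto simp: j_0 j_add)

lemma j_inj: "inj_on j sym_algebra"
  using homeomorphic_imp_injective_map[OF j_embedding[unfolded embedding_map_def]]
  by (simp add: topspace_weyl)

lemma j_nhds:
  assumes "open U" "a \<in> sym_algebra" "j a \<in> U"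
  obtains p e where "cont_seminorm scale p" "e > 0" "\<And>b. b \<in> sym_algebra \<Longrightarrow> weyl_seminorm R p (b - a) < e \<Longrightarrow> j b \<in> U"
proof -
  have "continuous_map (weyl_topology R) euclidean j"
    using homeomorphic_imp_continuous_map[OF j_embedding[unfolded embedding_map_def]]
    by (simp add: continuous_map_in_subtopology)
  then have "openin (weyl_topology R) {x \<in> sym_algebra. j x \<in> U}"
    using assms(1) openin_continuous_map_preimage[of "weyl_topology R" euclidean j U] by (simp add: topspace_weyl)
  then obtain p e where "cont_seminorm scale p" "e > 0" "{b \<in> sym_algebra. weyl_seminorm R p (b - a) < e} \<subseteq> {x \<in> sym_algebra. j x \<in> U}"
    unfolding openin_weyl weyl_open_def using assms(2,3) by blast
  then show thesis using that by blast
qed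

text \<open>Here \<open>j\<close> is used as an open map onto its image: a neighbourhood in the
  completion controls a seminorm on the algebra.\<close>

lemma nhds_0_weyl:
  assumes p: "cont_seminorm scale p" and e: "e > 0"
  obtains U where "open U" "0 \<in> U" "\<And>b. b \<in> sym_algebra \<Longrightarrow> j b \<in> U \<Longrightarrow> weyl_seminorm R p b < e"
proof -
  let ?B = "{b \<in> sym_algebra. weyl_seminorm R p b < e}"
  have "openin (subtopology euclidean (j ` sym_algebra)) (j ` ?B)"
    using homeomorphic_imp_open_map[OF j_embedding[unfolded embedding_map_def]] weyl_ball_open[OF p]
    by (simp add: open_map_def topspace_weyl)
  then obtain U where U: "open U" "j ` ?B = j ` sym_algebra \<inter> U"
    by (auto simp: openin_open)
  have "0 \<in> ?B" using e p weyl_seminorm_0 by (simp add: cont_seminorm_def)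
  then have "j 0 \<in> j ` ?B" by (rule imageI)
  then have "0 \<in> U" unfolding U(2) j_0 by simp
  moreover have "weyl_seminorm R p b < e" if "b \<in> sym_algebra" "j b \<in> U" for b
  proof -
    have "j b \<in> j ` ?B" using U(2) that by blast
    then show ?thesis using j_inj that by (auto simp: inj_on_def)
  qed
  ultimately show thesis using U(1) that by blast
qed

text \<open>The seminorms are not extended to the completion. Instead, closeness to a point
  \<open>x\<close> of it is expressed by pairs of algebra elements whose images are near
  \<open>x\<close>.\<close>

lemma nhds_weyl_small:
  assumes q: "cont_seminorm scale q" and d: "d > 0"
  shows "\<exists>A. open A \<and> x \<in> A \<and>
        (\<forall>a\<in>sym_algebra. \<forall>a'\<in>sym_algebra. j a \<in> A \<longrightarrow> j a' \<in> A \<longrightarrow> weyl_seminorm R q (a' - a) < d)"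
proof -
  obtain U where U: "open U" "0 \<in> U" "\<And>b. b \<in> sym_algebra \<Longrightarrow> j b \<in> U \<Longrightarrow> weyl_seminorm R q b < d"
    using nhds_0_weyl[OF q d] by blast
  have "open ((\<lambda>(a :: 'w, b). b - a) -` U)"
    using U(1) by (intro open_vimage) (auto simp: case_prod_unfold intro!: continuous_intros)
  moreover have "(x, x) \<in> (\<lambda>(a, b). b - a) -` U" using U(2) by simp
  ultimately obtain A B where AB: "open A" "open B" "x \<in> A" "x \<in> B" "A \<times> B \<subseteq> (\<lambda>(a, b). b - a) -` U"
    by (metis open_prod_def mem_Sigma_iff)
  show ?thesis
  proof (intro exI[of _ "A \<inter> B"] conjI ballI impI)
    fix a a' assume a: "a \<in> sym_algebra" "a' \<in> sym_algebra" "j a \<in> A \<inter> B" "j a' \<in> A \<inter> B"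
    then have "(j a, j a') \<in> (\<lambda>(a, b). b - a) -` U" using AB(5) by blast
    then have "j (a' - a) \<in> U" using a by (simp add: j_diff)
    then show "weyl_seminorm R q (a' - a) < d" using a by (intro U(3)) auto
  qed (use AB in auto)
qed

text \<open>By density some algebra element has its image near \<open>x\<close>, and all others with
  this property differ from it by less than 1 in the seminorm.\<close>

lemma nhds_weyl_bounded:
  assumes q: "cont_seminorm scale q"
  obtains A M where "open A" "x \<in> A" "M > 0" "\<And>a. a \<in> sym_algebra \<Longrightarrow> j a \<in> A \<Longrightarrow> weyl_seminorm R q a < M"
proof -
  have s: "seminorm scale q" using q by (simp add: cont_seminorm_def)
  obtain A where A: "open A" "x \<in> A"
    "\<And>a a'. a \<in> sym_algebra \<Longrightarrow> a' \<in> sym_algebra \<Longrightarrow> j a \<in> A \<Longrightarrow> j a' \<in> A \<Longrightarrow> weyl_seminorm R q (a' - a) < 1"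
    using nhds_weyl_small[OF q zero_less_one, of x] by blast
  have "x \<in> closure (j ` sym_algebra)" by (simp add: j_dense)
  then obtain a0 where a0: "a0 \<in> sym_algebra" "j a0 \<in> A"
    using A(1,2) unfolding closure_iff_nhds_not_empty by blast
  have "weyl_seminorm R q a < weyl_seminorm R q a0 + 1" if "a \<in> sym_algebra" "j a \<in> A" for a
  proof -
    have "weyl_seminorm R q ((a - a0) + a0) \<le> weyl_seminorm R q (a - a0) + weyl_seminorm R q a0"
      using that a0 by (intro weyl_seminorm_triangle s S_T) auto
    then show ?thesis using A(3)[OF a0(1) that(1) a0(2) that(2)] by simp
  qed
  moreover have "weyl_seminorm R q a0 + 1 > 0"
    using weyl_seminorm_nonneg[OF s S_T[OF a0(1)], of R] by simp
  ultimately show thesis using that A(1,2) by blast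
qed

text \<open>A Cauchy condition near each pair of points: a' b' - a b is split into (a' - a) b' + a
  (b' - b), where the factors that are not differences are bounded locally.\<close>

lemma star_uniform:
  assumes "open U" "0 \<in> U"
  obtains A B where "open A" "x \<in> A" "open B" "y \<in> B"
    "\<And>a a' b b'. a \<in> sym_algebra \<Longrightarrow> a' \<in> sym_algebra \<Longrightarrow> b \<in> sym_algebra \<Longrightarrow> b' \<in> sym_algebra \<Longrightarrow>
      j a \<in> A \<Longrightarrow> j a' \<in> A \<Longrightarrow> j b \<in> B \<Longrightarrow> j b' \<in> B \<Longrightarrow> j (star \<Lambda> z a' b') - j (star \<Lambda> z a b) \<in> U"
proof -
  obtain p e where p: "cont_seminorm scale p" "e > 0" "\<And>b. b \<in> sym_algebra \<Longrightarrow> weyl_seminorm R p (b - 0) < e \<Longrightarrow> j b \<in> U"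
    using j_nhds[OF assms(1), of 0] assms(2) j_0 by auto
  have sp: "seminorm scale p" using p(1) by (simp add: cont_seminorm_def)
  obtain q where q: "cont_seminorm scale q" "\<And>a b A B. a \<in> sym_algebra \<Longrightarrow> b \<in> sym_algebra \<Longrightarrow>
    dominated (weight R q) a A \<Longrightarrow> dominated (weight R q) b B \<Longrightarrow> dominated (weight R p) (star \<Lambda> z a b) (A * B)"
    using star_continuous[OF p(1) R_ge less_imp_le[OF R_less]] by blast
  have sq: "seminorm scale q" using q(1) by (simp add: cont_seminorm_def)
  obtain A1 M1 where A1: "open A1" "x \<in> A1" "M1 > 0" "\<And>a. a \<in> sym_algebra \<Longrightarrow> j a \<in> A1 \<Longrightarrow> weyl_seminorm R q a < M1"
    using nhds_weyl_bounded[OF q(1), where x = x] by blast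
  obtain B1 M2 where B1: "open B1" "y \<in> B1" "M2 > 0" "\<And>a. a \<in> sym_algebra \<Longrightarrow> j a \<in> B1 \<Longrightarrow> weyl_seminorm R q a < M2"
    using nhds_weyl_bounded[OF q(1), where x = y] by blast
  \<comment> \<open>Chosen so that the two error terms d M2 and M1 d add up to e/2.\<close>
  define d where "d = e / (2 * (M1 + M2))"
  have "d * M2 + M1 * d = d * (M1 + M2)" by (simp add: algebra_simps)
  also have "\<dots> = e / 2"
  proof -
    have "e / (2 * S) * S = e / 2" if "S > 0" for S :: real using that by simp
    from this[OF add_pos_pos[OF A1(3) B1(3)]] show ?thesis unfolding d_def .
  qed
  finally have d2: "d * M2 + M1 * d < e" using p(2) by simp
  have d: "d > 0" using p(2) A1(3) B1(3) by (simp add: d_def)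
  obtain A where A: "open A" "x \<in> A"
    "\<And>a a'. a \<in> sym_algebra \<Longrightarrow> a' \<in> sym_algebra \<Longrightarrow> j a \<in> A \<Longrightarrow> j a' \<in> A \<Longrightarrow> weyl_seminorm R q (a' - a) < d"
    using nhds_weyl_small[OF q(1) d, of x] by blast
  obtain B where B: "open B" "y \<in> B"
    "\<And>a a'. a \<in> sym_algebra \<Longrightarrow> a' \<in> sym_algebra \<Longrightarrow> j a \<in> B \<Longrightarrow> j a' \<in> B \<Longrightarrow> weyl_seminorm R q (a' - a) < d"
    using nhds_weyl_small[OF q(1) d, of y] by blast
  have "j (star \<Lambda> z a' b') - j (star \<Lambda> z a b) \<in> U"
    if S: "a \<in> sym_algebra" "a' \<in> sym_algebra" "b \<in> sym_algebra" "b' \<in> sym_algebra"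
      and AB: "j a \<in> A1 \<inter> A" "j a' \<in> A1 \<inter> A" "j b \<in> B1 \<inter> B" "j b' \<in> B1 \<inter> B" for a a' b b'
  proof -
    have eq: "star \<Lambda> z a' b' - star \<Lambda> z a b = star \<Lambda> z (a' - a) b' + star \<Lambda> z a (b' - b)"
      using S by (simp add: star_diff_left star_diff_right)
    have "dominated (weight R p) (star \<Lambda> z (a' - a) b' + star \<Lambda> z a (b' - b)) (d * M2 + M1 * d)"
      using S AB by (intro dominated_add q(2) dominated_weyl_seminorm[OF sq] S_T) (auto intro: A1 B1 A B)
    then have "weyl_seminorm R p (star \<Lambda> z a' b' - star \<Lambda> z a b) \<le> d * M2 + M1 * d"
      unfolding eq by (rule weyl_seminorm_le[OF sp])
    then have "j (star \<Lambda> z a' b' - star \<Lambda> z a b) \<in> U"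
      using S d2 by (intro p(3)) auto
    then show ?thesis using S by (simp add: j_diff)
  qed
  then show thesis
    using that[of "A1 \<inter> A" "B1 \<inter> B"] A1(1,2) B1(1,2) A(1,2) B(1,2) by (simp add: open_Int)
qed

lemma dense_eq:
  fixes f g :: "'w \<Rightarrow> 'w"
  assumes "continuous_on UNIV f" "continuous_on UNIV g" "\<And>a. a \<in> sym_algebra \<Longrightarrow> f (j a) = g (j a)"
  shows "f x = g x"
proof -
  have "closed {x. f x = g x}" by (rule closed_Collect_eq[OF assms(1,2)])
  moreover have "j ` sym_algebra \<subseteq> {x. f x = g x}" using assms(3) by auto
  ultimately have "closure (j ` sym_algebra) \<subseteq> {x. f x = g x}" by (rule closure_minimal[rotated])
  then show ?thesis by (auto simp: j_dense)
qed

text \<open>By the local Cauchy condition and completeness \<open>f\<close> has a limit at every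
  point of the square, also outside the image of \<open>j\<close>; in a regular target these
  pointwise limits form a continuous map.\<close>

lemma star_extension:
  "\<exists>g. continuous_on UNIV (\<lambda>(x, y). g x y) \<and> (\<forall>a\<in>sym_algebra. \<forall>b\<in>sym_algebra. g (j a) (j b) = j (star \<Lambda> z a b))"
proof -
  let ?S = "j ` sym_algebra \<times> j ` sym_algebra"
  define f where "f = (\<lambda>(x, y). j (star \<Lambda> z (inv_into sym_algebra j x) (inv_into sym_algebra j y)))"
  have f: "f (j a, j b) = j (star \<Lambda> z a b)" if "a \<in> sym_algebra" "b \<in> sym_algebra" for a b
    using that by (simp add: f_def inv_into_f_f[OF j_inj])
  have ev: "\<forall>\<^sub>F t' in at t within ?S. t' \<in> ?S \<and> fst t' \<in> A \<and> snd t' \<in> B"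
    if "open A" "fst t \<in> A" "open B" "snd t \<in> B" for t A B
  proof -
    have "\<forall>\<^sub>F t' in nhds t. t' \<in> A \<times> B"
      using that by (intro eventually_nhds_in_open open_Times) (auto simp: mem_Times_iff)
    then show ?thesis unfolding eventually_at_filter by eventually_elim auto
  qed
  have lim: "\<exists>l. (f \<longlongrightarrow> l) (at t within ?S)" for t
  proof (cases "at t within ?S = bot")
    case False
    have "cauchy_filter (filtermap f (at t within ?S))"
    proof (rule cauchy_filterI)
      fix U :: "'w set" assume U: "open U" "0 \<in> U"
      obtain A B where AB: "open A" "fst t \<in> A" "open B" "snd t \<in> B"
        "\<And>a a' b b'. a \<in> sym_algebra \<Longrightarrow> a' \<in> sym_algebra \<Longrightarrow> b \<in> sym_algebra \<Longrightarrow> b' \<in> sym_algebra \<Longrightarrow>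
        j a \<in> A \<Longrightarrow> j a' \<in> A \<Longrightarrow> j b \<in> B \<Longrightarrow> j b' \<in> B \<Longrightarrow> j (star \<Lambda> z a' b') - j (star \<Lambda> z a b) \<in> U"
        using star_uniform[OF U] by metis
      let ?P = "\<lambda>x. \<exists>a\<in>sym_algebra. \<exists>b\<in>sym_algebra. j a \<in> A \<and> j b \<in> B \<and> x = j (star \<Lambda> z a b)"
      have "eventually ?P (filtermap f (at t within ?S))"
        unfolding eventually_filtermap using ev[OF AB(1-4)]
      proof eventually_elim
        case (elim t')
        then obtain a b where "a \<in> sym_algebra" "b \<in> sym_algebra" "t' = (j a, j b)" by auto
        then show ?case using elim by (intro bexI[of _ a] bexI[of _ b]) (simp_all add: f)
      qed
      then show "\<exists>P. eventually P (filtermap f (at t within ?S)) \<and> (\<forall>x y. P x \<longrightarrow> P y \<longrightarrow> y - x \<in> U)"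
        by (intro exI[of _ ?P]) (auto intro: AB(5))
    qed
    then have "\<exists>x\<in>UNIV. filtermap f (at t within ?S) \<le> nhds x"
      using W_complete False unfolding complete_uniform by (auto simp: filtermap_bot_iff)
    then show ?thesis by (auto simp: filterlim_def)
  qed simp
  have cont: "continuous_on ?S f"
    unfolding continuous_on_def
  proof (intro ballI topological_tendstoI)
    fix t V assume t: "t \<in> ?S" and V: "open V" "f t \<in> V"
    obtain a b where ab: "a \<in> sym_algebra" "b \<in> sym_algebra" "t = (j a, j b)" using t by auto
    have U: "open ((\<lambda>u. u + f t) -` V)" "0 \<in> (\<lambda>u. u + f t) -` V"
      using V by (auto intro!: open_vimage continuous_intros)
    obtain A B where AB: "open A" "fst t \<in> A" "open B" "snd t \<in> B"
      "\<And>a a' b b'. a \<in> sym_algebra \<Longrightarrow> a' \<in> sym_algebra \<Longrightarrow> b \<in> sym_algebra \<Longrightarrow> b' \<in> sym_algebra \<Longrightarrow>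
      j a \<in> A \<Longrightarrow> j a' \<in> A \<Longrightarrow> j b \<in> B \<Longrightarrow> j b' \<in> B \<Longrightarrow> j (star \<Lambda> z a' b') - j (star \<Lambda> z a b) \<in> (\<lambda>u. u + f t) -` V"
      using star_uniform[OF U] by metis
    show "\<forall>\<^sub>F t' in at t within ?S. f t' \<in> V"
      using ev[OF AB(1-4)]
    proof eventually_elim
      case (elim t')
      then obtain a' b' where "a' \<in> sym_algebra" "b' \<in> sym_algebra" "t' = (j a', j b')" by auto
      then show ?case using AB(5)[of a a' b b'] AB(2,4) elim ab by (simp add: f)
    qed
  qed
  have dense: "UNIV \<subseteq> euclidean closure_of ?S"
    by (simp add: closure_Times j_dense)
  obtain g where g: "continuous_map (subtopology euclidean UNIV) euclidean g" "\<And>x. x \<in> ?S \<Longrightarrow> g x = f x"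
  proof (rule continuous_map_extension_pointwise_alt[OF regular_space_topological_group subset_UNIV dense, of f])
    show "continuous_map (top_of_set ?S) euclidean f" using cont by simp
    show "\<exists>l. limitin euclidean f l (atin_within euclidean t ?S)" for t
    proof -
      have "atin_within euclidean t ?S = at t within ?S"
        by (simp add: atin_within_def at_within_def nhdsin_def nhds_def)
      then show ?thesis using lim[of t] by (simp add: limitin_canonical_iff)
    qed
  qed blast
  have "continuous_on UNIV g" using g(1) by simp
  then show ?thesis
    using g(2) f by (intro exI[of _ "\<lambda>x y. g (x, y)"]) (auto simp: case_prod_unfold)
qed

abbreviation hat (infixl "\<odot>" 70) where "x \<odot> y \<equiv> star_hat j \<Lambda> z x y"

lemma star_hat: "continuous_on UNIV (\<lambda>(x, y). x \<odot> y)"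
  and star_hat_j: "a \<in> sym_algebra \<Longrightarrow> b \<in> sym_algebra \<Longrightarrow> j a \<odot> j b = j (star \<Lambda> z a b)"
proof -
  let ?P = "\<lambda>g. continuous_on UNIV (\<lambda>(x, y). g x y) \<and> (\<forall>a\<in>sym_algebra. \<forall>b\<in>sym_algebra. g (j a) (j b) = j (star \<Lambda> z a b))"
  obtain g where g: "?P g" using star_extension by blast
  have uniq: "h = g" if h: "?P h" for h
  proof -
    let ?E = "{t. (\<lambda>(x, y). h x y) t = (\<lambda>(x, y). g x y) t}"
    have "closed ?E" using h g by (intro closed_Collect_eq) auto
    moreover have "j ` sym_algebra \<times> j ` sym_algebra \<subseteq> ?E" using h g by auto
    ultimately have "closure (j ` sym_algebra \<times> j ` sym_algebra) \<subseteq> ?E" by (rule closure_minimal[rotated])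
    moreover have "(x, y) \<in> closure (j ` sym_algebra \<times> j ` sym_algebra)" for x y
      by (simp add: closure_Times j_dense)
    ultimately have "(x, y) \<in> ?E" for x y by blast
    then show ?thesis by (simp add: fun_eq_iff)
  qed
  have "star_hat j \<Lambda> z = g"
    unfolding star_hat_def cont_ext2_def by (rule the_equality[where P = ?P, OF g uniq])
  then show "continuous_on UNIV (\<lambda>(x, y). x \<odot> y)" "a \<in> sym_algebra \<Longrightarrow> b \<in> sym_algebra \<Longrightarrow> j a \<odot> j b = j (star \<Lambda> z a b)"
    using g by auto
qed

lemma continuous_on_star_hat [continuous_intros]:
  assumes "continuous_on A f" "continuous_on A g"
  shows "continuous_on A (\<lambda>x. f x \<odot> g x)"
  using continuous_on_compose2[OF star_hat continuous_on_Pair[OF assms]] by simp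

lemma tendsto_star_hat:
  assumes "(f \<longlongrightarrow> a) F" "(g \<longlongrightarrow> b) F"
  shows "((\<lambda>x. f x \<odot> g x) \<longlongrightarrow> a \<odot> b) F"
proof -
  have "isCont (\<lambda>(x, y). x \<odot> y) (a, b)"
    using star_hat by (simp add: continuous_on_eq_continuous_at)
  from isCont_tendsto_compose[OF this tendsto_Pair[OF assms]] show ?thesis by simp
qed

text \<open>Density is applied to one variable at a time, while the variables not yet treated stay
  in the image of \<open>j\<close>. The other algebraic laws follow the same pattern.\<close>

lemma star_hat_add_right: "x \<odot> (y + y') = x \<odot> y + x \<odot> y'"
proof -
  have 1: "j a \<odot> (j b + y') = j a \<odot> j b + j a \<odot> y'" if "a \<in> sym_algebra" "b \<in> sym_algebra" for a b
    by (rule dense_eq[where x = y' and f = "\<lambda>t. j a \<odot> (j b + t)" and g = "\<lambda>t. j a \<odot> j b + j a \<odot> t"])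
      (intro continuous_intros, intro continuous_intros, simp add: that star_hat_j star_add_right flip: j_add)
  have 2: "j a \<odot> (y + y') = j a \<odot> y + j a \<odot> y'" if "a \<in> sym_algebra" for a
    by (rule dense_eq[where x = y and f = "\<lambda>t. j a \<odot> (t + y')" and g = "\<lambda>t. j a \<odot> t + j a \<odot> y'"])
      (intro continuous_intros, intro continuous_intros, simp add: 1 that)
  show ?thesis
    by (rule dense_eq[where x = x and f = "\<lambda>t. t \<odot> (y + y')" and g = "\<lambda>t. t \<odot> y + t \<odot> y'"])
      (intro continuous_intros, intro continuous_intros, simp add: 2)
qed

lemma star_hat_add_left: "(x + x') \<odot> y = x \<odot> y + x' \<odot> y"
proof -
  have 1: "(j a + x') \<odot> j b = j a \<odot> j b + x' \<odot> j b" if "a \<in> sym_algebra" "b \<in> sym_algebra" for a b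
    by (rule dense_eq[where x = x' and f = "\<lambda>t. (j a + t) \<odot> j b" and g = "\<lambda>t. j a \<odot> j b + t \<odot> j b"])
      (intro continuous_intros, intro continuous_intros, simp add: that star_hat_j star_add_left flip: j_add)
  have 2: "(x + x') \<odot> j b = x \<odot> j b + x' \<odot> j b" if "b \<in> sym_algebra" for b
    by (rule dense_eq[where x = x and f = "\<lambda>t. (t + x') \<odot> j b" and g = "\<lambda>t. t \<odot> j b + x' \<odot> j b"])
      (intro continuous_intros, intro continuous_intros, simp add: 1 that)
  show ?thesis
    by (rule dense_eq[where x = y and f = "\<lambda>t. (x + x') \<odot> t" and g = "\<lambda>t. x \<odot> t + x' \<odot> t"])
      (intro continuous_intros, intro continuous_intros, simp add: 2)
qed

lemma continuous_on_scaleW [continuous_intros]: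
  assumes "continuous_on A f"
  shows "continuous_on A (\<lambda>x. scaleW c (f x))"
  using continuous_on_compose2[OF scaleW_cont continuous_on_Pair[OF continuous_on_const assms]] by simp

lemma star_hat_scale: "scaleW c x \<odot> y = scaleW c (x \<odot> y)" "x \<odot> scaleW c y = scaleW c (x \<odot> y)"
proof -
  have 1: "scaleW c (j a) \<odot> y = scaleW c (j a \<odot> y)" if "a \<in> sym_algebra" for a
    by (rule dense_eq[where x = y and f = "\<lambda>t. scaleW c (j a) \<odot> t" and g = "\<lambda>t. scaleW c (j a \<odot> t)"])
      (intro continuous_intros, intro continuous_intros, simp add: that star_hat_j star_scale_left flip: j_scale)
  have 2: "j a \<odot> scaleW c y = scaleW c (j a \<odot> y)" if "a \<in> sym_algebra" for a
    by (rule dense_eq[where x = y and f = "\<lambda>t. j a \<odot> scaleW c t" and g = "\<lambda>t. scaleW c (j a \<odot> t)"])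
      (intro continuous_intros, intro continuous_intros, simp add: that star_hat_j star_scale_right flip: j_scale)
  show "scaleW c x \<odot> y = scaleW c (x \<odot> y)"
    by (rule dense_eq[where x = x and f = "\<lambda>t. scaleW c t \<odot> y" and g = "\<lambda>t. scaleW c (t \<odot> y)"])
      (intro continuous_intros, intro continuous_intros, simp add: 1)
  show "x \<odot> scaleW c y = scaleW c (x \<odot> y)"
    by (rule dense_eq[where x = x and f = "\<lambda>t. t \<odot> scaleW c y" and g = "\<lambda>t. scaleW c (t \<odot> y)"])
      (intro continuous_intros, intro continuous_intros, simp add: 2)
qed

lemma star_hat_assoc: "x \<odot> y \<odot> v = x \<odot> (y \<odot> v)"
proof -
  have 1: "j a \<odot> j b \<odot> v = j a \<odot> (j b \<odot> v)" if "a \<in> sym_algebra" "b \<in> sym_algebra" for a b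
    by (rule dense_eq[where x = v and f = "\<lambda>t. j a \<odot> j b \<odot> t" and g = "\<lambda>t. j a \<odot> (j b \<odot> t)"])
      (intro continuous_intros, intro continuous_intros, simp add: that star_hat_j star_assoc)
  have 2: "j a \<odot> y \<odot> v = j a \<odot> (y \<odot> v)" if "a \<in> sym_algebra" for a
    by (rule dense_eq[where x = y and f = "\<lambda>t. j a \<odot> t \<odot> v" and g = "\<lambda>t. j a \<odot> (t \<odot> v)"])
      (intro continuous_intros, intro continuous_intros, simp add: 1 that)
  show ?thesis
    by (rule dense_eq[where x = x and f = "\<lambda>t. t \<odot> y \<odot> v" and g = "\<lambda>t. t \<odot> (y \<odot> v)"])
      (intro continuous_intros, intro continuous_intros, simp add: 2)
qed

lemma unit_S: "unit \<in> sym_algebra"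
  by (simp add: unit_eq)

lemma star_hat_unit: "j unit \<odot> x = x" "x \<odot> j unit = x"
proof -
  show "j unit \<odot> x = x"
    by (rule dense_eq[where x = x and f = "\<lambda>t. j unit \<odot> t" and g = "\<lambda>t. t"])
      (intro continuous_intros, intro continuous_intros, simp add: star_hat_j unit_S star_unit_left)
  show "x \<odot> j unit = x"
    by (rule dense_eq[where x = x and f = "\<lambda>t. t \<odot> j unit" and g = "\<lambda>t. t"])
      (intro continuous_intros, intro continuous_intros, simp add: star_hat_j unit_S star_unit_right)
qed

subsection \<open>Convergence in the completion\<close>

lemma j_tendsto:
  assumes "\<And>n. X n \<in> sym_algebra" "a \<in> sym_algebra"
    and "\<And>p e. cont_seminorm scale p \<Longrightarrow> e > 0 \<Longrightarrow> \<forall>\<^sub>F n in sequentially. weyl_seminorm R p (X n - a) < e"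
  shows "(\<lambda>n. j (X n)) \<longlonglongrightarrow> j a"
proof (rule topological_tendstoI)
  fix U assume "open U" "j a \<in> U"
  then obtain p e where "cont_seminorm scale p" "e > 0" "\<And>b. b \<in> sym_algebra \<Longrightarrow> weyl_seminorm R p (b - a) < e \<Longrightarrow> j b \<in> U"
    using j_nhds[OF _ assms(2)] by metis
  with assms(3)[of p e] assms(1) show "\<forall>\<^sub>F n in sequentially. j (X n) \<in> U"
    by (auto elim: eventually_mono)
qed

lemma exp_term_sums:
  assumes w: "w \<in> V0"
  shows "(\<lambda>N. j (\<Sum>n<N. exp_term w n)) \<longlonglongrightarrow> Exp_star scaleW j \<Lambda> z w"
proof -
  let ?X = "\<lambda>N. j (\<Sum>n<N. exp_term w n)"
  have "cauchy_filter (filtermap ?X sequentially)"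
  proof (rule cauchy_filterI)
    fix U :: "'w set" assume U: "open U" "0 \<in> U"
    \<comment> \<open>The estimate of the blocks \<open>{m..<n}\<close> covers differences with m
      \<le> n only; a symmetric neighbourhood takes care of the opposite order.\<close>
    have "open ((\<lambda>u. - u) -` U \<inter> U)" using U(1) by (auto intro!: open_Int open_vimage continuous_intros)
    moreover have "j 0 \<in> (\<lambda>u. - u) -` U \<inter> U" using U(2) by (simp add: j_0)
    ultimately obtain p e where p: "cont_seminorm scale p" "e > 0"
      "\<And>b. b \<in> sym_algebra \<Longrightarrow> weyl_seminorm R p (b - 0) < e \<Longrightarrow> j b \<in> (\<lambda>u. - u) -` U \<inter> U"
      using j_nhds[of "(\<lambda>u. - u) -` U \<inter> U" 0] by (metis S_0)
    have sp: "seminorm scale p" using p(1) by (simp add: cont_seminorm_def)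
    obtain \<gamma> where \<gamma>: "summable \<gamma>" "\<And>n. \<gamma> n \<ge> 0" "\<And>n. dominated (weight R p) (exp_term w n) (\<gamma> n)"
      using exp_term_dominated[OF p(1) R_less] by blast
    obtain M where M: "\<And>m n. m \<ge> M \<Longrightarrow> norm (sum \<gamma> {m..<n}) < e"
      using \<gamma>(1) p(2) unfolding summable_Cauchy by blast
    have le: "j (\<Sum>k\<in>{m..<n}. exp_term w k) \<in> (\<lambda>u. - u) -` U \<inter> U" if "m \<ge> M" for m n
    proof (rule p(3))
      have "dominated (weight R p) (\<Sum>k\<in>{m..<n}. exp_term w k) (sum \<gamma> {m..<n})"
        by (intro dominated_sum \<gamma>)
      then show "weyl_seminorm R p ((\<Sum>k\<in>{m..<n}. exp_term w k) - 0) < e"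
        using weyl_seminorm_le[OF sp] M[OF that, of n] by fastforce
    qed (simp add: exp_term_S)
    have step: "?X n - ?X m = j (\<Sum>k\<in>{m..<n}. exp_term w k)" if "m \<le> n" for m n
    proof -
      have "(\<Sum>k<n. exp_term w k) - (\<Sum>k<m. exp_term w k) = (\<Sum>k\<in>{m..<n}. exp_term w k)"
        using that sum_diff_nat_ivl[of 0 m n "exp_term w"] by (simp add: lessThan_atLeast0)
      then show ?thesis by (simp add: exp_term_S flip: j_diff)
    qed
    have "?X n - ?X m \<in> U" if mn: "m \<ge> M" "n \<ge> M" for m n
    proof (cases "m \<le> n")
      case True
      then show ?thesis using step le mn by auto
    next
      case False
      then have "- (?X m - ?X n) \<in> U" using step[of n m] le[of n m] mn by auto
      then show ?thesis by simp
    qed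
    then show "\<exists>P. eventually P (filtermap ?X sequentially) \<and> (\<forall>x y. P x \<longrightarrow> P y \<longrightarrow> y - x \<in> U)"
      by (intro exI[of _ "\<lambda>x. \<exists>n\<ge>M. x = ?X n"]) (auto simp: eventually_filtermap eventually_sequentially)
  qed
  then obtain u where u: "?X \<longlonglongrightarrow> u"
    using W_complete unfolding complete_uniform filterlim_def by (metis filtermap_bot_iff principal_UNIV sequentially_bot top_greatest)
  have "(\<lambda>n. scaleW (1 / fact n) (j (star_power \<Lambda> z (incl w) n))) = (\<lambda>n. j (exp_term w n))"
    using star_power_exp_term[OF w] j_scale by metis
  then have "(\<lambda>n. scaleW (1 / fact n) (j (star_power \<Lambda> z (incl w) n))) sums u"
    using u by (simp add: sums_def j_sum exp_term_S)
  then have "Exp_star scaleW j \<Lambda> z w = u"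
    unfolding Exp_star_def by (rule sums_unique[symmetric])
  then show ?thesis using u by simp
qed

subsection \<open>Conjugation by exponentials\<close>

lemma exp_term_0: "exp_term w 0 = unit"
  by (simp add: exp_term_def gauss_coeff_def sym_exp_term_def unit_eq)

lemma E_uminus: "E [- w] = - E [w]"
  using E_slot(2)[of "[]" "-1" w "[]"] by simp

text \<open>\<open>w\<close> commutes with the terms of its own exponential, since these are
  multiples of star powers of \<open>w\<close>.\<close>

lemma star_exp_term_right:
  assumes w: "w \<in> V0"
  shows "star \<Lambda> z (exp_term w n) (E [w]) = fscale (of_nat (Suc n)) (exp_term w (Suc n))"
proof -
  have "star \<Lambda> z (exp_term w n) (E [w]) = star \<Lambda> z (E [w]) (exp_term w n)"
  proof (induction n)
    case 0
    then show ?case by (simp add: exp_term_0 star_unit_left star_unit_right)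
  next
    case (Suc n)
    have X: "exp_term w (Suc n) = fscale (1 / of_nat (Suc n)) (star \<Lambda> z (E [w]) (exp_term w n))"
      by (simp add: star_exp_term[OF w] del: of_nat_Suc)
    show ?case
      unfolding X using Suc by (simp add: star_scale_left star_scale_right exp_term_S star_assoc)
  qed
  then show ?thesis by (simp add: star_exp_term[OF w])
qed

definition conj_term where
  "conj_term w a i l = star \<Lambda> z (star \<Lambda> z (exp_term w i) a) (exp_term (- w) l)"

lemma V0_uminus: "w \<in> V0 \<Longrightarrow> - w \<in> V0"
  using subspace_neg[OF subspace_V0] .

text \<open>Splitting k+1 into i and k+1-i turns (k+1) times the next diagonal sum into left minus
  right multiplication of the previous one by \<open>w\<close>, that is, into its commutator with
  \<open>w\<close>. Thus the diagonal sums obey the recursion of the terms of exp(D).\<close>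

lemma conj_sum:
  assumes w: "w \<in> V0" and a: "a \<in> sym_algebra"
  shows "(\<Sum>i\<le>k. conj_term w a i (k - i)) = fscale (1 / fact k) ((derv (\<lambda>v. z * (\<Lambda> w v - \<Lambda> v w)) ^^ k) a)"
proof (induction k)
  case 0
  then show ?case using a by (simp add: conj_term_def exp_term_0 star_unit_left star_unit_right)
next
  case (Suc k)
  let ?t = "\<lambda>k. \<Sum>i\<le>k. conj_term w a i (k - i)" and ?D = "derv (\<lambda>v. z * (\<Lambda> w v - \<Lambda> v w))"
  have cS: "conj_term w a i l \<in> sym_algebra" for i l by (simp add: conj_term_def a exp_term_S)
  have left: "star \<Lambda> z (E [w]) (conj_term w a i l) = fscale (of_nat (Suc i)) (conj_term w a (Suc i) l)" for i l
    using a by (simp add: conj_term_def exp_term_S star_scale_left star_exp_term[OF w] flip: star_assoc del: of_nat_Suc)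
  \<comment> \<open>The minus sign comes from the second exponential, whose terms are raised by
    \<open>- w\<close>.\<close>
  have right: "star \<Lambda> z (conj_term w a i l) (E [w]) = - fscale (of_nat (Suc l)) (conj_term w a i (Suc l))" for i l
  proof -
    have "star \<Lambda> z (conj_term w a i l) (E [- w]) = fscale (of_nat (Suc l)) (conj_term w a i (Suc l))"
      using a by (simp add: conj_term_def exp_term_S star_assoc star_scale_right star_exp_term_right[OF V0_uminus[OF w]] del: of_nat_Suc)
    moreover have "star \<Lambda> z (conj_term w a i l) (E [- w]) = - star \<Lambda> z (conj_term w a i l) (E [w])"
      using star_scale_right[OF cS S_E, of i l "-1" "[w]"] by (simp add: E_uminus)
    ultimately show ?thesis by (metis minus_minus)
  qed
  have "fscale (of_nat (Suc k)) (?t (Suc k)) = (\<Sum>i\<le>Suc k. fscale (of_nat i) (conj_term w a i (Suc k - i)) +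
      fscale (of_nat (Suc k - i)) (conj_term w a i (Suc k - i)))"
    unfolding fs.scale_sum_right
  proof (rule sum.cong)
    fix i assume "i \<in> {..Suc k}"
    then have "(of_nat (Suc k) :: 'k) = of_nat i + of_nat (Suc k - i)" by (simp flip: of_nat_add)
    then show "fscale (of_nat (Suc k)) (conj_term w a i (Suc k - i)) = fscale (of_nat i) (conj_term w a i (Suc k - i)) +
      fscale (of_nat (Suc k - i)) (conj_term w a i (Suc k - i))"
      by (simp only: fs.scale_left_distrib)
  qed simp
  also have "\<dots> = (\<Sum>i\<le>Suc k. fscale (of_nat i) (conj_term w a i (Suc k - i))) +
     (\<Sum>i\<le>Suc k. fscale (of_nat (Suc k - i)) (conj_term w a i (Suc k - i)))"
    by (rule sum.distrib)
  also have "(\<Sum>i\<le>Suc k. fscale (of_nat i) (conj_term w a i (Suc k - i))) =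
     (\<Sum>i\<le>k. star \<Lambda> z (E [w]) (conj_term w a i (k - i)))"
    unfolding sum.atMost_Suc_shift left by simp
  also have "(\<Sum>i\<le>Suc k. fscale (of_nat (Suc k - i)) (conj_term w a i (Suc k - i))) =
     (\<Sum>i\<le>k. - star \<Lambda> z (conj_term w a i (k - i)) (E [w]))"
    unfolding right sum.atMost_Suc by (simp del: of_nat_Suc) (rule sum.cong, auto simp: Suc_diff_le)
  also have "(\<Sum>i\<le>k. star \<Lambda> z (E [w]) (conj_term w a i (k - i))) + \<dots> = ?D (?t k)"
    using cS by (simp add: star_commutator[OF w, symmetric] star_sum_left star_sum_right sum_negf)
  also have "\<dots> = fscale (1 / fact k) ((?D ^^ Suc k) a)"
    unfolding Suc.IH by (simp add: derv_scale)
  finally have "fscale (1 / of_nat (Suc k)) (fscale (of_nat (Suc k)) (?t (Suc k))) = fscale (1 / of_nat (Suc k)) (fscale (1 / fact k) ((?D ^^ Suc k) a))"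
    by (simp only:)
  then show ?case by (simp del: of_nat_Suc sum.atMost_Suc funpow.simps)
qed

lemma sharp_par_form:
  assumes w: "w \<in> V0"
  shows "par_form False (\<lambda>v. z * (\<Lambda> w v - \<Lambda> v w))"
proof -
  have "lin_form (\<lambda>v. z * (\<Lambda> w v - \<Lambda> v w))"
    using lin_form_add[OF Lambda_lin(1)] lin_form_scale[OF Lambda_lin(1)]
      lin_form_add[OF Lambda_lin(2)] lin_form_scale[OF Lambda_lin(2)]
    by (simp add: lin_form_def algebra_simps)
  moreover have "z * (\<Lambda> w (pr True v) - \<Lambda> (pr True v) w) = 0" for v
    using w Lambda_even pr_in[of True v] by (simp add: even_bilinear_form_def Vpar_def)
  ultimately show ?thesis by (simp add: par_form_def)
qed

text \<open>Square and triangle sums have the same limit, the product of the two series.\<close>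

lemma Cauchy_square_sums:
  fixes \<gamma> \<delta> :: "nat \<Rightarrow> real"
  assumes "summable \<gamma>" "summable \<delta>" "\<And>n. \<gamma> n \<ge> 0" "\<And>n. \<delta> n \<ge> 0"
  shows "(\<lambda>N. \<Sum>(i, l)\<in>{(i, l). i < N \<and> l < N \<and> N \<le> i + l}. \<gamma> i * \<delta> l) \<longlonglongrightarrow> 0"
proof -
  have "(\<lambda>N. \<Sum>k<N. \<Sum>i\<le>k. \<gamma> i * \<delta> (k - i)) \<longlonglongrightarrow> suminf \<gamma> * suminf \<delta>"
    using Cauchy_product_sums[of \<gamma> \<delta>] assms by (simp add: sums_def)
  moreover have "(\<lambda>N. (\<Sum>i<N. \<gamma> i) * (\<Sum>l<N. \<delta> l)) \<longlonglongrightarrow> suminf \<gamma> * suminf \<delta>"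
    using assms(1,2) by (intro tendsto_mult summable_LIMSEQ)
  ultimately have "(\<lambda>N. (\<Sum>i<N. \<gamma> i) * (\<Sum>l<N. \<delta> l) - (\<Sum>k<N. \<Sum>i\<le>k. \<gamma> i * \<delta> (k - i))) \<longlonglongrightarrow> 0"
    using tendsto_diff by fastforce
  moreover have "(\<Sum>i<N. \<gamma> i) * (\<Sum>l<N. \<delta> l) - (\<Sum>k<N. \<Sum>i\<le>k. \<gamma> i * \<delta> (k - i)) =
     (\<Sum>(i, l)\<in>{(i, l). i < N \<and> l < N \<and> N \<le> i + l}. \<gamma> i * \<delta> l)" for N
    using square_minus_triangle[where N = N and F = "\<lambda>i l. \<gamma> i * \<delta> l"] by (simp add: sum_product)
  ultimately show ?thesis by simp
qed

text \<open>From \<open>N0\<close> on, the diagonal sums already add up to \<open>tauT\<close>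
  exactly, because D is locally nilpotent. The whole error is the part of the square beyond the
  diagonal, which \<open>Cauchy_square_sums\<close> controls.\<close>

lemma conj_tendsto:
  assumes w: "w \<in> V0" and a: "a \<in> sym_algebra"
  shows "(\<lambda>N. j (star \<Lambda> z (star \<Lambda> z (\<Sum>i<N. exp_term w i) a) (\<Sum>l<N. exp_term (- w) l)))
    \<longlonglongrightarrow> j (tauT (\<lambda>v. z * (\<Lambda> w v - \<Lambda> v w)) a)"
proof (rule j_tendsto)
  let ?\<phi> = "\<lambda>v. z * (\<Lambda> w v - \<Lambda> v w)"
  let ?C = "\<lambda>N. star \<Lambda> z (star \<Lambda> z (\<Sum>i<N. exp_term w i) a) (\<Sum>l<N. exp_term (- w) l)"
  note phi = sharp_par_form[OF w]
  show "?C N \<in> sym_algebra" for N using a by (simp add: exp_term_S)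
  show "tauT ?\<phi> a \<in> sym_algebra" by (rule tauT_S[OF phi a])
  fix p and e :: real assume p: "cont_seminorm scale p" and e: "e > 0"
  have sp: "seminorm scale p" using p by (simp add: cont_seminorm_def)
  \<comment> \<open>Seminorms are chosen from the outer product inwards: \<open>q\<close> for the
    factors of the outer one, \<open>r\<close> for those of the inner one.\<close>
  obtain q where q: "cont_seminorm scale q"
    "\<And>a b A B. a \<in> sym_algebra \<Longrightarrow> b \<in> sym_algebra \<Longrightarrow>
      dominated (weight R q) a A \<Longrightarrow> dominated (weight R q) b B \<Longrightarrow> dominated (weight R p) (star \<Lambda> z a b) (A * B)"
    using star_continuous[OF p R_ge less_imp_le[OF R_less]] by blast
  obtain r where r: "cont_seminorm scale r"
    "\<And>a b A B. a \<in> sym_algebra \<Longrightarrow> b \<in> sym_algebra \<Longrightarrow>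
      dominated (weight R r) a A \<Longrightarrow> dominated (weight R r) b B \<Longrightarrow> dominated (weight R q) (star \<Lambda> z a b) (A * B)"
    using star_continuous[OF q(1) R_ge less_imp_le[OF R_less]] by blast
  have sr: "seminorm scale r" using r(1) by (simp add: cont_seminorm_def)
  obtain \<gamma> where \<gamma>: "summable \<gamma>" "\<And>n. \<gamma> n \<ge> 0" "\<And>n. dominated (weight R r) (exp_term w n) (\<gamma> n)"
    using exp_term_dominated[OF r(1) R_less] by blast
  obtain \<delta> where \<delta>: "summable \<delta>" "\<And>n. \<delta> n \<ge> 0" "\<And>n. dominated (weight R q) (exp_term (- w) n) (\<delta> n)"
    using exp_term_dominated[OF q(1) R_less] by blast
  \<comment> \<open>The 1 is added because \<open>dominated_weyl_seminorm\<close> needs a strict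
    bound.\<close>
  define A where "A = weyl_seminorm R r a + 1"
  have dA: "dominated (weight R r) a A"
    by (rule dominated_weyl_seminorm[OF sr S_T[OF a]]) (simp add: A_def)
  have dom: "dominated (weight R p) (conj_term w a i l) (\<gamma> i * A * \<delta> l)" for i l
    unfolding conj_term_def using a by (intro q(2) r(2) \<gamma> \<delta> dA) (auto simp: exp_term_S)
  obtain N0 where N0: "\<And>N. N \<ge> N0 \<Longrightarrow> (\<Sum>k<N. fscale (1 / fact k) ((derv ?\<phi> ^^ k) a)) = tauT ?\<phi> a"
    using tauT_exp[OF phi a] by blast
  let ?R = "\<lambda>N. {(i, l). i < N \<and> l < N \<and> N \<le> i + l}"
  have diff: "?C N - tauT ?\<phi> a = (\<Sum>(i, l)\<in>?R N. conj_term w a i l)" if "N \<ge> N0" for N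
  proof -
    have "?C N = (\<Sum>i<N. \<Sum>l<N. conj_term w a i l)"
      using a by (simp add: star_sum_left star_sum_right exp_term_S conj_term_def) (rule sum.swap)
    moreover have "tauT ?\<phi> a = (\<Sum>k<N. \<Sum>i\<le>k. conj_term w a i (k - i))"
      unfolding conj_sum[OF w a] using N0[OF that] by simp
    ultimately show ?thesis by (simp add: square_minus_triangle)
  qed
  have dR: "dominated (weight R p) (\<Sum>(i, l)\<in>?R N. conj_term w a i l) (\<Sum>(i, l)\<in>?R N. \<gamma> i * A * \<delta> l)" for N
    unfolding case_prod_unfold by (rule dominated_sum) (rule dom)
  have A: "(\<Sum>(i, l)\<in>?R N. \<gamma> i * A * \<delta> l) = A * (\<Sum>(i, l)\<in>?R N. \<gamma> i * \<delta> l)" for N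
    by (simp add: sum_distrib_left case_prod_unfold mult_ac)
  have le: "weyl_seminorm R p (?C N - tauT ?\<phi> a) \<le> A * (\<Sum>(i, l)\<in>?R N. \<gamma> i * \<delta> l)" if "N \<ge> N0" for N
    unfolding diff[OF that] A[symmetric] by (rule weyl_seminorm_le[OF sp dR])
  have "(\<lambda>N. A * (\<Sum>(i, l)\<in>?R N. \<gamma> i * \<delta> l)) \<longlonglongrightarrow> 0"
    using tendsto_mult_right_zero[OF Cauchy_square_sums[OF \<gamma>(1) \<delta>(1) \<gamma>(2) \<delta>(2)]] .
  from order_tendstoD(2)[OF this e] eventually_ge_at_top[of N0]
  show "\<forall>\<^sub>F N in sequentially. weyl_seminorm R p (?C N - tauT ?\<phi> a) < e"
    by eventually_elim (use le in fastforce)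
qed

lemma conj_exp:
  assumes w: "w \<in> V0" and a: "a \<in> sym_algebra"
  shows "Exp_star scaleW j \<Lambda> z w \<odot> j a \<odot> Exp_star scaleW j \<Lambda> z (- w) = j (tauT (\<lambda>v. z * (\<Lambda> w v - \<Lambda> v w)) a)"
proof (rule LIMSEQ_unique)
  have "(\<lambda>N. j (\<Sum>i<N. exp_term w i) \<odot> j a \<odot> j (\<Sum>l<N. exp_term (- w) l))
     \<longlonglongrightarrow> Exp_star scaleW j \<Lambda> z w \<odot> j a \<odot> Exp_star scaleW j \<Lambda> z (- w)"
    by (intro tendsto_star_hat exp_term_sums w V0_uminus tendsto_const)
  then show "(\<lambda>N. j (star \<Lambda> z (star \<Lambda> z (\<Sum>i<N. exp_term w i) a) (\<Sum>l<N. exp_term (- w) l)))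
    \<longlonglongrightarrow> Exp_star scaleW j \<Lambda> z w \<odot> j a \<odot> Exp_star scaleW j \<Lambda> z (- w)"
    using a by (simp add: star_hat_j exp_term_S)
qed (rule conj_tendsto[OF assms])

text \<open>Conjugation applied to the unit, which the translation fixes.\<close>

lemma exp_inverse:
  assumes w: "w \<in> V0"
  shows "Exp_star scaleW j \<Lambda> z w \<odot> Exp_star scaleW j \<Lambda> z (- w) = j unit"
proof -
  note phi = sharp_par_form[OF w]
  have "tauT (\<lambda>v. z * (\<Lambda> w v - \<Lambda> v w)) unit = unit"
    using tauT_automorphism[OF phi] by (simp add: unital_algebra_automorphism_def unit_S)
  then show ?thesis using conj_exp[OF w unit_S] by (simp add: star_hat_unit)
qed

lemma sharp_even:
  assumes "w \<in> V0"
  shows "2 * z * sharp \<Lambda> w v = z * (\<Lambda> w v - \<Lambda> v w)"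
proof -
  have p: "proj_along V0 V1 = pr False" "proj_along V1 V0 = pr True" by (simp_all add: pr_def)
  have w: "pr False w = w" "pr True w = 0"
    using assms by (auto simp: pr_same pr_other Vpar_def)
  have "\<Lambda> w v = \<Lambda> w (pr False v) + \<Lambda> w (pr True v)" "\<Lambda> v w = \<Lambda> (pr False v) w + \<Lambda> (pr True v) w"
    using lin_form_add[OF Lambda_lin(1)] lin_form_add[OF Lambda_lin(2)] by (metis pr_sum)+
  then show ?thesis
    by (simp add: sharp_def Lambda_minus_def p w Let_def lin_form_0[OF Lambda_lin(1)] lin_form_0[OF Lambda_lin(2)] algebra_simps)
qed

text \<open>The conjugation is continuous and agrees with \<open>tau \<phi>\<close> on a dense
  subset. So the continuous extension exists without an estimate for \<open>tau \<phi>\<close>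
  itself.\<close>

lemma tau_hat_eq:
  assumes w: "w \<in> V0" and \<phi>: "\<phi> = (\<lambda>v. 2 * z * sharp \<Lambda> w v)"
  shows "tau_hat j \<phi> x = Exp_star scaleW j \<Lambda> z w \<odot> x \<odot> Exp_star scaleW j \<Lambda> z (- w)"
proof -
  let ?g = "\<lambda>x. Exp_star scaleW j \<Lambda> z w \<odot> x \<odot> Exp_star scaleW j \<Lambda> z (- w)"
  have \<phi>': "\<phi> = (\<lambda>v. z * (\<Lambda> w v - \<Lambda> v w))" by (simp only: \<phi> sharp_even[OF w])
  have par: "par_form False \<phi>" unfolding \<phi>' by (rule sharp_par_form[OF w])
  have g: "continuous_on UNIV ?g \<and> (\<forall>a\<in>sym_algebra. ?g (j a) = j (tau \<phi> a))"
  proof (intro conjI ballI)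
    show "continuous_on UNIV ?g" by (intro continuous_intros)
    show "?g (j a) = j (tau \<phi> a)" if "a \<in> sym_algebra" for a
    proof -
      have "tau \<phi> a = tauT \<phi> a" by (rule tau_eq[OF par that])
      then show ?thesis by (simp only: conj_exp[OF w that] \<phi>')
    qed
  qed
  have "tau_hat j \<phi> = ?g"
    unfolding tau_hat_def cont_ext1_def
  proof (rule the_equality[where P = "\<lambda>g. continuous_on UNIV g \<and> (\<forall>a\<in>sym_algebra. g (j a) = j (tau \<phi> a))", OF g])
    fix h assume h: "continuous_on UNIV h \<and> (\<forall>a\<in>sym_algebra. h (j a) = j (tau \<phi> a))"
    show "h = ?g"
      by (rule ext, rule dense_eq) (use g h in auto)
  qed
  then show ?thesis by simp
qed

lemma inner_automorphism_tau_hat: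
  assumes w: "w \<in> V0" and \<phi>: "\<phi> = (\<lambda>v. 2 * z * sharp \<Lambda> w v)"
  shows "inner_automorphism scaleW UNIV (star_hat j \<Lambda> z) (j unit) (tau_hat j \<phi>)"
proof -
  let ?u = "Exp_star scaleW j \<Lambda> z w" and ?u' = "Exp_star scaleW j \<Lambda> z (- w)"
  have inv: "?u \<odot> ?u' = j unit" "?u' \<odot> ?u = j unit"
    using exp_inverse[OF w] exp_inverse[OF V0_uminus[OF w]] by simp_all
  have inv': "?u \<odot> (?u' \<odot> x) = x" "?u' \<odot> (?u \<odot> x) = x" for x
    unfolding star_hat_assoc[symmetric] inv star_hat_unit by (rule refl)+
  have t: "tau_hat j \<phi> = (\<lambda>x. ?u \<odot> x \<odot> ?u')"
    by (rule ext) (rule tau_hat_eq[OF w \<phi>])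
  have "bij (\<lambda>x. ?u \<odot> x \<odot> ?u')"
    by (rule o_bij[of "\<lambda>x. ?u' \<odot> x \<odot> ?u"]) (simp_all add: fun_eq_iff star_hat_assoc inv inv' star_hat_unit)
  then have "unital_algebra_automorphism scaleW UNIV (star_hat j \<Lambda> z) (j unit) (tau_hat j \<phi>)"
    unfolding unital_algebra_automorphism_def t
    by (simp add: star_hat_add_left star_hat_add_right star_hat_scale star_hat_assoc inv inv' star_hat_unit)
  then show ?thesis
    unfolding inner_automorphism_def
    by (rule conjI, intro bexI[where x = ?u] bexI[where x = ?u']) (simp_all add: inv t)
qed

end

section \<open>Existence of an even vector with the prescribed commutator\<close>

context graded_lcs_form
begin

text \<open>A preimage of \<phi> under \<open>sharp\<close> may have an odd component, but that one
  pairs with odd vectors only, where \<phi> vanishes. Hence the even component, divided by 2 z,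
  solves the equation.\<close>

lemma even_sharp_preimage:
  assumes \<phi>: "continuous_linear_form \<phi>" "even_linear_form \<phi>" "\<phi> \<in> range (sharp \<Lambda>)" and z: "z \<noteq> 0"
  shows "\<exists>w\<in>V0. (\<lambda>v. 2 * z * sharp \<Lambda> w v) = \<phi>"
proof -
  obtain v where v: "\<phi> = sharp \<Lambda> v" using \<phi>(3) by blast
  let ?v0 = "pr False v" and ?w = "scale (1 / (2 * z)) (pr False v)"
  have p: "proj_along V0 V1 = pr False" "proj_along V1 V0 = pr True" by (simp_all add: pr_def)
  have lin: "lin_form \<phi>" using \<phi>(1) by (simp add: continuous_linear_form_def linear_iff_lin_form)
  have z0: "\<Lambda> 0 x = 0" "\<Lambda> x 0 = 0" for x
    using lin_form_0[OF Lambda_lin(1)] lin_form_0[OF Lambda_lin(2)] by auto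
  have ev: "\<Lambda> (pr False x) (pr True y) = 0" "\<Lambda> (pr True x) (pr False y) = 0" for x y
    using Lambda_even pr_in[of False] pr_in[of True] by (simp_all add: even_bilinear_form_def Vpar_def)
  have "2 * z * sharp \<Lambda> ?w x = \<phi> x" for x
  proof -
    have "\<phi> x = \<phi> (pr False x) + \<phi> (pr True x)"
      using lin_form_add[OF lin, of "pr False x" "pr True x"] by (simp add: pr_sum)
    also have "\<phi> (pr True x) = 0"
      using \<phi>(2) pr_in[of True x] by (simp add: even_linear_form_def Vpar_def)
    finally have "\<phi> x = 1/2 * (\<Lambda> ?v0 (pr False x) - \<Lambda> (pr False x) ?v0)"
      by (simp add: v sharp_def Lambda_minus_def p Let_def ev z0)
    moreover have "sharp \<Lambda> ?w x = 1 / (2 * z) * (1/2 * (\<Lambda> ?v0 (pr False x) - \<Lambda> (pr False x) ?v0))"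
      by (simp add: sharp_def Lambda_minus_def p Let_def ev z0 pr_scale lin_form_scale[OF Lambda_lin(1)]
          lin_form_scale[OF Lambda_lin(2)] algebra_simps)
    ultimately have "sharp \<Lambda> ?w x = 1 / (2 * z) * \<phi> x" by (simp only:)
    then show ?thesis using z by simp
  qed
  moreover have "?w \<in> V0"
    using subspace_scale[OF subspace_V0] pr_in[of False v] by (simp add: Vpar_def)
  ultimately show ?thesis by blast
qed

end

theorem proposition5p6:
  fixes scale :: "'k::real_normed_field \<Rightarrow> 'v::{t2_space,topological_ab_group_add} \<Rightarrow> 'v"
    and V0 V1 :: "'v set"
    and \<Lambda> :: "'v \<Rightarrow> 'v \<Rightarrow> 'k"
    and R :: real
    and \<phi> :: "'v \<Rightarrow> 'k"
    and z :: 'k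
    and scaleW :: "'k \<Rightarrow> 'w \<Rightarrow> 'w::{t2_space,ab_group_add,uniform_topological_group_add}"
    and j :: "(('v list \<Rightarrow> 'k) \<Rightarrow> 'k) \<Rightarrow> 'w"
  assumes "graded_lcs scale V0 V1"
    and "graded_lcs.continuous_bilinear_form scale \<Lambda>"
    and "graded_lcs.even_bilinear_form V0 V1 \<Lambda>"
    and "1/2 \<le> R" and "R < 1"
    and "graded_lcs.is_completion scale V0 V1 R scaleW j"
    and "graded_lcs.continuous_linear_form scale \<phi>"
    and "graded_lcs.even_linear_form V1 \<phi>"
    and "\<phi> \<in> range (graded_lcs.sharp V0 V1 \<Lambda>)"
    and "z \<noteq> 0"
  shows "inner_automorphism scaleW UNIV
           (graded_lcs.star_hat scale V0 V1 j \<Lambda> z) (j (graded_lcs.unit scale))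
           (graded_lcs.tau_hat scale V0 V1 j \<phi>)
       \<and> (\<exists>w\<in>V0. (\<lambda>v. 2 * z * graded_lcs.sharp V0 V1 \<Lambda> w v) = \<phi>)
       \<and> (\<forall>w\<in>V0. (\<lambda>v. 2 * z * graded_lcs.sharp V0 V1 \<Lambda> w v) = \<phi> \<longrightarrow>
           (\<forall>a. graded_lcs.tau_hat scale V0 V1 j \<phi> a =
              graded_lcs.star_hat scale V0 V1 j \<Lambda> z
                (graded_lcs.star_hat scale V0 V1 j \<Lambda> z
                   (graded_lcs.Exp_star scale V0 V1 scaleW j \<Lambda> z w) a)
                (graded_lcs.Exp_star scale V0 V1 scaleW j \<Lambda> z (- w))))"
proof -
  interpret graded_lcs scale V0 V1 by fact
  interpret weyl_completion scale V0 V1 \<Lambda> z R scaleW j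
    by unfold_locales (use assms in auto)
  have ex: "\<exists>w\<in>V0. (\<lambda>v. 2 * z * sharp \<Lambda> w v) = \<phi>"
    by (rule even_sharp_preimage[OF assms(7-10)])
  then obtain w where "w \<in> V0" "\<phi> = (\<lambda>v. 2 * z * sharp \<Lambda> w v)" by blast
  then have "inner_automorphism scaleW UNIV (star_hat j \<Lambda> z) (j unit) (tau_hat j \<phi>)"
    by (rule inner_automorphism_tau_hat)
  then show ?thesis
    using ex tau_hat_eq by blast
qed

end
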